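(* Let $d>1$ be an integer, $0<p<1$, $n>2d-1$, and let $\xi_1,\dots,\xi_n$ be independent Bernoulli$(p)$ random variables, i.e. $\mathbb{P}[\xi_m=1]=1-\mathbb{P}[\xi_m=0]=p$. With indices understood cyclically ($\xi_{n+1}\equiv\xi_1$, $\xi_{n+2}\equiv\xi_2$, and so on), define for $i=1,\dots,d$ $$V_i:=\sum_{m=1}^n(\xi_m\xi_{m+1}\cdots\xi_{m+i-1}-p^i),\qquad W_i:=\frac{V_i}{\sqrt{np^i(1-p)}},$$ and $W=(W_1,\dots,W_d)^t$. Let $\Sigma=(\sigma_{i,j})_{i,j=1,\dots,d}$ be given by $$\sigma_{i,j}:=p^{|i-j|/2}\sum_{k=0}^{i\wedge j-1}(|i-j|+1+2k)p^k .$$ Then for every three times differentiable function $h:\mathbb{R}^d\to\mathbb{R}$, $$|\mathbb{E}h(W)-\mathbb{E}h(\Sigma^{1/2}Z)|\le\frac{416\,d^{7/2}|h|_2+960\,d^5|h|_3}{p^{d/2}(1-p)^{3/2}\sqrt n},$$ where $Z$ has the $d$-dimensional standard normal distribution.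
   Context: $i\wedge j=\min(i,j)$. $\Sigma^{1/2}$ is the unique symmetric nonnegative definite square root of $\Sigma$ ($\Sigma$ is the covariance matrix of $W$). For $h:\mathbb{R}^d\to\mathbb{R}$, with $\|\cdot\|$ the supremum norm, $|h|_2:=\sup_{i,j}\|\partial^2h/\partial x_i\partial x_j\|$ and $|h|_3:=\sup_{i,j,k}\|\partial^3h/\partial x_i\partial x_j\partial x_k\|$ (if one of these is infinite the bound has no content). *)

theory Defs
  imports "HOL-Probability.Probability"
begin

section \<open>Runs of successes on a circle\<close>

text \<open>Representative in \<open>{1..n}\<close> of the cyclic index \<open>m \<ge> 1\<close>, so that
  \<open>n + 1\<close> is read as \<open>1\<close>, etc.\<close>

definition cyc :: "nat \<Rightarrow> nat \<Rightarrow> nat" where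
  "cyc n m = Suc ((m - 1) mod n)"

definition runs_V :: "(nat \<Rightarrow> 'a \<Rightarrow> real) \<Rightarrow> nat \<Rightarrow> real \<Rightarrow> nat \<Rightarrow> 'a \<Rightarrow> real" where
  "runs_V \<xi> n p i \<omega> = (\<Sum>m=1..n. (\<Prod>k<i. \<xi> (cyc n (m + k)) \<omega>) - p ^ i)"

text \<open>Vectors in \<open>\<real>\<^sup>d\<close> have type \<open>real ^ 'd\<close> with \<open>d = CARD('d)\<close>. The coordinates are
  numbered by a bijection \<open>idx\<close> from \<open>'d\<close> onto \<open>{1..d}\<close>, so the coordinate \<open>a\<close> of the vector
  is its \<open>idx a\<close>-th entry.\<close>

definition runs_W ::
  "(nat \<Rightarrow> 'a \<Rightarrow> real) \<Rightarrow> nat \<Rightarrow> real \<Rightarrow> ('d::finite \<Rightarrow> nat) \<Rightarrow> 'a \<Rightarrow> real ^ 'd" where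
  "runs_W \<xi> n p idx \<omega> =
     (\<chi> a. runs_V \<xi> n p (idx a) \<omega> / sqrt (real n * p ^ idx a * (1 - p)))"

definition sigma :: "real \<Rightarrow> nat \<Rightarrow> nat \<Rightarrow> real" where
  "sigma p i j =
     p powr (\<bar>real i - real j\<bar> / 2) *
     (\<Sum>k<min i j. (\<bar>real i - real j\<bar> + 1 + 2 * real k) * p ^ k)"

definition Sigma_mat :: "real \<Rightarrow> ('d::finite \<Rightarrow> nat) \<Rightarrow> real ^ 'd ^ 'd" where
  "Sigma_mat p idx = (\<chi> a b. sigma p (idx a) (idx b))"

section \<open>Square roots of matrices and the standard normal distribution\<close>

definition nonneg_definite :: "real ^ 'd ^ 'd \<Rightarrow> bool" where
  "nonneg_definite A \<longleftrightarrow> (\<forall>x. 0 \<le> x \<bullet> (A *v x))"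

definition mat_sqrt :: "real ^ 'd ^ 'd \<Rightarrow> real ^ 'd ^ 'd" where
  "mat_sqrt S = (THE R. transpose R = R \<and> nonneg_definite R \<and> R ** R = S)"

definition std_normal_vector :: "'b measure \<Rightarrow> ('b \<Rightarrow> real ^ 'd::finite) \<Rightarrow> bool" where
  "std_normal_vector N Z \<longleftrightarrow>
     prob_space.indep_vars N (\<lambda>_. borel) (\<lambda>i \<omega>. Z \<omega> $ i) UNIV \<and>
     (\<forall>i. distributed N lborel (\<lambda>\<omega>. Z \<omega> $ i) std_normal_density)"

section \<open>Derivatives of functions of several variables\<close>

text \<open>Three times differentiable everywhere in the Frechet sense; \<open>h1\<close>, \<open>h2\<close>, \<open>h3\<close> are the
  successive derivatives, with values in spaces of continuous linear maps. The third derivative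
  need not be continuous.\<close>

definition three_times_differentiable :: "(real ^ 'd::finite \<Rightarrow> real) \<Rightarrow> bool" where
  "three_times_differentiable h \<longleftrightarrow>
     (\<exists>(h1 :: (real ^ 'd) \<Rightarrow> ((real ^ 'd) \<Rightarrow>\<^sub>L real))
       (h2 :: (real ^ 'd) \<Rightarrow> ((real ^ 'd) \<Rightarrow>\<^sub>L ((real ^ 'd) \<Rightarrow>\<^sub>L real)))
       (h3 :: (real ^ 'd) \<Rightarrow> ((real ^ 'd) \<Rightarrow>\<^sub>L ((real ^ 'd) \<Rightarrow>\<^sub>L ((real ^ 'd) \<Rightarrow>\<^sub>L real)))).
       \<forall>x. (h has_derivative blinfun_apply (h1 x)) (at x) \<and>
           (h1 has_derivative blinfun_apply (h2 x)) (at x) \<and>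
           (h2 has_derivative blinfun_apply (h3 x)) (at x))"

definition partial :: "'d::finite \<Rightarrow> (real ^ 'd \<Rightarrow> real) \<Rightarrow> real ^ 'd \<Rightarrow> real" where
  "partial i h x = deriv (\<lambda>t. h (x + t *\<^sub>R axis i 1)) 0"

text \<open>The suprema are extended reals, since they may be infinite.\<close>

definition seminorm2 :: "(real ^ 'd::finite \<Rightarrow> real) \<Rightarrow> ereal" where
  "seminorm2 h = (SUP i. SUP j. SUP x. ereal \<bar>partial i (partial j h) x\<bar>)"

definition seminorm3 :: "(real ^ 'd::finite \<Rightarrow> real) \<Rightarrow> ereal" where
  "seminorm3 h = (SUP i. SUP j. SUP k. SUP x. ereal \<bar>partial i (partial j (partial k h)) x\<bar>)"

end

(*
The bound follows from the third-derivative term alone, by Slepian's interpolation along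
the quarter circle combined with Stein's method for locally dependent summands. For a
centred Gaussian Y = Sigma^(1/2) Z independent of W, put
  Psi(t) = E h(sin t W + cos t Y),  so  Psi(pi/2) = E h(W)  and  Psi(0) = E h(Y).
Differentiating, and integrating by parts in the Gaussian variable,
  Psi'(t) = cos t E [ sum_k W_k h_k - sin t sum_(k,j) Sigma_kj h_jk ],
with the derivatives evaluated at sin t W + cos t Y. For a fixed value of Y the bracket is
small: W is a sum over the n starting positions of summands X_m which depend only on d
consecutive trials, so removing the neighbours of X_m from W makes the rest independent
of X_m, and Taylor expansion leaves n O(d^2) third-order moments of the X_m for each of
the d^3 coordinate triples. Since Cov W is exactly Sigma, the second-order terms cancel.
*)
theory Submission
  imports Defs "HOL-Real_Asymp.Real_Asymp"
begin

section \<open>Square roots of nonnegative definite matrices\<close>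

text \<open>On the circle sin^2 + cos^2 = 1, so the interpolant keeps the covariance Sigma, and its
  derivative has none of the end-point singularities of a square-root parametrisation; a bound on
  Psi' uniform in t costs only the length pi / 2. The third derivative of h may be discontinuous, so
  Taylor remainders come from the mean value inequality and carry C3 where an integral remainder
  would carry C3 / 2. This doubling, with at most 2 d neighbours per summand, gives 4 n d^3 (2 d)^2
  (2 C3) T = 32 d^5 C3 n T for the bracket, T bounding the third moments, and pi / 2 \<le> 2 makes
  it 64 d^5 C3 n T, below the 960 d^5 term. A bound on the second derivatives controls the growth of
  h and of its gradient, hence integrability and differentiation under the Gaussian integral. The
  trials are replaced by a finite weighted sum over success sets, so analytic questions arise on the
  Gaussian side alone.\<close>

lemma symmetric_matrix_inner:
  fixes A :: "real ^ 'n ^ 'n::finite"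
  assumes "transpose A = A"
  shows "x \<bullet> (A *v y) = (A *v x) \<bullet> y"
  by (metis assms dot_lmul_matrix transpose_matrix_vector)

text \<open>Maximise the quadratic form of A over the unit sphere of V. At a maximiser v the
  residual w = A v - l v lies in V and is orthogonal to v. Moving from v to v + t w would raise the
  form by 2 t |w|^2 to first order while changing |v|^2 only to second order, so w must
  vanish.\<close>

lemma symmetric_invariant_subspace_eigenvector:
  fixes A :: "real ^ 'n ^ 'n::finite"
  assumes sym: "transpose A = A" and V: "subspace V" and u: "u \<in> V" "u \<noteq> 0"
    and inv: "\<And>x. x \<in> V \<Longrightarrow> A *v x \<in> V"
  shows "\<exists>v\<in>V. norm v = 1 \<and> (\<exists>l. A *v v = l *\<^sub>R v)"
proof -
  let ?S = "V \<inter> sphere 0 1"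
  have "compact ?S"
    using closed_subspace[OF V] compact_sphere by (metis closed_Int_compact)
  moreover have "u /\<^sub>R norm u \<in> ?S"
    using u V by (auto intro: subspace_scale)
  then have "?S \<noteq> {}" by blast
  moreover have "continuous_on ?S (\<lambda>x. x \<bullet> (A *v x))"
    by (intro continuous_on_inner continuous_on_id matrix_vector_mult_linear_continuous_on)
  ultimately obtain v where v: "v \<in> ?S" and vmax: "\<And>x. x \<in> ?S \<Longrightarrow> x \<bullet> (A *v x) \<le> v \<bullet> (A *v v)"
    using continuous_attains_sup[of ?S "\<lambda>x. x \<bullet> (A *v x)"] by blast
  have nv: "norm v = 1" and vV: "v \<in> V" using v by auto
  have vv: "v \<bullet> v = 1" using nv by (simp add: norm_eq_1)
  define l where "l = v \<bullet> (A *v v)"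
  have le: "x \<bullet> (A *v x) \<le> l * (x \<bullet> x)" if "x \<in> V" for x
  proof (cases "x = 0")
    case False
    have "x /\<^sub>R norm x \<in> ?S"
      using that False V by (auto intro: subspace_scale)
    from vmax[OF this] have "inverse (norm x) * (inverse (norm x) * (x \<bullet> (A *v x))) \<le> l"
      by (simp only: l_def matrix_vector_mult_scaleR inner_scaleR_left inner_scaleR_right)
    then have "(x \<bullet> (A *v x)) / (norm x)\<^sup>2 \<le> l"
      by (simp only: power2_eq_square divide_inverse inverse_mult_distrib mult_ac)
    then show ?thesis
      using False by (simp add: pos_divide_le_eq power2_norm_eq_inner)
  qed simp
  define w where "w = A *v v - l *\<^sub>R v"
  have wV: "w \<in> V" unfolding w_def using inv vV V by (simp add: subspace_diff subspace_scale)
  have wv: "w \<bullet> v = 0"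
    unfolding w_def inner_diff_left inner_scaleR_left vv l_def by (simp add: inner_commute)
  have wAv: "w \<bullet> (A *v v) = w \<bullet> w"
  proof -
    have "A *v v = w + l *\<^sub>R v" by (simp add: w_def)
    then show ?thesis using wv by (simp add: inner_add_right)
  qed
  \<comment> \<open>The \<open>+ 1\<close> makes \<open>K\<close> positive, so that
    \<open>t = (w \<bullet> w) / K\<close> can be inserted in \<open>q\<close>, where a term linear
    in t is bounded by a quadratic one.\<close>
  define K where "K = \<bar>l * (w \<bullet> w) - w \<bullet> (A *v w)\<bar> + 1"
  have K: "K > 0" unfolding K_def by linarith
  have q: "2 * t * (w \<bullet> w) \<le> t\<^sup>2 * K" for t
  proof -
    have "(v + t *\<^sub>R w) \<bullet> (A *v (v + t *\<^sub>R w)) \<le> l * ((v + t *\<^sub>R w) \<bullet> (v + t *\<^sub>R w))"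
      using le[of "v + t *\<^sub>R w"] vV wV V by (simp add: subspace_add subspace_scale)
    also have "(v + t *\<^sub>R w) \<bullet> (A *v (v + t *\<^sub>R w)) = l + 2 * t * (w \<bullet> w) + t\<^sup>2 * (w \<bullet> (A *v w))"
      using symmetric_matrix_inner[OF sym, of v w] wAv
      by (simp add: matrix_vector_right_distrib matrix_vector_mult_scaleR inner_add l_def[symmetric]
          power2_eq_square inner_commute algebra_simps)
    also have "l * ((v + t *\<^sub>R w) \<bullet> (v + t *\<^sub>R w)) = l + t\<^sup>2 * (l * (w \<bullet> w))"
      using wv vv by (simp add: inner_add power2_eq_square inner_commute algebra_simps)
    finally have "2 * t * (w \<bullet> w) \<le> t\<^sup>2 * (l * (w \<bullet> w) - w \<bullet> (A *v w))"
      by (simp add: algebra_simps)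
    also have "\<dots> \<le> t\<^sup>2 * K" unfolding K_def by (intro mult_left_mono) auto
    finally show ?thesis .
  qed
  have "2 * (w \<bullet> w) \<le> w \<bullet> w"
  proof (cases "w \<bullet> w = 0")
    case False
    then have pos: "(w \<bullet> w)\<^sup>2 / K > 0" using K by simp
    have "2 * ((w \<bullet> w)\<^sup>2 / K) \<le> (w \<bullet> w)\<^sup>2 / K"
      using q[of "(w \<bullet> w) / K"] K by (simp add: power2_eq_square)
    then show ?thesis using pos by linarith
  qed simp
  then have "w \<bullet> w = 0" using inner_ge_zero[of w] by linarith
  then have "w = 0" by simp
  then show ?thesis using vV nv by (auto simp: w_def)
qed

text \<open>Take an orthonormal set of eigenvectors of largest cardinality. If it did not span, its
  orthogonal complement would be a nonzero subspace, invariant by symmetry of A, and would supply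
  one more eigenvector.\<close>

lemma symmetric_matrix_eigenbasis:
  fixes A :: "real ^ 'n ^ 'n::finite"
  assumes sym: "transpose A = A"
  obtains B where "finite B" "pairwise orthogonal B" "\<And>v. v \<in> B \<Longrightarrow> norm v = 1"
    "\<And>v. v \<in> B \<Longrightarrow> \<exists>l. A *v v = l *\<^sub>R v" "span B = UNIV"
proof -
  define P where "P B \<longleftrightarrow> pairwise orthogonal B \<and> (\<forall>v\<in>B. norm v = 1 \<and> (\<exists>l. A *v v = l *\<^sub>R v))"
    for B :: "(real ^ 'n) set"
  have fin: "finite B \<and> card B \<le> DIM(real ^ 'n)" if "P B" for B
  proof -
    have "independent B"
      using that unfolding P_def by (intro pairwise_orthogonal_independent) auto
    then show ?thesis by (rule independent_bound)
  qed
  have "P {}" by (simp add: P_def)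
  then obtain B where B: "P B" and Bmax: "\<And>B'. P B' \<Longrightarrow> card B' \<le> card B"
    using ex_has_greatest_nat[of P "{}" card "DIM(real ^ 'n) + 1"] fin by force
  have "span B = UNIV"
  proof (rule ccontr)
    assume "span B \<noteq> UNIV"
    then obtain u where u: "u \<noteq> 0" "\<forall>x\<in>span B. u \<bullet> x = 0"
      using span_not_UNIV_orthogonal by metis
    define V where "V = {y. \<forall>x\<in>B. orthogonal x y}"
    have V: "subspace V" unfolding V_def by (rule subspace_orthogonal_to_vectors)
    have uV: "u \<in> V" using u span_base by (auto simp: V_def orthogonal_def inner_commute)
    have inv: "A *v x \<in> V" if "x \<in> V" for x
    proof -
      have "y \<bullet> (A *v x) = 0" if "y \<in> B" for y
      proof -
        obtain l where "A *v y = l *\<^sub>R y" using B \<open>y \<in> B\<close> unfolding P_def by blast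
        then show ?thesis
          using \<open>x \<in> V\<close> \<open>y \<in> B\<close> symmetric_matrix_inner[OF sym, of y x] by (simp add: V_def orthogonal_def)
      qed
      then show ?thesis by (auto simp: V_def orthogonal_def)
    qed
    obtain v where v: "v \<in> V" "norm v = 1" "\<exists>l. A *v v = l *\<^sub>R v"
      using symmetric_invariant_subspace_eigenvector[OF sym V uV u(1) inv] by blast
    have "v \<notin> B"
    proof
      assume "v \<in> B"
      with v(1) have "orthogonal v v" by (auto simp: V_def)
      with v(2) show False by (simp add: orthogonal_self)
    qed
    moreover have "P (insert v B)"
      using B v unfolding P_def V_def
      by (auto intro!: pairwise_orthogonal_insert simp: orthogonal_commute)
    ultimately show False using Bmax[of "insert v B"] fin[OF B] by simp
  qed
  with that B fin[OF B] show thesis unfolding P_def by blast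
qed

text \<open>The root scales each vector v of an orthonormal eigenbasis by \<open>sqrt (l v)\<close>.
  Symmetry and nonnegativity are both read off the bilinear formula \<open>inn\<close>, and the
  square is compared with S on the basis.\<close>

lemma matrix_sqrt_exists:
  fixes S :: "real ^ 'n ^ 'n::finite"
  assumes sym: "transpose S = S" and nn: "nonneg_definite S"
  shows "\<exists>R. transpose R = R \<and> nonneg_definite R \<and> R ** R = S"
proof -
  obtain B where B: "finite B" "pairwise orthogonal B" "\<And>v. v \<in> B \<Longrightarrow> norm v = 1"
    "\<And>v. v \<in> B \<Longrightarrow> \<exists>l. S *v v = l *\<^sub>R v" "span B = UNIV"
    using symmetric_matrix_eigenbasis[OF sym] by blast
  define l where "l v = (SOME l. S *v v = l *\<^sub>R v)" for v
  have l: "S *v v = l v *\<^sub>R v" if "v \<in> B" for v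
    unfolding l_def using B(4)[OF that] by (rule someI_ex)
  have l0: "0 \<le> l v" if "v \<in> B" for v
  proof -
    have "0 \<le> v \<bullet> (S *v v)" using nn unfolding nonneg_definite_def by blast
    then show ?thesis using l[OF that] B(3)[OF that] by (simp add: norm_eq_1)
  qed
  define f where "f x = (\<Sum>v\<in>B. (sqrt (l v) * (v \<bullet> x)) *\<^sub>R v)" for x :: "real ^ 'n"
  have lin: "linear f" unfolding f_def
    by (intro linear_compose_sum ballI linearI)
       (auto simp: inner_add_right algebra_simps)
  define R where "R = matrix f"
  have R: "R *v x = f x" for x unfolding R_def using lin by (simp add: matrix_works)
  have fv: "f v = sqrt (l v) *\<^sub>R v" if "v \<in> B" for v
  proof -
    have "f v = (\<Sum>w\<in>B. if w = v then sqrt (l v) *\<^sub>R v else 0)"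
      unfolding f_def
    proof (intro sum.cong refl)
      fix w assume "w \<in> B"
      then show "(sqrt (l w) * (w \<bullet> v)) *\<^sub>R w = (if w = v then sqrt (l v) *\<^sub>R v else 0)"
        using that B(2,3) by (auto simp: norm_eq_1 pairwise_def orthogonal_def)
    qed
    then show ?thesis using B(1) that by simp
  qed
  have inn: "x \<bullet> (R *v y) = (\<Sum>v\<in>B. sqrt (l v) * (v \<bullet> x) * (v \<bullet> y))" for x y
    unfolding R f_def by (simp add: inner_sum_right inner_commute mult_ac)
  have "transpose R = R"
  proof -
    have "(transpose R *v x) \<bullet> y = (R *v x) \<bullet> y" for x y
      using inn[of x y] inn[of y x] unfolding transpose_matrix_vector dot_lmul_matrix
      by (simp add: inner_commute[of "R *v x"] mult_ac)
    then have "transpose R *v x = R *v x" for x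
      using vector_eq_rdot by blast
    then show ?thesis by (simp add: matrix_eq)
  qed
  moreover have "nonneg_definite R"
    unfolding nonneg_definite_def inn using l0
    by (auto intro!: sum_nonneg simp: mult.assoc)
  moreover have "R ** R = S"
  proof -
    have "(R ** R) *v x = S *v x" for x
    proof (rule linear_eq_on_span[of "(*v) (R ** R)" "(*v) S" B])
      fix b assume "b \<in> B"
      then show "R ** R *v b = S *v b"
        by (simp add: matrix_vector_mul_assoc[symmetric] R fv l l0 linear_scale[OF lin])
    qed (auto simp: B)
    then show ?thesis by (simp add: matrix_eq)
  qed
  ultimately show ?thesis by blast
qed

text \<open>Instead of matching the eigenspaces of R and Q, this diagonalises their difference D.
  For an eigenvector with eigenvalue l, either l = 0 or both nonnegative forms vanish at it; but
  their difference there is l, so l = 0 in either case.\<close>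

lemma matrix_sqrt_unique:
  fixes R :: "real ^ 'n ^ 'n::finite"
  assumes R: "transpose R = R" "nonneg_definite R" and Q: "transpose Q = Q" "nonneg_definite Q"
    and eq: "R ** R = Q ** Q"
  shows "R = Q"
proof -
  define D where "D = R - Q"
  have D: "D *v x = R *v x - Q *v x" for x
    by (simp add: D_def matrix_vector_mult_diff_rdistrib)
  have "transpose D = D" using R(1) Q(1) unfolding D_def by (simp add: transpose_def vec_eq_iff)
  then obtain B where B: "\<And>v. v \<in> B \<Longrightarrow> norm v = 1"
    "\<And>v. v \<in> B \<Longrightarrow> \<exists>l. D *v v = l *\<^sub>R v" "span B = UNIV"
    using symmetric_matrix_eigenbasis by metis
  have "D *v v = 0" if v: "v \<in> B" for v
  proof -
    obtain l where l: "D *v v = l *\<^sub>R v" using B(2)[OF v] by blast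
    have nn: "0 \<le> v \<bullet> (R *v v)" "0 \<le> v \<bullet> (Q *v v)"
      using R(2) Q(2) unfolding nonneg_definite_def by auto
    txt \<open>From \<open>0 = R\<^sup>2 - Q\<^sup>2 = R D + D Q\<close>, tested against the eigenvector \<open>v\<close> of \<open>D\<close>.\<close>
    have "R *v (R *v v) = Q *v (Q *v v)"
      using eq by (simp add: matrix_vector_mul_assoc)
    then have "R *v (D *v v) + D *v (Q *v v) = 0"
      by (simp add: D matrix_vector_mult_diff_distrib)
    then have "0 = v \<bullet> (R *v (D *v v)) + v \<bullet> (D *v (Q *v v))"
      by (metis inner_add_right inner_zero_right)
    also have "v \<bullet> (D *v (Q *v v)) = (D *v v) \<bullet> (Q *v v)"
      by (rule symmetric_matrix_inner) fact
    finally have *: "l * (v \<bullet> (R *v v) + v \<bullet> (Q *v v)) = 0"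
      unfolding l by (simp add: matrix_vector_mult_scaleR distrib_left)
    have "v \<bullet> (R *v v) - v \<bullet> (Q *v v) = v \<bullet> (D *v v)" by (simp add: D inner_diff_right)
    also have "\<dots> = l" unfolding l using B(1)[OF v] by (simp add: norm_eq_1)
    finally have "l = 0" using * nn by auto
    then show ?thesis using l by simp
  qed
  then have "D *v x = 0 *v x" for x
    using linear_eq_on_span[of "(*v) D" "(*v) 0" B x] B(3) by (auto simp: matrix_vector_mult_0)
  then have "D = 0" by (simp add: matrix_eq)
  then show ?thesis by (simp add: D_def)
qed

text \<open>Since \<open>mat_sqrt\<close> is a definite description, existence and uniqueness are
  both required before any of its properties can be used.\<close>

lemma mat_sqrt_properties:
  fixes S :: "real ^ 'n ^ 'n::finite"
  assumes "transpose S = S" and "nonneg_definite S"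
  shows "transpose (mat_sqrt S) = mat_sqrt S" and "mat_sqrt S ** mat_sqrt S = S"
proof -
  have "\<exists>!R. transpose R = R \<and> nonneg_definite R \<and> R ** R = S"
    using matrix_sqrt_exists[OF assms] matrix_sqrt_unique by metis
  from theI'[OF this] show "transpose (mat_sqrt S) = mat_sqrt S" "mat_sqrt S ** mat_sqrt S = S"
    unfolding mat_sqrt_def by blast+
qed

section \<open>Gaussian integration by parts\<close>

text \<open>The normal density satisfies phi' = - y phi, so phi u' - y phi u is the derivative of
  phi u. A bounded u' gives u at most linear growth, so phi u vanishes at both ends of the line and
  the derivative integrates to 0.\<close>

lemma gaussian_integration_by_parts_real:
  fixes u u' :: "real \<Rightarrow> real"
  assumes du: "\<And>y. (u has_real_derivative u' y) (at y)" and cu': "\<And>y. isCont u' y"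
    and B: "\<And>y. \<bar>u' y\<bar> \<le> B"
  shows "(\<integral>y. std_normal_density y * (y * u y) \<partial>lborel) = (\<integral>y. std_normal_density y * u' y \<partial>lborel)"
proof -
  let ?\<phi> = std_normal_density
  have cu: "continuous_on UNIV u" using du by (meson DERIV_continuous_on has_field_derivative_at_within)
  have cu'2: "continuous_on UNIV u'" using cu' by (simp add: continuous_on_eq_continuous_at)
  have meas[measurable]: "u \<in> borel_measurable borel" "u' \<in> borel_measurable borel"
    using cu cu'2 by (auto intro: borel_measurable_continuous_onI)
  have B0: "B \<ge> 0" using B[of 0] by linarith
  have growth: "\<bar>u y\<bar> \<le> \<bar>u 0\<bar> + B * \<bar>y\<bar>" for y
  proof -
    have "norm (u y - u 0) \<le> B * norm (y - 0)"
      by (rule field_differentiable_bound[of UNIV u u' B]) (use du B in auto)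
    then show ?thesis by simp
  qed
  have i1: "integrable lborel (\<lambda>y. ?\<phi> y * u' y)"
  proof (rule Bochner_Integration.integrable_bound)
    show "integrable lborel (\<lambda>y. B * ?\<phi> y)" by simp
    show "AE y in lborel. norm (?\<phi> y * u' y) \<le> norm (B * ?\<phi> y)"
      using B B0 by (auto simp: abs_mult mult.commute intro!: mult_right_mono)
  qed simp
  \<comment> \<open>Linear growth of u makes y u(y) at most quadratic, so the first absolute moment
    and the second moment dominate it.\<close>
  have i2: "integrable lborel (\<lambda>y. ?\<phi> y * (y * u y))"
  proof (rule Bochner_Integration.integrable_bound)
    show "integrable lborel (\<lambda>y. \<bar>u 0\<bar> * (?\<phi> y * \<bar>y\<bar> ^ 1) + B * (?\<phi> y * y ^ 2))"
      using integrable_std_normal_moment_abs[of 1] integrable_std_normal_moment[of 2] by simp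
    have "norm (?\<phi> y * (y * u y)) \<le> \<bar>u 0\<bar> * (?\<phi> y * \<bar>y\<bar> ^ 1) + B * (?\<phi> y * y ^ 2)" for y
    proof -
      have "\<bar>y\<bar> * \<bar>u y\<bar> \<le> \<bar>y\<bar> * (\<bar>u 0\<bar> + B * \<bar>y\<bar>)"
        by (rule mult_left_mono[OF growth]) simp
      also have "\<dots> = \<bar>u 0\<bar> * \<bar>y\<bar> + B * y\<^sup>2"
        by (simp add: distrib_left power2_eq_square mult_ac flip: abs_mult)
      finally have "?\<phi> y * (\<bar>y\<bar> * \<bar>u y\<bar>) \<le> ?\<phi> y * (\<bar>u 0\<bar> * \<bar>y\<bar> + B * y\<^sup>2)"
        by (rule mult_left_mono) simp
      then show ?thesis by (simp add: abs_mult distrib_left mult_ac)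
    qed
    then show "AE y in lborel. norm (?\<phi> y * (y * u y)) \<le> norm (\<bar>u 0\<bar> * (?\<phi> y * \<bar>y\<bar> ^ 1) + B * (?\<phi> y * y ^ 2))"
      by (intro AE_I2) (metis abs_ge_self order_trans real_norm_def)
  qed simp
  have d\<phi>: "(?\<phi> has_real_derivative - y * ?\<phi> y) (at y)" for y
  proof -
    have "((\<lambda>y. exp (- y\<^sup>2 / 2)) has_real_derivative exp (- y\<^sup>2 / 2) * (- y)) (at y)"
      by (auto intro!: derivative_eq_intros)
    from DERIV_cmult[OF this, of "1 / sqrt (2 * pi)"] show ?thesis
      unfolding std_normal_density_def by (simp add: mult_ac)
  qed
  let ?F = "\<lambda>y. ?\<phi> y * u y" and ?f = "\<lambda>y. ?\<phi> y * u' y - ?\<phi> y * (y * u y)"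
  have dF: "(?F has_vector_derivative ?f y) (at y)" for y
    unfolding has_real_derivative_iff_has_vector_derivative[symmetric]
    by (rule DERIV_cong[OF DERIV_mult[OF d\<phi> du]]) (simp add: algebra_simps)
  have c\<phi>: "isCont ?\<phi> y" for y using d\<phi> DERIV_isCont by blast
  have cuy: "isCont u y" for y using du DERIV_isCont by blast
  have bound: "\<bar>?F y\<bar> \<le> ?\<phi> y * (\<bar>u 0\<bar> + B * \<bar>y\<bar>)" for y
    using growth[of y] by (auto simp: abs_mult intro!: mult_left_mono)
  have lim1: "(?F \<longlongrightarrow> 0) at_top"
  proof (rule Lim_null_comparison[OF always_eventually])
    show "\<forall>y. norm (?F y) \<le> ?\<phi> y * (\<bar>u 0\<bar> + B * \<bar>y\<bar>)" using bound by simp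
    show "((\<lambda>y. ?\<phi> y * (\<bar>u 0\<bar> + B * \<bar>y\<bar>)) \<longlongrightarrow> 0) at_top"
    proof -
      have "((\<lambda>y::real. exp (- y\<^sup>2 / 2)) \<longlongrightarrow> 0) at_top" "((\<lambda>y::real. exp (- y\<^sup>2 / 2) * \<bar>y\<bar>) \<longlongrightarrow> 0) at_top"
        by real_asymp+
      from tendsto_add[OF tendsto_mult_left[OF this(1), of "\<bar>u 0\<bar> / sqrt (2 * pi)"]
          tendsto_mult_left[OF this(2), of "B / sqrt (2 * pi)"]]
      show ?thesis by (simp add: std_normal_density_def field_simps)
    qed
  qed
  have lim2: "(?F \<longlongrightarrow> 0) at_bot"
  proof (rule Lim_null_comparison[OF always_eventually])
    show "\<forall>y. norm (?F y) \<le> ?\<phi> y * (\<bar>u 0\<bar> + B * \<bar>y\<bar>)" using bound by simp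
    show "((\<lambda>y. ?\<phi> y * (\<bar>u 0\<bar> + B * \<bar>y\<bar>)) \<longlongrightarrow> 0) at_bot"
    proof -
      have "((\<lambda>y::real. exp (- y\<^sup>2 / 2)) \<longlongrightarrow> 0) at_bot" "((\<lambda>y::real. exp (- y\<^sup>2 / 2) * \<bar>y\<bar>) \<longlongrightarrow> 0) at_bot"
        by real_asymp+
      from tendsto_add[OF tendsto_mult_left[OF this(1), of "\<bar>u 0\<bar> / sqrt (2 * pi)"]
          tendsto_mult_left[OF this(2), of "B / sqrt (2 * pi)"]]
      show ?thesis by (simp add: std_normal_density_def field_simps)
    qed
  qed
  have "(LBINT y=-\<infinity>..\<infinity>. ?f y) = 0 - 0"
  proof (rule interval_integral_FTC_integrable[where F = ?F])
    show "set_integrable lborel (einterval (-\<infinity>) \<infinity>) ?f"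
      using i1 i2 by (simp add: set_integrable_def)
    show "((?F \<circ> real_of_ereal) \<longlongrightarrow> 0) (at_right (-\<infinity>))" "((?F \<circ> real_of_ereal) \<longlongrightarrow> 0) (at_left \<infinity>)"
      using lim1 lim2 by (simp_all add: ereal_tendsto_simps)
  qed (use dF c\<phi> cu' cuy in \<open>auto intro!: continuous_intros\<close>)
  then have "(\<integral>y. ?f y \<partial>lborel) = 0"
    by (simp add: interval_lebesgue_integral_def set_lebesgue_integral_def)
  then show ?thesis using i1 i2 by (simp add: Bochner_Integration.integral_diff)
qed

section \<open>Integration by parts for a standard normal vector\<close>

abbreviation std_normal :: "real measure" where
  "std_normal \<equiv> density lborel (\<lambda>x. ennreal (std_normal_density x))"

lemma integral_std_normal:
  fixes f :: "real \<Rightarrow> real"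
  assumes "f \<in> borel_measurable borel"
  shows "(\<integral>y. f y \<partial>std_normal) = (\<integral>y. std_normal_density y * f y \<partial>lborel)"
  using assms by (subst integral_density) auto

lemma prob_space_std_normal: "prob_space std_normal"
  by (rule prob_space_normal_density) simp

lemma measurable_vec_lambda [measurable]:
  "(\<lambda>g. (\<chi> i. g i) :: real ^ 'd::finite) \<in> borel_measurable (\<Pi>\<^sub>M i\<in>UNIV. borel)"
proof (subst borel_measurable_euclidean_space, intro ballI)
  fix b :: "real ^ 'd" assume "b \<in> Basis"
  then obtain i where "b = axis i 1" by (auto simp: Basis_vec_def)
  then have "(\<lambda>g. ((\<chi> i. g i) :: real ^ 'd) \<bullet> b) = (\<lambda>g. g i)"
    by (simp add: inner_axis fun_eq_iff)
  then show "(\<lambda>g. ((\<chi> i. g i) :: real ^ 'd) \<bullet> b) \<in> borel_measurable (\<Pi>\<^sub>M i\<in>UNIV. borel)"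
    by simp
qed

context
  fixes N :: "'b measure" and Z :: "'b \<Rightarrow> real ^ 'd::finite"
  assumes N: "prob_space N" and Z: "std_normal_vector N Z"
begin

lemma std_normal_vector_component:
  shows "(\<lambda>\<omega>. Z \<omega> $ i) \<in> borel_measurable N" and "distr N borel (\<lambda>\<omega>. Z \<omega> $ i) = std_normal"
proof -
  have D: "distributed N lborel (\<lambda>\<omega>. Z \<omega> $ i) std_normal_density"
    using Z by (simp add: std_normal_vector_def)
  show "(\<lambda>\<omega>. Z \<omega> $ i) \<in> borel_measurable N"
    using distributed_measurable[OF D] by simp
  show "distr N borel (\<lambda>\<omega>. Z \<omega> $ i) = std_normal"
    using distributed_distr_eq_density[OF D] by (metis distr_cong sets_lborel)
qed

lemma std_normal_vector_distr:
  "distr N (\<Pi>\<^sub>M i\<in>UNIV. borel) (\<lambda>\<omega>. \<lambda>i\<in>UNIV. Z \<omega> $ i) = (\<Pi>\<^sub>M i\<in>UNIV. std_normal)"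
proof -
  interpret prob_space N by (rule N)
  have "indep_vars (\<lambda>_. borel) (\<lambda>i \<omega>. Z \<omega> $ i) UNIV"
    using Z by (simp add: std_normal_vector_def)
  then show ?thesis
    using indep_vars_iff_distr_eq_PiM'[where I = UNIV and M' = "\<lambda>_. borel" and X = "\<lambda>i \<omega>. Z \<omega> $ i"] std_normal_vector_component
    by simp
qed

lemma std_normal_vector_measurable: "Z \<in> borel_measurable N"
proof (subst borel_measurable_euclidean_space, intro ballI)
  fix b :: "real ^ 'd" assume "b \<in> Basis"
  then obtain i where "b = axis i 1" by (auto simp: Basis_vec_def)
  then show "(\<lambda>\<omega>. Z \<omega> \<bullet> b) \<in> borel_measurable N"
    using std_normal_vector_component(1)[of i] by (simp add: inner_axis)
qed

text \<open>Moves integrals over Z to a product measure, where Fubini can single out one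
  coordinate.\<close>

lemma std_normal_vector_transfer:
  fixes f :: "real ^ 'd \<Rightarrow> real"
  assumes [measurable]: "f \<in> borel_measurable borel"
  shows "(\<integral>\<omega>. f (Z \<omega>) \<partial>N) = (\<integral>x. f (\<chi> i. x i) \<partial>(\<Pi>\<^sub>M i\<in>UNIV. std_normal))"
    and "integrable N (\<lambda>\<omega>. f (Z \<omega>)) \<longleftrightarrow> integrable (\<Pi>\<^sub>M i\<in>UNIV. std_normal) (\<lambda>x. f (\<chi> i. x i))"
proof -
  have m: "(\<lambda>\<omega>. \<lambda>i\<in>UNIV. Z \<omega> $ i) \<in> measurable N (\<Pi>\<^sub>M i\<in>UNIV. borel)"
    using std_normal_vector_component(1) by (intro measurable_restrict) auto
  show "(\<integral>\<omega>. f (Z \<omega>) \<partial>N) = (\<integral>x. f (\<chi> i. x i) \<partial>(\<Pi>\<^sub>M i\<in>UNIV. std_normal))"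
    unfolding std_normal_vector_distr[symmetric]
    by (subst integral_distr[OF m]) (auto simp: restrict_def)
  show "integrable N (\<lambda>\<omega>. f (Z \<omega>)) \<longleftrightarrow> integrable (\<Pi>\<^sub>M i\<in>UNIV. std_normal) (\<lambda>x. f (\<chi> i. x i))"
    unfolding std_normal_vector_distr[symmetric]
    by (subst integrable_distr_eq[OF m]) (auto simp: restrict_def)
qed

text \<open>Fubini isolates coordinate i, and the real identity applies along each line parallel to
  that axis. Integrability of the left-hand side is assumed because only the derivative in direction
  i is bounded, which says nothing about growth in the other coordinates.\<close>

lemma gaussian_integration_by_parts:
  fixes f :: "real ^ 'd \<Rightarrow> real"
  assumes df: "\<And>x. (f has_derivative f1 x) (at x)"
    and cf': "continuous_on UNIV (\<lambda>x. f1 x (axis i 1))"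
    and B: "\<And>x. \<bar>f1 x (axis i 1)\<bar> \<le> B"
    and int: "integrable N (\<lambda>\<omega>. Z \<omega> $ i * f (Z \<omega>))"
  shows "(\<integral>\<omega>. Z \<omega> $ i * f (Z \<omega>) \<partial>N) = (\<integral>\<omega>. f1 (Z \<omega>) (axis i 1) \<partial>N)"
proof -
  let ?f' = "\<lambda>x. f1 x (axis i 1)" and ?Q = "\<Pi>\<^sub>M j\<in>UNIV. std_normal"
  let ?v = "\<lambda>x. (\<chi> j. x j) :: real ^ 'd"
  have "continuous_on UNIV f"
    using df by (meson has_derivative_continuous continuous_at_imp_continuous_on)
  then have fm[measurable]: "f \<in> borel_measurable borel" by (rule borel_measurable_continuous_onI)
  have f'm[measurable]: "?f' \<in> borel_measurable borel" by (rule borel_measurable_continuous_onI[OF cf'])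
  interpret prob_space N by (rule N)
  interpret product_sigma_finite "\<lambda>_::'d. std_normal"
    by (simp add: product_sigma_finite_def prob_space_std_normal prob_space_imp_sigma_finite)
  have m1[measurable]: "(\<lambda>z::real^'d. z $ i * f z) \<in> borel_measurable borel"
    by (intro borel_measurable_times fm borel_measurable_continuous_onI continuous_intros)
  have int1: "integrable ?Q (\<lambda>x. ?v x $ i * f (?v x))"
    using std_normal_vector_transfer(2)[OF m1] int by simp
  have "integrable N (\<lambda>\<omega>. ?f' (Z \<omega>))"
    by (rule integrable_const_bound[of _ B])
       (use B measurable_compose[OF std_normal_vector_measurable f'm] in auto)
  then have int2: "integrable ?Q (\<lambda>x. ?f' (?v x))"
    using std_normal_vector_transfer(2)[OF f'm] by simp
  have U: "insert i (UNIV - {i}) = (UNIV :: 'd set)" by auto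
  have der: "((\<lambda>y. f (?v (x(i := y)))) has_real_derivative ?f' (?v (x(i := y)))) (at y)" for x y
  proof -
    have eq: "?v (x(i := y)) = ?v (x(i := 0)) + y *\<^sub>R axis i 1" for y
      by (simp add: vec_eq_iff axis_def)
    have "((\<lambda>y. ?v (x(i := 0)) + y *\<^sub>R axis i 1) has_derivative (\<lambda>t. t *\<^sub>R axis i 1)) (at y)"
      by (rule has_derivative_eq_rhs[OF has_derivative_add[OF has_derivative_const
            has_derivative_scaleR_left[OF has_derivative_ident]]]) simp
    from has_derivative_compose[OF this df]
    have "((\<lambda>y. f (?v (x(i := y)))) has_derivative (\<lambda>t. f1 (?v (x(i := y))) (t *\<^sub>R axis i 1))) (at y)"
      by (simp only: eq[symmetric])
    moreover have "(\<lambda>t. f1 z (t *\<^sub>R axis i 1)) = (*) (f1 z (axis i 1))" for z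
      using linear_scale[OF has_derivative_linear[OF df]] by (simp add: fun_eq_iff mult.commute)
    ultimately show ?thesis unfolding has_field_derivative_def by (simp only:)
  qed
  have cont: "isCont (\<lambda>y. ?f' (?v (x(i := y)))) y" for x y
  proof -
    have "continuous_on UNIV (\<lambda>y. (x(i := y)) j)" for j
      by (cases "j = i") auto
    then have "continuous_on UNIV (\<lambda>y. ?v (x(i := y)))"
      by (rule continuous_on_vec_lambda)
    then have "continuous_on UNIV (\<lambda>y. ?f' (?v (x(i := y))))"
      by (rule continuous_on_compose2[OF cf']) auto
    then show ?thesis by (simp add: continuous_on_eq_continuous_at)
  qed
  have inner: "(\<integral>y. ?v (x(i := y)) $ i * f (?v (x(i := y))) \<partial>std_normal) = (\<integral>y. ?f' (?v (x(i := y))) \<partial>std_normal)" for x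
  proof -
    have "continuous_on UNIV (\<lambda>y. f (?v (x(i := y))))"
      by (intro continuous_at_imp_continuous_on ballI DERIV_isCont[OF der])
    then have a: "(\<lambda>y. f (?v (x(i := y)))) \<in> borel_measurable borel" by (rule borel_measurable_continuous_onI)
    have b: "(\<lambda>y. ?f' (?v (x(i := y)))) \<in> borel_measurable borel"
      using cont by (intro borel_measurable_continuous_onI) (simp add: continuous_on_eq_continuous_at)
    show ?thesis
      using gaussian_integration_by_parts_real[OF der cont B, of x] a b by (simp add: integral_std_normal)
  qed
  have "(\<integral>\<omega>. Z \<omega> $ i * f (Z \<omega>) \<partial>N) = (\<integral>x. ?v x $ i * f (?v x) \<partial>?Q)"
    by (rule std_normal_vector_transfer(1)[OF m1])
  also have "\<dots> = (\<integral>x. (\<integral>y. ?v (x(i := y)) $ i * f (?v (x(i := y))) \<partial>std_normal) \<partial>(\<Pi>\<^sub>M j\<in>UNIV - {i}. std_normal))"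
    using product_integral_insert[of "UNIV - {i}" i "\<lambda>x. ?v x $ i * f (?v x)"] int1 unfolding U by simp
  also have "\<dots> = (\<integral>x. (\<integral>y. ?f' (?v (x(i := y))) \<partial>std_normal) \<partial>(\<Pi>\<^sub>M j\<in>UNIV - {i}. std_normal))"
    unfolding inner ..
  also have "\<dots> = (\<integral>x. ?f' (?v x) \<partial>?Q)"
    using product_integral_insert[of "UNIV - {i}" i "\<lambda>x. ?f' (?v x)"] int2 unfolding U by simp
  also have "\<dots> = (\<integral>\<omega>. ?f' (Z \<omega>) \<partial>N)"
    by (rule std_normal_vector_transfer(1)[OF f'm, symmetric])
  finally show ?thesis .
qed

lemma std_normal_vector_square_integrable: "integrable N (\<lambda>\<omega>. (norm (Z \<omega>))\<^sup>2)"
proof -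
  have c: "integrable N (\<lambda>\<omega>. (Z \<omega> $ i)\<^sup>2)" for i
  proof -
    have "integrable std_normal (\<lambda>y. y\<^sup>2)"
      using integrable_std_normal_moment[of 2] by (subst integrable_density) auto
    then show ?thesis
      unfolding std_normal_vector_component(2)[of i, symmetric]
      by (subst (asm) integrable_distr_eq) (auto simp: std_normal_vector_component(1))
  qed
  have "(norm z)\<^sup>2 = (\<Sum>i\<in>UNIV. (z $ i)\<^sup>2)" for z :: "real ^ 'd"
    unfolding power2_norm_eq_inner inner_vec_def by (simp add: power2_eq_square)
  then show ?thesis using c by simp
qed

end

section \<open>Sums of locally dependent vectors\<close>

text \<open>A positive normalised linear functional defined on all real functions. It models
  expectation over a finite space, so the local dependence argument can be carried out without
  measurability or integrability conditions.\<close>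

locale expectation_functional =
  fixes E :: "('s \<Rightarrow> real) \<Rightarrow> real"
  assumes E_add: "E (\<lambda>s. F s + G s) = E F + E G"
    and E_cmult: "E (\<lambda>s. c * F s) = c * E F"
    and E_mono: "(\<And>s. F s \<le> G s) \<Longrightarrow> E F \<le> E G"
    and E_const: "E (\<lambda>s. c) = c"
begin

lemma E_diff: "E (\<lambda>s. F s - G s) = E F - E G"
  using E_add[of F "\<lambda>s. -1 * G s"] E_cmult[of "-1" G] by simp

lemma E_sum: "E (\<lambda>s. \<Sum>i\<in>A. F i s) = (\<Sum>i\<in>A. E (F i))"
  by (induction A rule: infinite_finite_induct) (auto simp: E_const E_add)

lemma E_nonneg: "(\<And>s. 0 \<le> F s) \<Longrightarrow> 0 \<le> E F"
  using E_mono[of "\<lambda>s. 0" F] by (simp add: E_const)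

lemma abs_E_le: "(\<And>s. \<bar>F s\<bar> \<le> G s) \<Longrightarrow> \<bar>E F\<bar> \<le> E G"
proof -
  assume *: "\<And>s. \<bar>F s\<bar> \<le> G s"
  have "E F \<le> E G" using * by (intro E_mono) (meson abs_le_D1)
  moreover have "E (\<lambda>s. - 1 * F s) \<le> E G" using * by (intro E_mono) (simp add: abs_le_iff)
  ultimately show ?thesis by (simp only: E_cmult)
qed

text \<open>Two nested neighbourhoods are removed. Write Wm for W without D m, and Wml for W without
  D m and D l. Expanding g(W) at Wm produces products X_m X_l H(Wm) with l in D m; H(Wm) is still
  correlated with X_l, so it is moved on to Wml, where \<open>indep2\<close> factorises the
  expectation, and then back to W. Each move costs one extra summand, hence a third-order moment:
  \<open>T1\<close> bounds the joint ones and \<open>T2\<close> those arising after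
  factorisation.\<close>

lemma local_dependence_bound:
  fixes X :: "'i \<Rightarrow> 's \<Rightarrow> real ^ 'd::finite" and I :: "'i set" and D :: "'i \<Rightarrow> 'i set"
    and g :: "'d \<Rightarrow> real ^ 'd \<Rightarrow> real" and H :: "'d \<Rightarrow> 'd \<Rightarrow> real ^ 'd \<Rightarrow> real"
  assumes I: "finite I" and D: "\<And>m. m \<in> I \<Longrightarrow> D m \<subseteq> I" and K: "\<And>m. m \<in> I \<Longrightarrow> card (D m) \<le> K"
    and indep1: "\<And>m k \<phi>. m \<in> I \<Longrightarrow> E (\<lambda>s. X m s $ k * \<phi> (\<Sum>l\<in>I - D m. X l s)) = 0"
    and indep2: "\<And>m l k j \<phi>. m \<in> I \<Longrightarrow> l \<in> D m \<Longrightarrow>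
        E (\<lambda>s. X m s $ k * X l s $ j * \<phi> (\<Sum>l'\<in>I - (D m \<union> D l). X l' s))
        = E (\<lambda>s. X m s $ k * X l s $ j) * E (\<lambda>s. \<phi> (\<Sum>l'\<in>I - (D m \<union> D l). X l' s))"
    and T1: "\<And>m l l' k j i. m \<in> I \<Longrightarrow> l \<in> I \<Longrightarrow> l' \<in> I \<Longrightarrow>
        E (\<lambda>s. \<bar>X m s $ k\<bar> * \<bar>X l s $ j\<bar> * \<bar>X l' s $ i\<bar>) \<le> T"
    and T2: "\<And>m l l' k j i. m \<in> I \<Longrightarrow> l \<in> I \<Longrightarrow> l' \<in> I \<Longrightarrow>
        E (\<lambda>s. \<bar>X m s $ k\<bar> * \<bar>X l s $ j\<bar>) * E (\<lambda>s. \<bar>X l' s $ i\<bar>) \<le> T"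
    and C: "0 \<le> C" and T: "0 \<le> T"
    and g: "\<And>k x v. \<bar>g k (x + v) - g k x - (\<Sum>j\<in>UNIV. v $ j * H j k x)\<bar> \<le> C / 2 * (\<Sum>j\<in>UNIV. \<bar>v $ j\<bar>)\<^sup>2"
    and H: "\<And>j k x v. \<bar>H j k (x + v) - H j k x\<bar> \<le> C * (\<Sum>i\<in>UNIV. \<bar>v $ i\<bar>)"
  defines "W \<equiv> \<lambda>s. \<Sum>m\<in>I. X m s"
  shows "\<bar>E (\<lambda>s. \<Sum>k\<in>UNIV. W s $ k * g k (W s))
      - (\<Sum>k\<in>UNIV. \<Sum>j\<in>UNIV. (\<Sum>m\<in>I. \<Sum>l\<in>D m. E (\<lambda>s. X m s $ k * X l s $ j)) * E (\<lambda>s. H j k (W s)))\<bar>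
    \<le> 4 * real (card I) * real CARD('d) ^ 3 * real K ^ 2 * C * T"
proof -
  let ?d = "real CARD('d)"
  have norm1: "(\<Sum>j\<in>UNIV. \<bar>(\<Sum>l\<in>A. X l s) $ j\<bar>) \<le> (\<Sum>j\<in>UNIV. \<Sum>l\<in>A. \<bar>X l s $ j\<bar>)" for A s
    by (intro sum_mono) (simp add: sum_abs)
  have finD: "finite (D m)" if "m \<in> I" for m using D[OF that] I finite_subset by blast
  have triple: "(\<Sum>i\<in>(UNIV::'d set). \<Sum>l'\<in>A. f i l') \<le> ?d * real c * T"
    if "\<And>i l'. l' \<in> A \<Longrightarrow> f i l' \<le> T" "card A \<le> c" for A :: "'i set" and f :: "'d \<Rightarrow> 'i \<Rightarrow> real" and c
  proof -
    have "(\<Sum>i\<in>(UNIV::'d set). \<Sum>l'\<in>A. f i l') \<le> (\<Sum>i\<in>(UNIV::'d set). \<Sum>l'\<in>A. T)"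
      using that(1) by (intro sum_mono) auto
    also have "\<dots> = ?d * real (card A) * T" by simp
    also have "\<dots> \<le> ?d * real c * T" using that(2) T by (intro mult_right_mono mult_left_mono) auto
    finally show ?thesis .
  qed
  \<comment> \<open>The factor 3 is 1 + 2: passing from Wm to Wml removes at most K summands,
    returning from Wml to W restores at most 2 K.\<close>
  have step2: "\<bar>E (\<lambda>s. X m s $ k * X l s $ j * H j k (\<Sum>l\<in>I - D m. X l s))
      - E (\<lambda>s. X m s $ k * X l s $ j) * E (\<lambda>s. H j k (W s))\<bar> \<le> 3 * C * ?d * real K * T"
    if m: "m \<in> I" and l: "l \<in> D m" for m l k j
  proof -
    let ?Wm = "\<lambda>s. \<Sum>l\<in>I - D m. X l s" and ?Wml = "\<lambda>s. \<Sum>l'\<in>I - (D m \<union> D l). X l' s"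
    let ?Y = "\<lambda>s. X m s $ k * X l s $ j"
    have lI: "l \<in> I" using l D[OF m] by blast
    have Wm: "?Wm s = ?Wml s + (\<Sum>l'\<in>D l - D m. X l' s)" for s
    proof -
      have eq: "I - D m = (I - (D m \<union> D l)) \<union> (D l - D m)" using D[OF lI] by blast
      show ?thesis
        by (subst eq, rule sum.union_disjoint) (use I finD[OF lI] in auto)
    qed
    have W: "W s = ?Wml s + (\<Sum>l'\<in>D m \<union> D l. X l' s)" for s
      unfolding W_def using I D[OF lI] D[OF m] by (simp add: sum.subset_diff[of "D m \<union> D l" I])
    have "\<bar>E (\<lambda>s. ?Y s * H j k (?Wm s) - ?Y s * H j k (?Wml s))\<bar>
      \<le> E (\<lambda>s. C * (\<Sum>i\<in>UNIV. \<Sum>l'\<in>D l - D m. \<bar>X m s $ k\<bar> * \<bar>X l s $ j\<bar> * \<bar>X l' s $ i\<bar>))"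
    proof (rule abs_E_le)
      fix s
      have "\<bar>?Y s * H j k (?Wm s) - ?Y s * H j k (?Wml s)\<bar> = \<bar>?Y s\<bar> * \<bar>H j k (?Wm s) - H j k (?Wml s)\<bar>"
        by (simp add: abs_mult flip: right_diff_distrib)
      also have "\<dots> \<le> \<bar>?Y s\<bar> * (C * (\<Sum>i\<in>UNIV. \<Sum>l'\<in>D l - D m. \<bar>X l' s $ i\<bar>))"
        unfolding Wm by (intro mult_left_mono order_trans[OF H] norm1 C) auto
      also have "\<dots> = C * (\<Sum>i\<in>UNIV. \<Sum>l'\<in>D l - D m. \<bar>X m s $ k\<bar> * \<bar>X l s $ j\<bar> * \<bar>X l' s $ i\<bar>)"
        by (simp add: sum_distrib_left abs_mult mult_ac)
      finally show "\<bar>?Y s * H j k (?Wm s) - ?Y s * H j k (?Wml s)\<bar> \<le> \<dots>" .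
    qed
    also have "\<dots> = C * (\<Sum>i\<in>UNIV. \<Sum>l'\<in>D l - D m. E (\<lambda>s. \<bar>X m s $ k\<bar> * \<bar>X l s $ j\<bar> * \<bar>X l' s $ i\<bar>))"
      by (simp only: E_cmult E_sum)
    also have "\<dots> \<le> C * (?d * real K * T)"
    proof (intro mult_left_mono triple C)
      show "card (D l - D m) \<le> K"
        using K[OF lI] finD[OF lI] card_mono[of "D l" "D l - D m"] by force
    qed (use T1[OF m lI] D[OF lI] in blast)
    finally have a: "\<bar>E (\<lambda>s. ?Y s * H j k (?Wm s)) - E (\<lambda>s. ?Y s * H j k (?Wml s))\<bar> \<le> C * (?d * real K * T)"
      by (simp only: E_diff)
    have "\<bar>E (\<lambda>s. H j k (W s) - H j k (?Wml s))\<bar> \<le> E (\<lambda>s. C * (\<Sum>i\<in>UNIV. \<Sum>l'\<in>D m \<union> D l. \<bar>X l' s $ i\<bar>))"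
      unfolding W by (intro abs_E_le order_trans[OF H] mult_left_mono norm1 C)
    also have "\<dots> = C * (\<Sum>i\<in>UNIV. \<Sum>l'\<in>D m \<union> D l. E (\<lambda>s. \<bar>X l' s $ i\<bar>))"
      by (simp only: E_cmult E_sum)
    finally have b0: "\<bar>E (\<lambda>s. H j k (W s)) - E (\<lambda>s. H j k (?Wml s))\<bar>
        \<le> C * (\<Sum>i\<in>UNIV. \<Sum>l'\<in>D m \<union> D l. E (\<lambda>s. \<bar>X l' s $ i\<bar>))" by (simp only: E_diff)
    have Yabs: "\<bar>E ?Y\<bar> \<le> E (\<lambda>s. \<bar>X m s $ k\<bar> * \<bar>X l s $ j\<bar>)"
      by (rule abs_E_le) (simp add: abs_mult)
    have "\<bar>E ?Y * E (\<lambda>s. H j k (W s)) - E ?Y * E (\<lambda>s. H j k (?Wml s))\<bar>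
        = \<bar>E ?Y\<bar> * \<bar>E (\<lambda>s. H j k (W s)) - E (\<lambda>s. H j k (?Wml s))\<bar>"
      by (simp add: abs_mult flip: right_diff_distrib)
    also have "\<dots> \<le> E (\<lambda>s. \<bar>X m s $ k\<bar> * \<bar>X l s $ j\<bar>) * (C * (\<Sum>i\<in>UNIV. \<Sum>l'\<in>D m \<union> D l. E (\<lambda>s. \<bar>X l' s $ i\<bar>)))"
      by (intro mult_mono Yabs b0 E_nonneg) auto
    also have "\<dots> = C * (\<Sum>i\<in>UNIV. \<Sum>l'\<in>D m \<union> D l. E (\<lambda>s. \<bar>X m s $ k\<bar> * \<bar>X l s $ j\<bar>) * E (\<lambda>s. \<bar>X l' s $ i\<bar>))"
      by (simp add: sum_distrib_left mult_ac)
    also have "\<dots> \<le> C * (?d * real (2 * K) * T)"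
    proof (intro mult_left_mono triple C)
      show "card (D m \<union> D l) \<le> 2 * K"
        using K[OF lI] K[OF m] card_Un_le[of "D m" "D l"] by linarith
    qed (use T2[OF m lI] D[OF lI] D[OF m] in blast)
    finally have b: "\<bar>E ?Y * E (\<lambda>s. H j k (W s)) - E ?Y * E (\<lambda>s. H j k (?Wml s))\<bar> \<le> C * (?d * real (2 * K) * T)" .
    have "\<bar>E (\<lambda>s. ?Y s * H j k (?Wm s)) - E ?Y * E (\<lambda>s. H j k (W s))\<bar> \<le> C * (?d * real K * T) + C * (?d * real (2 * K) * T)"
      using a b unfolding indep2[OF m l, of k j "H j k"] by linarith
    then show ?thesis by (simp add: algebra_simps)
  qed
  have step: "\<bar>E (\<lambda>s. X m s $ k * g k (W s))
      - (\<Sum>j\<in>UNIV. \<Sum>l\<in>D m. E (\<lambda>s. X m s $ k * X l s $ j) * E (\<lambda>s. H j k (W s)))\<bar>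
      \<le> 4 * ?d ^ 2 * real K ^ 2 * C * T" if m: "m \<in> I" for m k
  proof -
    let ?Wm = "\<lambda>s. \<Sum>l\<in>I - D m. X l s" and ?S = "\<lambda>s. \<Sum>l\<in>D m. X l s"
    have W: "W s = ?Wm s + ?S s" for s
      unfolding W_def using I D[OF m] by (simp add: sum.subset_diff[of "D m" I])
    have "\<bar>E (\<lambda>s. X m s $ k * (g k (W s) - g k (?Wm s) - (\<Sum>j\<in>UNIV. ?S s $ j * H j k (?Wm s))))\<bar>
      \<le> E (\<lambda>s. C / 2 * (\<Sum>j\<in>UNIV. \<Sum>l\<in>D m. \<Sum>i\<in>UNIV. \<Sum>l'\<in>D m. \<bar>X m s $ k\<bar> * \<bar>X l s $ j\<bar> * \<bar>X l' s $ i\<bar>))"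
    proof (rule abs_E_le)
      fix s
      have "(\<Sum>j\<in>UNIV. \<bar>?S s $ j\<bar>)\<^sup>2 \<le> (\<Sum>j\<in>UNIV. \<Sum>l\<in>D m. \<bar>X l s $ j\<bar>)\<^sup>2"
        by (intro power_mono norm1 sum_nonneg) auto
      then have "\<bar>g k (W s) - g k (?Wm s) - (\<Sum>j\<in>UNIV. ?S s $ j * H j k (?Wm s))\<bar>
          \<le> C / 2 * (\<Sum>j\<in>UNIV. \<Sum>l\<in>D m. \<bar>X l s $ j\<bar>)\<^sup>2"
        unfolding W using C by (intro order_trans[OF g] mult_left_mono) auto
      then have "\<bar>X m s $ k * (g k (W s) - g k (?Wm s) - (\<Sum>j\<in>UNIV. ?S s $ j * H j k (?Wm s)))\<bar>
        \<le> \<bar>X m s $ k\<bar> * (C / 2 * (\<Sum>j\<in>UNIV. \<Sum>l\<in>D m. \<bar>X l s $ j\<bar>)\<^sup>2)"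
        unfolding abs_mult by (intro mult_left_mono) auto
      also have "\<dots> = C / 2 * (\<Sum>j\<in>UNIV. \<Sum>l\<in>D m. \<Sum>i\<in>UNIV. \<Sum>l'\<in>D m. \<bar>X m s $ k\<bar> * \<bar>X l s $ j\<bar> * \<bar>X l' s $ i\<bar>)"
        unfolding power2_eq_square sum_distrib_right unfolding sum_distrib_left by (simp add: mult_ac)
      finally show "\<bar>X m s $ k * (g k (W s) - g k (?Wm s) - (\<Sum>j\<in>UNIV. ?S s $ j * H j k (?Wm s)))\<bar> \<le> \<dots>" .
    qed
    also have "\<dots> = C / 2 * (\<Sum>j\<in>UNIV. \<Sum>l\<in>D m. \<Sum>i\<in>UNIV. \<Sum>l'\<in>D m. E (\<lambda>s. \<bar>X m s $ k\<bar> * \<bar>X l s $ j\<bar> * \<bar>X l' s $ i\<bar>))"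
      by (simp only: E_cmult E_sum)
    also have "\<dots> \<le> C / 2 * (\<Sum>j\<in>(UNIV::'d set). \<Sum>l\<in>D m. ?d * real K * T)"
      using C D[OF m] by (intro mult_left_mono sum_mono triple K[OF m] T1[OF m]) auto
    also have "\<dots> \<le> C / 2 * (?d * real K * (?d * real K * T))"
    proof -
      have "(\<Sum>j\<in>(UNIV::'d set). \<Sum>l\<in>D m. ?d * real K * T) = ?d * (real (card (D m)) * (?d * real K * T))"
        by simp
      also have "\<dots> \<le> ?d * (real K * (?d * real K * T))"
        using K[OF m] T by (intro mult_left_mono mult_right_mono) auto
      finally show ?thesis using C by (intro mult_left_mono) (auto simp: mult_ac)
    qed
    finally have a: "\<bar>E (\<lambda>s. X m s $ k * (g k (W s) - g k (?Wm s) - (\<Sum>j\<in>UNIV. ?S s $ j * H j k (?Wm s))))\<bar>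
       \<le> C / 2 * (?d * real K * (?d * real K * T))" .
    have "E (\<lambda>s. X m s $ k * (g k (W s) - g k (?Wm s) - (\<Sum>j\<in>UNIV. ?S s $ j * H j k (?Wm s))))
      = E (\<lambda>s. X m s $ k * g k (W s) - X m s $ k * g k (?Wm s)
          - (\<Sum>j\<in>UNIV. \<Sum>l\<in>D m. X m s $ k * X l s $ j * H j k (?Wm s)))"
      by (simp add: right_diff_distrib sum_distrib_left sum_distrib_right mult_ac)
    \<comment> \<open>The zeroth-order term X_m g(Wm) has expectation 0 by \<open>indep1\<close>;
      only the original term and the first-order terms remain.\<close>
    also have "\<dots> = E (\<lambda>s. X m s $ k * g k (W s))
        - (\<Sum>j\<in>UNIV. \<Sum>l\<in>D m. E (\<lambda>s. X m s $ k * X l s $ j * H j k (?Wm s)))"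
      using indep1[OF m, of k "g k"] by (simp only: E_diff E_sum)
    finally have a': "\<bar>E (\<lambda>s. X m s $ k * g k (W s))
        - (\<Sum>j\<in>UNIV. \<Sum>l\<in>D m. E (\<lambda>s. X m s $ k * X l s $ j * H j k (?Wm s)))\<bar>
       \<le> C / 2 * (?d * real K * (?d * real K * T))" using a by simp
    have "\<bar>(\<Sum>j\<in>UNIV. \<Sum>l\<in>D m. E (\<lambda>s. X m s $ k * X l s $ j * H j k (?Wm s)))
        - (\<Sum>j\<in>UNIV. \<Sum>l\<in>D m. E (\<lambda>s. X m s $ k * X l s $ j) * E (\<lambda>s. H j k (W s)))\<bar>
      \<le> (\<Sum>j\<in>(UNIV::'d set). \<Sum>l\<in>D m. 3 * C * ?d * real K * T)"
      unfolding sum_subtractf[symmetric]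
      by (intro order_trans[OF sum_abs] sum_mono step2 m)
    also have "\<dots> = ?d * (real (card (D m)) * (3 * C * ?d * real K * T))" by simp
    also have "\<dots> \<le> ?d * (real K * (3 * C * ?d * real K * T))"
      using K[OF m] T C by (intro mult_left_mono mult_right_mono) auto
    finally have "\<bar>E (\<lambda>s. X m s $ k * g k (W s))
        - (\<Sum>j\<in>UNIV. \<Sum>l\<in>D m. E (\<lambda>s. X m s $ k * X l s $ j) * E (\<lambda>s. H j k (W s)))\<bar>
      \<le> C / 2 * (?d * real K * (?d * real K * T)) + ?d * (real K * (3 * C * ?d * real K * T))"
      using a' by linarith
    \<comment> \<open>The Taylor remainder contributes 1 / 2 and the decoupling 3; the sum is then
      rounded up to 4.\<close>
    also have "\<dots> = 7 / 2 * (?d ^ 2 * real K ^ 2 * C * T)"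
      by (simp add: power2_eq_square algebra_simps)
    also have "\<dots> \<le> 4 * (?d ^ 2 * real K ^ 2 * C * T)"
      using C T by (intro mult_right_mono) auto
    finally show ?thesis by (simp only: mult.assoc)
  qed
  have "E (\<lambda>s. \<Sum>k\<in>UNIV. W s $ k * g k (W s)) = (\<Sum>k\<in>UNIV. \<Sum>m\<in>I. E (\<lambda>s. X m s $ k * g k (W s)))"
    unfolding E_sum[symmetric] by (simp add: W_def sum_distrib_right)
  moreover have "(\<Sum>k\<in>UNIV. \<Sum>j\<in>UNIV. (\<Sum>m\<in>I. \<Sum>l\<in>D m. E (\<lambda>s. X m s $ k * X l s $ j)) * E (\<lambda>s. H j k (W s)))
    = (\<Sum>k\<in>UNIV. \<Sum>m\<in>I. \<Sum>j\<in>UNIV. \<Sum>l\<in>D m. E (\<lambda>s. X m s $ k * X l s $ j) * E (\<lambda>s. H j k (W s)))"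
    unfolding sum_distrib_right by (intro sum.cong refl sum.swap)
  ultimately have "\<bar>E (\<lambda>s. \<Sum>k\<in>UNIV. W s $ k * g k (W s))
      - (\<Sum>k\<in>UNIV. \<Sum>j\<in>UNIV. (\<Sum>m\<in>I. \<Sum>l\<in>D m. E (\<lambda>s. X m s $ k * X l s $ j)) * E (\<lambda>s. H j k (W s)))\<bar>
    \<le> (\<Sum>k\<in>(UNIV::'d set). \<Sum>m\<in>I. 4 * ?d ^ 2 * real K ^ 2 * C * T)"
    by (simp only: sum_subtractf[symmetric]) (intro order_trans[OF sum_abs] sum_mono step)
  also have "\<dots> = 4 * real (card I) * ?d ^ 3 * real K ^ 2 * C * T"
    by (simp add: power2_eq_square power3_eq_cube)
  finally show ?thesis .
qed

end

section \<open>Functions with bounded third derivatives\<close>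

text \<open>With c = 0 this is a Lipschitz bound, with c = D j x a first-order Taylor estimate. The
  mean value inequality along the segment from x to x + v asks for no continuity of the partial
  derivatives.\<close>

lemma mean_value_remainder:
  fixes f :: "real ^ 'd::finite \<Rightarrow> real"
  assumes df: "\<And>x. (f has_derivative (\<lambda>v. \<Sum>j\<in>UNIV. v $ j * D j x)) (at x)"
    and L: "\<And>t j. 0 \<le> t \<Longrightarrow> t \<le> 1 \<Longrightarrow> \<bar>D j (x + t *\<^sub>R v) - c j\<bar> \<le> L"
  shows "\<bar>f (x + v) - f x - (\<Sum>j\<in>UNIV. v $ j * c j)\<bar> \<le> L * (\<Sum>j\<in>UNIV. \<bar>v $ j\<bar>)"
proof -
  let ?\<phi> = "\<lambda>t. f (x + t *\<^sub>R v) - t * (\<Sum>j\<in>UNIV. v $ j * c j)"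
  have "((\<lambda>t. x + t *\<^sub>R v) has_derivative (\<lambda>s. s *\<^sub>R v)) (at t)" for t
    by (auto intro!: derivative_eq_intros)
  note * = has_derivative_compose[OF this df]
  have d1: "((\<lambda>t. f (x + t *\<^sub>R v)) has_real_derivative (\<Sum>j\<in>UNIV. v $ j * D j (x + t *\<^sub>R v))) (at t)" for t
  proof -
    have "(\<lambda>s. \<Sum>j\<in>UNIV. (s *\<^sub>R v) $ j * D j (x + t *\<^sub>R v)) = (*) (\<Sum>j\<in>UNIV. v $ j * D j (x + t *\<^sub>R v))"
      by (simp add: fun_eq_iff sum_distrib_left sum_distrib_right mult_ac)
    then show ?thesis
      using *[of t] unfolding has_field_derivative_def by (simp only:)
  qed
  have d: "(?\<phi> has_real_derivative (\<Sum>j\<in>UNIV. v $ j * (D j (x + t *\<^sub>R v) - c j))) (at t)" for t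
    by (rule DERIV_cong[OF DERIV_diff[OF d1 DERIV_cmult_right[OF DERIV_ident]]])
       (simp add: sum_subtractf right_diff_distrib)
  have "norm (?\<phi> 1 - ?\<phi> 0) \<le> (L * (\<Sum>j\<in>UNIV. \<bar>v $ j\<bar>)) * norm (1 - 0 :: real)"
  proof (rule field_differentiable_bound[of "{0..1}" ?\<phi> "\<lambda>t. \<Sum>j\<in>UNIV. v $ j * (D j (x + t *\<^sub>R v) - c j)"])
    fix t :: real assume t: "t \<in> {0..1}"
    show "(?\<phi> has_real_derivative (\<Sum>j\<in>UNIV. v $ j * (D j (x + t *\<^sub>R v) - c j))) (at t within {0..1})"
      using d by (rule has_field_derivative_at_within)
    have "\<bar>\<Sum>j\<in>UNIV. v $ j * (D j (x + t *\<^sub>R v) - c j)\<bar> \<le> (\<Sum>j\<in>UNIV. \<bar>v $ j\<bar> * L)"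
      using t by (intro order_trans[OF sum_abs] sum_mono) (auto simp: abs_mult intro!: mult_left_mono L)
    then show "norm (\<Sum>j\<in>UNIV. v $ j * (D j (x + t *\<^sub>R v) - c j)) \<le> L * (\<Sum>j\<in>UNIV. \<bar>v $ j\<bar>)"
      by (simp add: sum_distrib_left mult_ac)
  qed auto
  then show ?thesis by simp
qed

text \<open>The second-order bounds apply the mean value inequality to the remainders, whose
  derivatives are controlled by the first-order bounds; hence e^2 in place of e^2 / 2.\<close>

lemma sin_cos_second_order:
  fixes t e :: real
  shows "\<bar>sin (t + e) - sin t\<bar> \<le> \<bar>e\<bar>" "\<bar>cos (t + e) - cos t\<bar> \<le> \<bar>e\<bar>"
    and "\<bar>sin (t + e) - sin t - e * cos t\<bar> \<le> e\<^sup>2" "\<bar>cos (t + e) - cos t + e * sin t\<bar> \<le> e\<^sup>2"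
proof -
  have s: "\<bar>sin (t + a) - sin t\<bar> \<le> \<bar>a\<bar>" for a
    using field_differentiable_bound[of UNIV sin cos 1 "t + a" t] by (auto intro: DERIV_sin has_field_derivative_at_within)
  have c: "\<bar>cos (t + a) - cos t\<bar> \<le> \<bar>a\<bar>" for a
    using field_differentiable_bound[of UNIV cos "\<lambda>x. - sin x" 1 "t + a" t] by (auto intro: DERIV_cos has_field_derivative_at_within)
  show "\<bar>sin (t + e) - sin t\<bar> \<le> \<bar>e\<bar>" "\<bar>cos (t + e) - cos t\<bar> \<le> \<bar>e\<bar>" by (fact s c)+
  have "norm ((sin (t + e) - e * cos t) - (sin (t + 0) - 0 * cos t)) \<le> \<bar>e\<bar> * norm (e - 0)"
  proof (rule field_differentiable_bound[of "closed_segment 0 e" "\<lambda>a. sin (t + a) - a * cos t" "\<lambda>a. cos (t + a) - cos t"])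
    fix a assume "a \<in> closed_segment 0 e"
    then show "norm (cos (t + a) - cos t) \<le> \<bar>e\<bar>"
      using c[of a] by (auto simp: closed_segment_eq_real_ivl split: if_splits)
  qed (auto intro!: derivative_eq_intros)
  then show "\<bar>sin (t + e) - sin t - e * cos t\<bar> \<le> e\<^sup>2"
    by (simp add: power2_eq_square algebra_simps flip: abs_mult)
  have "norm ((cos (t + e) + e * sin t) - (cos (t + 0) + 0 * sin t)) \<le> \<bar>e\<bar> * norm (e - 0)"
  proof (rule field_differentiable_bound[of "closed_segment 0 e" "\<lambda>a. cos (t + a) + a * sin t" "\<lambda>a. sin t - sin (t + a)"])
    fix a assume "a \<in> closed_segment 0 e"
    then show "norm (sin t - sin (t + a)) \<le> \<bar>e\<bar>"
      using s[of a] by (auto simp: closed_segment_eq_real_ivl split: if_splits)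
  qed (auto intro!: derivative_eq_intros)
  then show "\<bar>cos (t + e) - cos t + e * sin t\<bar> \<le> e\<^sup>2"
    by (simp add: power2_eq_square algebra_simps flip: abs_mult)
qed

text \<open>A quadratic remainder with an explicit constant survives integration. This is how
  differentiation under the integral is carried out, with no dominated convergence.\<close>

lemma DERIV_if_quadratic_remainder:
  fixes f :: "real \<Rightarrow> real"
  assumes "\<And>e. \<bar>f (x + e) - f x - e * D\<bar> \<le> K * e\<^sup>2"
  shows "(f has_real_derivative D) (at x)"
  unfolding DERIV_def
proof (rule LIM_zero_cancel, rule Lim_null_comparison)
  have "norm ((f (x + e) - f x) / e - D) \<le> K * \<bar>e\<bar>" if "e \<noteq> 0" for e
  proof -
    have "\<bar>(f (x + e) - f x) / e - D\<bar> = \<bar>f (x + e) - f x - e * D\<bar> / \<bar>e\<bar>"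
      using that by (simp add: field_simps flip: abs_divide)
    also have "\<dots> \<le> K * e\<^sup>2 / \<bar>e\<bar>" using assms by (intro divide_right_mono) auto
    also have "\<dots> = K * \<bar>e\<bar>" using that by (simp add: field_simps power2_eq_square)
    finally show ?thesis by simp
  qed
  then show "\<forall>\<^sub>F e in at 0. norm ((f (x + e) - f x) / e - D) \<le> K * \<bar>e\<bar>"
    by (auto simp: eventually_at_filter)
  show "((\<lambda>e. K * \<bar>e\<bar>) \<longlongrightarrow> 0) (at 0)" by (auto intro!: tendsto_eq_intros)
qed

text \<open>Absorbs linear growth terms into bounds of the form A (1 + q^2).\<close>

lemma le_two_plus_square: "q \<le> 2 * (1 + q\<^sup>2)" for q :: real
proof -
  have "0 \<le> (q - 1)\<^sup>2 + 3 * q\<^sup>2 + 3" by (intro add_nonneg_nonneg) auto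
  then show ?thesis by (simp add: power2_eq_square algebra_simps)
qed

text \<open>All derivatives appear through their coordinates, the leftmost index being the latest
  direction of differentiation. The gradient \<open>g\<close> itself carries no bound: it may grow
  linearly and \<open>h\<close> quadratically, which second moments can integrate.\<close>

locale bounded_third_derivative =
  fixes h :: "real ^ 'd::finite \<Rightarrow> real" and g :: "'d \<Rightarrow> real ^ 'd \<Rightarrow> real"
    and H :: "'d \<Rightarrow> 'd \<Rightarrow> real ^ 'd \<Rightarrow> real" and T :: "'d \<Rightarrow> 'd \<Rightarrow> 'd \<Rightarrow> real ^ 'd \<Rightarrow> real"
    and C2 C3 :: real
  assumes dh: "\<And>x. (h has_derivative (\<lambda>v. \<Sum>k\<in>UNIV. v $ k * g k x)) (at x)"
    and dg: "\<And>k x. (g k has_derivative (\<lambda>v. \<Sum>j\<in>UNIV. v $ j * H j k x)) (at x)"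
    and dH: "\<And>j k x. (H j k has_derivative (\<lambda>v. \<Sum>i\<in>UNIV. v $ i * T i j k x)) (at x)"
    and C2: "\<And>j k x. \<bar>H j k x\<bar> \<le> C2" and C3: "\<And>i j k x. \<bar>T i j k x\<bar> \<le> C3"
begin

lemma C_nonneg: "0 \<le> C2" "0 \<le> C3"
  using C2 C3 abs_ge_zero order_trans by blast+

lemma H_lipschitz: "\<bar>H j k (x + v) - H j k x\<bar> \<le> C3 * (\<Sum>i\<in>UNIV. \<bar>v $ i\<bar>)"
  using mean_value_remainder[OF dH, where c = "\<lambda>_. 0" and L = C3] C3 by simp

lemma g_lipschitz: "\<bar>g k (x + v) - g k x\<bar> \<le> C2 * (\<Sum>i\<in>UNIV. \<bar>v $ i\<bar>)"
  using mean_value_remainder[OF dg, where c = "\<lambda>_. 0" and L = C2] C2 by simp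

lemma l1_segment:
  fixes v :: "real ^ 'd"
  assumes "0 \<le> t" "t \<le> 1"
  shows "(\<Sum>i\<in>UNIV. \<bar>(t *\<^sub>R v) $ i\<bar>) \<le> (\<Sum>i\<in>UNIV. \<bar>v $ i\<bar>)"
  using assms by (intro sum_mono) (auto simp: abs_mult mult_left_le_one_le)

lemma g_taylor:
  "\<bar>g k (x + v) - g k x - (\<Sum>j\<in>UNIV. v $ j * H j k x)\<bar> \<le> C3 * (\<Sum>i\<in>UNIV. \<bar>v $ i\<bar>)\<^sup>2"
proof -
  have "\<bar>g k (x + v) - g k x - (\<Sum>j\<in>UNIV. v $ j * H j k x)\<bar>
      \<le> C3 * (\<Sum>i\<in>UNIV. \<bar>v $ i\<bar>) * (\<Sum>j\<in>UNIV. \<bar>v $ j\<bar>)"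
    by (rule mean_value_remainder[OF dg])
       (intro order_trans[OF H_lipschitz] mult_left_mono l1_segment C_nonneg)
  then show ?thesis by (simp add: power2_eq_square mult.assoc)
qed

lemma h_taylor:
  "\<bar>h (x + v) - h x - (\<Sum>j\<in>UNIV. v $ j * g j x)\<bar> \<le> C2 * (\<Sum>i\<in>UNIV. \<bar>v $ i\<bar>)\<^sup>2"
proof -
  have "\<bar>h (x + v) - h x - (\<Sum>j\<in>UNIV. v $ j * g j x)\<bar>
      \<le> C2 * (\<Sum>i\<in>UNIV. \<bar>v $ i\<bar>) * (\<Sum>j\<in>UNIV. \<bar>v $ j\<bar>)"
    by (rule mean_value_remainder[OF dh])
       (intro order_trans[OF g_lipschitz] mult_left_mono l1_segment C_nonneg)
  then show ?thesis by (simp add: power2_eq_square mult.assoc)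
qed

lemma l1_le_norm: "(\<Sum>i\<in>UNIV. \<bar>v $ i\<bar>) \<le> real CARD('d) * norm (v :: real ^ 'd)"
  using sum_bounded_above[of UNIV "\<lambda>i. \<bar>v $ i\<bar>" "norm v"] component_le_norm_cart[of v] by simp

lemma g_growth: "\<bar>g k x\<bar> \<le> (\<Sum>k\<in>UNIV. \<bar>g k 0\<bar>) + C2 * real CARD('d) * norm x"
proof -
  have "\<bar>g k x - g k 0\<bar> \<le> C2 * (real CARD('d) * norm x)"
    using order_trans[OF g_lipschitz[of k 0 x] mult_left_mono[OF l1_le_norm C_nonneg(1)]] by simp
  moreover have "\<bar>g k 0\<bar> \<le> (\<Sum>k\<in>UNIV. \<bar>g k 0\<bar>)" by (rule member_le_sum) auto
  ultimately show ?thesis by (simp add: mult.assoc)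
qed

text \<open>The displacement v along the path differs from its linearisation in e by r, the
  second-order error of sine and cosine. So the remainder has two parts: the Taylor error of h over
  v, and the gradient applied to r. Both are quadratic in e, and quadratic in the norms of w and y,
  which keeps them integrable.\<close>

lemma path_second_order:
  "\<exists>A\<ge>0. \<forall>t e w y. \<bar>h (sin (t + e) *\<^sub>R w + cos (t + e) *\<^sub>R y) - h (sin t *\<^sub>R w + cos t *\<^sub>R y)
      - e * (\<Sum>k\<in>UNIV. (cos t * w $ k - sin t * y $ k) * g k (sin t *\<^sub>R w + cos t *\<^sub>R y))\<bar>
    \<le> A * (1 + (norm w + norm y)\<^sup>2) * e\<^sup>2"
proof -
  define d where "d = real CARD('d)"
  define G0 where "G0 = (\<Sum>k\<in>UNIV. \<bar>g k 0\<bar>)"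
  have d1: "d \<ge> 1" unfolding d_def using zero_less_card_finite[where 'a='d] by linarith
  have G0: "G0 \<ge> 0" unfolding G0_def by (simp add: sum_nonneg)
  \<comment> \<open>The part \<open>2 * C2 * d\<^sup>2\<close> collects the Taylor error and the
    linear growth of the gradient; the factor 2 in \<open>2 * d * G0\<close> pays for absorbing the
    linear term by \<open>le_two_plus_square\<close>.\<close>
  define A where "A = 2 * C2 * d\<^sup>2 + 2 * d * G0"
  have A: "A \<ge> 0" unfolding A_def using G0 d1 C_nonneg by auto
  have "\<bar>h (sin (t + e) *\<^sub>R w + cos (t + e) *\<^sub>R y) - h (sin t *\<^sub>R w + cos t *\<^sub>R y)
      - e * (\<Sum>k\<in>UNIV. (cos t * w $ k - sin t * y $ k) * g k (sin t *\<^sub>R w + cos t *\<^sub>R y))\<bar>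
    \<le> A * (1 + (norm w + norm y)\<^sup>2) * e\<^sup>2" for t e and w y :: "real ^ 'd"
  proof -
    define q where "q = norm w + norm y"
    have q0: "q \<ge> 0" unfolding q_def by simp
    define x where "x = sin t *\<^sub>R w + cos t *\<^sub>R y"
    define v where "v = (sin (t + e) - sin t) *\<^sub>R w + (cos (t + e) - cos t) *\<^sub>R y"
    define r where "r = (sin (t + e) - sin t - e * cos t) *\<^sub>R w + (cos (t + e) - cos t + e * sin t) *\<^sub>R y"
    have xv: "sin (t + e) *\<^sub>R w + cos (t + e) *\<^sub>R y = x + v"
      unfolding x_def v_def by (simp add: algebra_simps)
    have "norm v \<le> \<bar>e\<bar> * norm w + \<bar>e\<bar> * norm y"
      unfolding v_def by (rule norm_triangle_le) (intro add_mono; simp; intro mult_right_mono sin_cos_second_order norm_ge_zero)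
    then have nv: "norm v \<le> \<bar>e\<bar> * q" by (simp add: q_def distrib_left)
    have "norm r \<le> e\<^sup>2 * norm w + e\<^sup>2 * norm y"
      unfolding r_def by (rule norm_triangle_le) (intro add_mono; simp; intro mult_right_mono sin_cos_second_order norm_ge_zero)
    then have nr: "norm r \<le> e\<^sup>2 * q" by (simp add: q_def distrib_left)
    have "norm x \<le> \<bar>sin t\<bar> * norm w + \<bar>cos t\<bar> * norm y"
      unfolding x_def by (rule norm_triangle_le) simp
    also have "\<dots> \<le> 1 * norm w + 1 * norm y" by (intro add_mono mult_right_mono) auto
    finally have nx: "norm x \<le> q" by (simp add: q_def)
    have "(\<Sum>i\<in>UNIV. \<bar>v $ i\<bar>) \<le> d * (\<bar>e\<bar> * q)"
      using l1_le_norm[of v] nv d1 unfolding d_def[symmetric] by (meson mult_left_mono order_trans zero_le_one)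
    then have "(\<Sum>i\<in>UNIV. \<bar>v $ i\<bar>)\<^sup>2 \<le> (d * (\<bar>e\<bar> * q))\<^sup>2"
      by (intro power_mono sum_nonneg) auto
    then have "C2 * (\<Sum>i\<in>UNIV. \<bar>v $ i\<bar>)\<^sup>2 \<le> C2 * (d\<^sup>2 * q\<^sup>2 * e\<^sup>2)"
      using C_nonneg(1) by (intro mult_left_mono) (auto simp: power_mult_distrib mult_ac)
    then have a: "\<bar>h (x + v) - h x - (\<Sum>k\<in>UNIV. v $ k * g k x)\<bar> \<le> C2 * (d\<^sup>2 * q\<^sup>2 * e\<^sup>2)"
      using h_taylor order_trans by blast
    have gx: "\<bar>g k x\<bar> \<le> G0 + C2 * d * q" for k
      using g_growth[of k x] mult_left_mono[OF nx, of "C2 * d"] C_nonneg(1) d1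
      unfolding d_def[symmetric] G0_def[symmetric] by auto
    have "(\<Sum>k\<in>UNIV. v $ k * g k x) - e * (\<Sum>k\<in>UNIV. (cos t * w $ k - sin t * y $ k) * g k x)
        = (\<Sum>k\<in>UNIV. r $ k * g k x)"
      unfolding sum_distrib_left sum_subtractf[symmetric]
      by (intro sum.cong refl) (simp add: v_def r_def algebra_simps)
    also have "\<bar>\<dots>\<bar> \<le> (\<Sum>k\<in>UNIV. \<bar>r $ k\<bar> * (G0 + C2 * d * q))"
      by (intro order_trans[OF sum_abs] sum_mono) (auto simp: abs_mult intro!: mult_left_mono gx)
    also have "\<dots> = (\<Sum>k\<in>UNIV. \<bar>r $ k\<bar>) * (G0 + C2 * d * q)" by (simp add: sum_distrib_right)
    also have "\<dots> \<le> (d * (e\<^sup>2 * q)) * (G0 + C2 * d * q)"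
    proof (rule mult_right_mono)
      show "(\<Sum>k\<in>UNIV. \<bar>r $ k\<bar>) \<le> d * (e\<^sup>2 * q)"
        using l1_le_norm[of r] nr d1 unfolding d_def[symmetric] by (meson mult_left_mono order_trans zero_le_one)
      show "0 \<le> G0 + C2 * d * q" using G0 C_nonneg d1 q0 by simp
    qed
    finally have b: "\<bar>(\<Sum>k\<in>UNIV. v $ k * g k x) - e * (\<Sum>k\<in>UNIV. (cos t * w $ k - sin t * y $ k) * g k x)\<bar>
        \<le> (d * (e\<^sup>2 * q)) * (G0 + C2 * d * q)" .
    have "C2 * (d\<^sup>2 * q\<^sup>2 * e\<^sup>2) + (d * (e\<^sup>2 * q)) * (G0 + C2 * d * q) = (2 * C2 * d\<^sup>2 * q\<^sup>2 + d * G0 * q) * e\<^sup>2"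
      by (simp add: algebra_simps power2_eq_square)
    also have "\<dots> \<le> (A * (1 + q\<^sup>2)) * e\<^sup>2"
    proof (rule mult_right_mono)
      have "d * G0 * q \<le> d * G0 * (2 * (1 + q\<^sup>2))"
        using d1 G0 by (intro mult_left_mono le_two_plus_square) auto
      moreover have "2 * C2 * d\<^sup>2 * q\<^sup>2 \<le> 2 * C2 * d\<^sup>2 * (1 + q\<^sup>2)" using C_nonneg by (intro mult_left_mono) auto
      ultimately show "2 * C2 * d\<^sup>2 * q\<^sup>2 + d * G0 * q \<le> A * (1 + q\<^sup>2)"
        unfolding A_def by (simp add: algebra_simps)
    qed simp
    finally have c: "C2 * (d\<^sup>2 * q\<^sup>2 * e\<^sup>2) + (d * (e\<^sup>2 * q)) * (G0 + C2 * d * q) \<le> A * (1 + q\<^sup>2) * e\<^sup>2" .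
    show ?thesis unfolding xv x_def[symmetric] q_def[symmetric] using a b c by linarith
  qed
  then show ?thesis using A by blast
qed

lemma continuous_derivatives: "continuous_on UNIV h" "continuous_on UNIV (g k)" "continuous_on UNIV (H j k)"
  using dh dg dH by (meson has_derivative_continuous continuous_at_imp_continuous_on)+

lemma h_growth: "\<exists>A\<ge>0. \<forall>x. \<bar>h x\<bar> \<le> A * (1 + (norm x)\<^sup>2)"
proof -
  define d where "d = real CARD('d)"
  define A where "A = \<bar>h 0\<bar> + C2 * d\<^sup>2 + 2 * (\<Sum>k\<in>UNIV. \<bar>g k 0\<bar>)"
  have A: "A \<ge> 0" unfolding A_def using C_nonneg by (simp add: sum_nonneg)
  have "\<bar>h x\<bar> \<le> A * (1 + (norm x)\<^sup>2)" for x
  proof -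
    have a: "\<bar>h x - h 0 - (\<Sum>j\<in>UNIV. x $ j * g j 0)\<bar> \<le> C2 * (\<Sum>i\<in>UNIV. \<bar>x $ i\<bar>)\<^sup>2"
      using h_taylor[of 0 x] by simp
    have "(\<Sum>i\<in>UNIV. \<bar>x $ i\<bar>)\<^sup>2 \<le> (d * norm x)\<^sup>2"
      using l1_le_norm[of x] unfolding d_def by (intro power_mono sum_nonneg) auto
    then have b: "C2 * (\<Sum>i\<in>UNIV. \<bar>x $ i\<bar>)\<^sup>2 \<le> C2 * d\<^sup>2 * (norm x)\<^sup>2"
      using C_nonneg(1) by (simp add: power_mult_distrib mult_left_mono mult.assoc)
    have "\<bar>\<Sum>j\<in>UNIV. x $ j * g j 0\<bar> \<le> (\<Sum>j\<in>UNIV. norm x * \<bar>g j 0\<bar>)"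
      by (intro order_trans[OF sum_abs] sum_mono) (simp add: abs_mult mult_right_mono component_le_norm_cart)
    also have "\<dots> = (\<Sum>k\<in>UNIV. \<bar>g k 0\<bar>) * norm x" by (simp add: sum_distrib_left mult.commute)
    also have "\<dots> \<le> (\<Sum>k\<in>UNIV. \<bar>g k 0\<bar>) * (2 * (1 + (norm x)\<^sup>2))"
      by (intro mult_left_mono sum_nonneg le_two_plus_square) auto
    finally have c: "\<bar>\<Sum>j\<in>UNIV. x $ j * g j 0\<bar> \<le> (\<Sum>k\<in>UNIV. \<bar>g k 0\<bar>) * (2 * (1 + (norm x)\<^sup>2))" .
    have "\<bar>h x\<bar> \<le> \<bar>h 0\<bar> + C2 * d\<^sup>2 * (norm x)\<^sup>2 + (\<Sum>k\<in>UNIV. \<bar>g k 0\<bar>) * (2 * (1 + (norm x)\<^sup>2))"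
      using a b c by linarith
    also have "\<dots> \<le> A * (1 + (norm x)\<^sup>2)"
    proof -
      have "0 \<le> C2 * d\<^sup>2 + \<bar>h 0\<bar> * (norm x)\<^sup>2" using C_nonneg by simp
      then show ?thesis by (simp add: A_def algebra_simps)
    qed
    finally show ?thesis .
  qed
  then show ?thesis using A by blast
qed

end

section \<open>Interpolation between a finite distribution and a Gaussian\<close>

context bounded_third_derivative
begin

lemma path_norm:
  fixes w y :: "real ^ 'd"
  shows "norm (sin t *\<^sub>R w + cos t *\<^sub>R y) \<le> norm w + norm y"
  by (rule norm_triangle_le) (auto intro!: add_mono mult_left_le_one_le)

context
  fixes N :: "'b measure" and Y :: "'b \<Rightarrow> real ^ 'd"
  assumes N: "prob_space N" and Y[measurable]: "Y \<in> borel_measurable N"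
    and Y2: "integrable N (\<lambda>\<omega>. (norm (Y \<omega>))\<^sup>2)"
begin

lemma integrable_quadratic_growth:
  fixes F :: "'b \<Rightarrow> real"
  assumes [measurable]: "F \<in> borel_measurable N"
    and F: "\<And>\<omega>. \<bar>F \<omega>\<bar> \<le> A * (1 + (q + norm (Y \<omega>))\<^sup>2)" and A: "0 \<le> A"
  shows "integrable N F"
proof (rule Bochner_Integration.integrable_bound)
  interpret prob_space N by (rule N)
  let ?B = "\<lambda>\<omega>. A * (1 + (2 * q\<^sup>2 + 2 * (norm (Y \<omega>))\<^sup>2))"
  show "integrable N ?B" using Y2 by simp
  have "\<bar>F \<omega>\<bar> \<le> ?B \<omega>" for \<omega>
  proof -
    have "(q + norm (Y \<omega>))\<^sup>2 \<le> 2 * q\<^sup>2 + 2 * (norm (Y \<omega>))\<^sup>2"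
      using zero_le_power2[of "q - norm (Y \<omega>)"] by (simp add: power2_eq_square algebra_simps)
    then have "A * (1 + (q + norm (Y \<omega>))\<^sup>2) \<le> ?B \<omega>" using A by (intro mult_left_mono) auto
    then show ?thesis using F[of \<omega>] by linarith
  qed
  then show "AE \<omega> in N. norm (F \<omega>) \<le> norm (?B \<omega>)"
    by (intro AE_I2) (metis abs_ge_self order_trans real_norm_def)
qed simp

lemma measurable_path:
  assumes "continuous_on UNIV f"
  shows "(\<lambda>\<omega>. f (sin t *\<^sub>R w + cos t *\<^sub>R Y \<omega>) :: real) \<in> borel_measurable N"
  using borel_measurable_continuous_onI[OF assms] by measurable

lemma integrable_h_path: "integrable N (\<lambda>\<omega>. h (sin t *\<^sub>R w + cos t *\<^sub>R Y \<omega>))"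
proof -
  obtain A where A: "A \<ge> 0" "\<And>x. \<bar>h x\<bar> \<le> A * (1 + (norm x)\<^sup>2)" using h_growth by blast
  show ?thesis
  proof (rule integrable_quadratic_growth[of _ A "norm w"])
    fix \<omega>
    have "A * (1 + (norm (sin t *\<^sub>R w + cos t *\<^sub>R Y \<omega>))\<^sup>2) \<le> A * (1 + (norm w + norm (Y \<omega>))\<^sup>2)"
      using A(1) path_norm[of t w "Y \<omega>"] by (intro mult_left_mono add_left_mono power_mono) auto
    with A(2) show "\<bar>h (sin t *\<^sub>R w + cos t *\<^sub>R Y \<omega>)\<bar> \<le> A * (1 + (norm w + norm (Y \<omega>))\<^sup>2)"
      using order_trans by blast
  qed (use A measurable_path continuous_derivatives in auto)
qed

text \<open>A linearly growing factor times the linearly growing gradient is quadratic, hence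
  integrable by the second moment. Keeping L and U general allows both the use with Y along the path
  and the use with Z before the matrix R is applied.\<close>

lemma integrable_linear_g:
  assumes [measurable]: "L \<in> borel_measurable N" "U \<in> borel_measurable N"
    and L: "\<And>\<omega>. \<bar>L \<omega>\<bar> \<le> c * (1 + norm (Y \<omega>))" and U: "\<And>\<omega>. norm (U \<omega>) \<le> c * (1 + norm (Y \<omega>))"
    and c: "0 \<le> c"
  shows "integrable N (\<lambda>\<omega>. L \<omega> * g k (U \<omega>))"
proof -
  define B where "B = (\<Sum>k\<in>UNIV. \<bar>g k 0\<bar>) + C2 * real CARD('d)"
  have B: "B \<ge> 0" unfolding B_def using C_nonneg by (intro add_nonneg_nonneg sum_nonneg) auto
  have gB: "\<bar>g k x\<bar> \<le> B * (1 + norm x)" for x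
  proof -
    have "0 \<le> (\<Sum>k\<in>UNIV. \<bar>g k 0\<bar>) * norm x + C2 * real CARD('d)"
      using C_nonneg by (intro add_nonneg_nonneg mult_nonneg_nonneg sum_nonneg) auto
    then show ?thesis using g_growth[of k x] unfolding B_def by (simp add: algebra_simps)
  qed
  show ?thesis
  proof (rule integrable_quadratic_growth[of _ "c * (B * (1 + c))" 1])
    show "(\<lambda>\<omega>. L \<omega> * g k (U \<omega>)) \<in> borel_measurable N"
      using borel_measurable_continuous_onI[OF continuous_derivatives(2)] by measurable
    fix \<omega>
    let ?y = "1 + norm (Y \<omega>)"
    have "1 + norm (U \<omega>) \<le> (1 + c) * ?y"
    proof -
      have "(1 + c) * ?y = ?y + c * ?y" by (simp only: distrib_right mult_1)
      then show ?thesis using U[of \<omega>] norm_ge_zero[of "Y \<omega>"] by linarith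
    qed
    then have "\<bar>g k (U \<omega>)\<bar> \<le> B * ((1 + c) * ?y)"
      using gB[of "U \<omega>"] mult_left_mono[OF _ B] order_trans by blast
    then have "\<bar>L \<omega> * g k (U \<omega>)\<bar> \<le> (c * ?y) * (B * ((1 + c) * ?y))"
      unfolding abs_mult using c L by (intro mult_mono) auto
    also have "\<dots> = c * (B * (1 + c)) * ?y\<^sup>2" by (simp only: power2_eq_square mult_ac)
    also have "\<dots> \<le> c * (B * (1 + c)) * (1 + ?y\<^sup>2)" using c B by (intro mult_left_mono) auto
    finally show "\<bar>L \<omega> * g k (U \<omega>)\<bar> \<le> c * (B * (1 + c)) * (1 + ?y\<^sup>2)" .
  qed (use c B in auto)
qed

lemma integrable_g_path:
  shows "integrable N (\<lambda>\<omega>. Y \<omega> $ k * g k (sin t *\<^sub>R w + cos t *\<^sub>R Y \<omega>))"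
    and "integrable N (\<lambda>\<omega>. g k (sin t *\<^sub>R w + cos t *\<^sub>R Y \<omega>))"
proof -
  have U: "norm (sin t *\<^sub>R w + cos t *\<^sub>R Y \<omega>) \<le> (1 + norm w) * (1 + norm (Y \<omega>))" for \<omega>
  proof -
    have "norm w + norm (Y \<omega>) \<le> (1 + norm w) * (1 + norm (Y \<omega>))" by (simp add: algebra_simps)
    then show ?thesis using path_norm order_trans by blast
  qed
  have c: "a \<le> (1 + norm w) * (1 + norm (Y \<omega>))" if "a \<le> 1 + norm (Y \<omega>)" for a \<omega>
  proof -
    have "1 * (1 + norm (Y \<omega>)) \<le> (1 + norm w) * (1 + norm (Y \<omega>))" by (intro mult_right_mono) auto
    from order_trans[OF that this[unfolded mult_1]] show ?thesis .
  qed
  have "(\<lambda>\<omega>. Y \<omega> $ k) \<in> borel_measurable N"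
    using measurable_compose[OF Y borel_measurable_continuous_onI[of "\<lambda>x. x $ k"]]
    by (simp add: continuous_on_component)
  then show "integrable N (\<lambda>\<omega>. Y \<omega> $ k * g k (sin t *\<^sub>R w + cos t *\<^sub>R Y \<omega>))"
    by (rule integrable_linear_g[where c = "1 + norm w"])
       (auto intro!: U c order_trans[OF component_le_norm_cart])
  have "integrable N (\<lambda>\<omega>. 1 * g k (sin t *\<^sub>R w + cos t *\<^sub>R Y \<omega>))"
    by (rule integrable_linear_g[where c = "1 + norm w"]) (auto intro!: U c)
  then show "integrable N (\<lambda>\<omega>. g k (sin t *\<^sub>R w + cos t *\<^sub>R Y \<omega>))" by simp
qed

lemma integrable_H_path: "integrable N (\<lambda>\<omega>. H j k (sin t *\<^sub>R w + cos t *\<^sub>R Y \<omega>))"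
proof -
  interpret prob_space N by (rule N)
  show ?thesis
    by (rule integrable_const_bound[of _ C2]) (use C2 measurable_path continuous_derivatives in auto)
qed

text \<open>For fixed w the remainder bound of \<open>path_second_order\<close> is integrable in Y;
  integrating it gives the criterion of \<open>DERIV_if_quadratic_remainder\<close>.\<close>

lemma path_expectation_derivative:
  "((\<lambda>t. \<integral>\<omega>. h (sin t *\<^sub>R w + cos t *\<^sub>R Y \<omega>) \<partial>N) has_real_derivative
    (\<integral>\<omega>. (\<Sum>k\<in>UNIV. (cos t * w $ k - sin t * Y \<omega> $ k) * g k (sin t *\<^sub>R w + cos t *\<^sub>R Y \<omega>)) \<partial>N)) (at t)"
proof -
  interpret prob_space N by (rule N)
  obtain A where A: "A \<ge> 0" "\<forall>t e w y. \<bar>h (sin (t + e) *\<^sub>R w + cos (t + e) *\<^sub>R y) - h (sin t *\<^sub>R w + cos t *\<^sub>R y)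
      - e * (\<Sum>k\<in>UNIV. (cos t * w $ k - sin t * y $ k) * g k (sin t *\<^sub>R w + cos t *\<^sub>R y))\<bar>
    \<le> A * (1 + (norm w + norm y)\<^sup>2) * e\<^sup>2" using path_second_order by blast
  let ?D = "\<lambda>\<omega>. \<Sum>k\<in>UNIV. (cos t * w $ k - sin t * Y \<omega> $ k) * g k (sin t *\<^sub>R w + cos t *\<^sub>R Y \<omega>)"
  let ?B = "\<lambda>\<omega>. A * (1 + (norm w + norm (Y \<omega>))\<^sup>2)"
  have B: "integrable N ?B"
    by (rule integrable_quadratic_growth[of _ A "norm w"]) (use A(1) in auto)
  have D: "integrable N ?D"
    using integrable_g_path by (simp add: left_diff_distrib mult.assoc)
  show ?thesis
  proof (rule DERIV_if_quadratic_remainder[where K = "\<integral>\<omega>. ?B \<omega> \<partial>N"])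
    fix e
    let ?R = "\<lambda>\<omega>. h (sin (t + e) *\<^sub>R w + cos (t + e) *\<^sub>R Y \<omega>) - h (sin t *\<^sub>R w + cos t *\<^sub>R Y \<omega>) - e * ?D \<omega>"
    have "\<bar>\<integral>\<omega>. ?R \<omega> \<partial>N\<bar> \<le> (\<integral>\<omega>. ?B \<omega> * e\<^sup>2 \<partial>N)"
      using A(2)[rule_format] B D integrable_h_path
      by (intro order_trans[OF integral_abs_bound] integral_mono) auto
    also have "(\<integral>\<omega>. ?R \<omega> \<partial>N) = (\<integral>\<omega>. h (sin (t + e) *\<^sub>R w + cos (t + e) *\<^sub>R Y \<omega>) \<partial>N)
        - (\<integral>\<omega>. h (sin t *\<^sub>R w + cos t *\<^sub>R Y \<omega>) \<partial>N) - e * (\<integral>\<omega>. ?D \<omega> \<partial>N)"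
      using D integrable_h_path by simp
    finally show "\<bar>(\<integral>\<omega>. h (sin (t + e) *\<^sub>R w + cos (t + e) *\<^sub>R Y \<omega>) \<partial>N)
        - (\<integral>\<omega>. h (sin t *\<^sub>R w + cos t *\<^sub>R Y \<omega>) \<partial>N) - e * (\<integral>\<omega>. ?D \<omega> \<partial>N)\<bar> \<le> (\<integral>\<omega>. ?B \<omega> \<partial>N) * e\<^sup>2"
      by simp
  qed
qed

end

text \<open>Integrate by parts in each Z_i, with g k composed with the affine map z to sin t w + cos
  t R z. The chain rule gives cos t times the sum over j of R_ji H_jk, and weighting by R_ki and
  summing over i assembles the covariance R R^T.\<close>

lemma gaussian_path_integration_by_parts:
  fixes N :: "'b measure" and Z :: "'b \<Rightarrow> real ^ 'd" and R :: "real ^ 'd ^ 'd"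
  assumes N: "prob_space N" and Z: "std_normal_vector N Z"
  shows "(\<integral>\<omega>. (R *v Z \<omega>) $ k * g k (sin t *\<^sub>R w + cos t *\<^sub>R (R *v Z \<omega>)) \<partial>N)
    = (\<Sum>j\<in>UNIV. (R ** transpose R) $ k $ j * (cos t * (\<integral>\<omega>. H j k (sin t *\<^sub>R w + cos t *\<^sub>R (R *v Z \<omega>)) \<partial>N)))"
    and "(\<lambda>\<omega>. R *v Z \<omega>) \<in> borel_measurable N"
    and "integrable N (\<lambda>\<omega>. (norm (R *v Z \<omega>))\<^sup>2)"
proof -
  interpret prob_space N by (rule N)
  have cR: "continuous_on UNIV ((*v) R)" by (rule matrix_vector_mult_linear_continuous_on)
  have Zm: "Z \<in> borel_measurable N" by (rule std_normal_vector_measurable[OF N Z])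
  show Ym: "(\<lambda>\<omega>. R *v Z \<omega>) \<in> borel_measurable N"
    by (rule measurable_compose[OF Zm borel_measurable_continuous_onI[OF cR]])
  obtain c where c: "\<And>z. norm (R *v z) \<le> c * norm z"
    using linear_bounded[OF matrix_vector_mul_linear[of R]] by (metis mult.commute)
  have sq: "(norm (R *v z))\<^sup>2 \<le> c\<^sup>2 * (norm z)\<^sup>2" for z
    using power_mono[OF c norm_ge_zero, of z 2] by (simp add: power_mult_distrib)
  show Y2: "integrable N (\<lambda>\<omega>. (norm (R *v Z \<omega>))\<^sup>2)"
  proof (rule Bochner_Integration.integrable_bound)
    show "integrable N (\<lambda>\<omega>. c\<^sup>2 * (norm (Z \<omega>))\<^sup>2)"
      using std_normal_vector_square_integrable[OF N Z] by simp
    show "AE \<omega> in N. norm ((norm (R *v Z \<omega>))\<^sup>2) \<le> norm (c\<^sup>2 * (norm (Z \<omega>))\<^sup>2)"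
      using sq by (auto simp: abs_mult)
  qed (use Ym in measurable)
  let ?f = "\<lambda>z. g k (sin t *\<^sub>R w + cos t *\<^sub>R (R *v z))"
  let ?HH = "\<lambda>j z. H j k (sin t *\<^sub>R w + cos t *\<^sub>R (R *v z))"
  let ?f1 = "\<lambda>z v. \<Sum>j\<in>UNIV. (cos t *\<^sub>R (R *v v)) $ j * ?HH j z"
  have df: "(?f has_derivative ?f1 z) (at z)" for z
  proof -
    have "((\<lambda>z. sin t *\<^sub>R w + cos t *\<^sub>R (R *v z)) has_derivative (\<lambda>v. cos t *\<^sub>R (R *v v))) (at z)"
      by (rule has_derivative_eq_rhs[OF has_derivative_add[OF has_derivative_const
            has_derivative_scaleR_right[OF linear_imp_has_derivative[OF matrix_vector_mul_linear]]]]) simp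
    from has_derivative_compose[OF this dg] show ?thesis .
  qed
  have f1: "?f1 z (axis i 1) = cos t * (\<Sum>j\<in>UNIV. R $ j $ i * ?HH j z)" for z i
    by (simp add: matrix_vector_mul_component inner_axis sum_distrib_left mult_ac)
  have cHH: "continuous_on UNIV (?HH j)" for j
    by (rule continuous_on_compose2[OF continuous_derivatives(3)]) (auto intro!: continuous_intros cR)
  have int: "integrable N (\<lambda>\<omega>. Z \<omega> $ i * ?f (Z \<omega>))" for i
  \<comment> \<open>One constant has to dominate both Z_i and the path, whose norm is at most norm w
    + \<bar>c\<bar> norm Z. The absolute value appears because the operator bound c comes without a
    sign.\<close>
  proof (rule integrable_linear_g[OF N Zm std_normal_vector_square_integrable[OF N Z], where c = "1 + norm w + \<bar>c\<bar>"])
    fix \<omega>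
    have z: "a \<le> (1 + norm w + \<bar>c\<bar>) * (1 + norm (Z \<omega>))"
      if "a \<le> 1 + norm w + norm (Z \<omega>) + \<bar>c\<bar> * norm (Z \<omega>)" for a
    proof -
      have "(1 + norm w + \<bar>c\<bar>) * (1 + norm (Z \<omega>))
          = 1 + norm w + norm (Z \<omega>) + \<bar>c\<bar> * norm (Z \<omega>) + (norm w * norm (Z \<omega>) + \<bar>c\<bar>)"
        by (simp add: algebra_simps)
      moreover have "0 \<le> norm w * norm (Z \<omega>) + \<bar>c\<bar>" by simp
      ultimately show ?thesis using that by linarith
    qed
    have "0 \<le> \<bar>c\<bar> * norm (Z \<omega>)" "0 \<le> norm w" by simp_all
    then show "\<bar>Z \<omega> $ i\<bar> \<le> (1 + norm w + \<bar>c\<bar>) * (1 + norm (Z \<omega>))"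
      using component_le_norm_cart[of "Z \<omega>" i] by (intro z) linarith
    have "norm (R *v Z \<omega>) \<le> \<bar>c\<bar> * norm (Z \<omega>)"
      using c[of "Z \<omega>"] mult_right_mono[OF abs_ge_self norm_ge_zero, of c "Z \<omega>"] by linarith
    then show "norm (sin t *\<^sub>R w + cos t *\<^sub>R (R *v Z \<omega>)) \<le> (1 + norm w + \<bar>c\<bar>) * (1 + norm (Z \<omega>))"
      using path_norm[of t w "R *v Z \<omega>"] norm_ge_zero[of "Z \<omega>"] by (intro z) linarith
  qed (use std_normal_vector_component(1)[OF N Z] Ym in auto)
  have intH: "integrable N (\<lambda>\<omega>. ?HH j (Z \<omega>))" for j
    by (rule integrable_H_path[OF N Ym Y2])
  have ibp: "(\<integral>\<omega>. Z \<omega> $ i * ?f (Z \<omega>) \<partial>N) = cos t * (\<Sum>j\<in>UNIV. R $ j $ i * (\<integral>\<omega>. ?HH j (Z \<omega>) \<partial>N))" for i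
  proof -
    have bound: "\<bar>?f1 z (axis i 1)\<bar> \<le> (\<Sum>j\<in>UNIV. \<bar>R $ j $ i\<bar> * C2)" for z
    proof -
      have "\<bar>?f1 z (axis i 1)\<bar> \<le> 1 * \<bar>\<Sum>j\<in>UNIV. R $ j $ i * ?HH j z\<bar>"
        unfolding f1 abs_mult by (intro mult_right_mono) auto
      also have "\<dots> \<le> (\<Sum>j\<in>UNIV. \<bar>R $ j $ i\<bar> * C2)"
        unfolding mult_1 by (intro order_trans[OF sum_abs] sum_mono) (auto simp: abs_mult intro!: mult_left_mono C2)
      finally show ?thesis .
    qed
    have cont: "continuous_on UNIV (\<lambda>z. ?f1 z (axis i 1))"
      unfolding f1 by (intro continuous_intros cHH)
    have "(\<integral>\<omega>. Z \<omega> $ i * ?f (Z \<omega>) \<partial>N) = (\<integral>\<omega>. ?f1 (Z \<omega>) (axis i 1) \<partial>N)"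
      by (rule gaussian_integration_by_parts[OF N Z df cont bound int])
    then show ?thesis unfolding f1 using intH by simp
  qed
  have "(\<integral>\<omega>. (R *v Z \<omega>) $ k * ?f (Z \<omega>) \<partial>N) = (\<integral>\<omega>. (\<Sum>i\<in>UNIV. R $ k $ i * (Z \<omega> $ i * ?f (Z \<omega>))) \<partial>N)"
    by (simp add: matrix_vector_mult_def sum_distrib_right mult.assoc)
  also have "\<dots> = (\<Sum>i\<in>UNIV. R $ k $ i * (cos t * (\<Sum>j\<in>UNIV. R $ j $ i * (\<integral>\<omega>. ?HH j (Z \<omega>) \<partial>N))))"
    using int ibp by simp
  also have "\<dots> = (\<Sum>i\<in>UNIV. \<Sum>j\<in>UNIV. R $ k $ i * R $ j $ i * (cos t * (\<integral>\<omega>. ?HH j (Z \<omega>) \<partial>N)))"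
    by (simp add: sum_distrib_left mult_ac)
  also have "\<dots> = (\<Sum>j\<in>UNIV. \<Sum>i\<in>UNIV. R $ k $ i * R $ j $ i * (cos t * (\<integral>\<omega>. ?HH j (Z \<omega>) \<partial>N)))"
    by (rule sum.swap)
  also have "\<dots> = (\<Sum>j\<in>UNIV. (R ** transpose R) $ k $ j * (cos t * (\<integral>\<omega>. ?HH j (Z \<omega>) \<partial>N)))"
    by (simp add: matrix_matrix_mult_def transpose_def sum_distrib_right)
  finally show "(\<integral>\<omega>. (R *v Z \<omega>) $ k * g k (sin t *\<^sub>R w + cos t *\<^sub>R (R *v Z \<omega>)) \<partial>N)
    = (\<Sum>j\<in>UNIV. (R ** transpose R) $ k $ j * (cos t * (\<integral>\<omega>. H j k (sin t *\<^sub>R w + cos t *\<^sub>R (R *v Z \<omega>)) \<partial>N)))" .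
qed

text \<open>The hypothesis \<open>stein\<close> concerns a frozen value y, which stands for cos t Y.
  Since W lives on a finite weighted set, independence of W and Y amounts to combining the sum over
  that set with the integral over N. Gaussian integration by parts makes cos t a common factor of
  the derivative, and it is bounded by 1.\<close>

lemma interpolation_bound:
  fixes N :: "'b measure" and Z :: "'b \<Rightarrow> real ^ 'd" and R :: "real ^ 'd ^ 'd"
    and \<Omega> :: "'s set" and P :: "'s \<Rightarrow> real" and W :: "'s \<Rightarrow> real ^ 'd"
  assumes N: "prob_space N" and Z: "std_normal_vector N Z" and P: "sum P \<Omega> = 1"
    and stein: "\<And>t y. \<bar>(\<Sum>s\<in>\<Omega>. P s * (\<Sum>k\<in>UNIV. W s $ k * g k (sin t *\<^sub>R W s + y)))
      - sin t * (\<Sum>k\<in>UNIV. \<Sum>j\<in>UNIV. (R ** transpose R) $ k $ j * (\<Sum>s\<in>\<Omega>. P s * H j k (sin t *\<^sub>R W s + y)))\<bar> \<le> B"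
  shows "\<bar>(\<Sum>s\<in>\<Omega>. P s * h (W s)) - (\<integral>\<omega>. h (R *v Z \<omega>) \<partial>N)\<bar> \<le> B * (pi / 2)"
proof -
  interpret prob_space N by (rule N)
  note Ym = gaussian_path_integration_by_parts(2)[OF N Z, of R]
    and Y2 = gaussian_path_integration_by_parts(3)[OF N Z, of R]
  let ?Y = "\<lambda>\<omega>. R *v Z \<omega>" and ?S = "\<lambda>k j. (R ** transpose R) $ k $ j"
  let ?x = "\<lambda>t s \<omega>. sin t *\<^sub>R W s + cos t *\<^sub>R ?Y \<omega>"
  define \<Psi> where "\<Psi> t = (\<Sum>s\<in>\<Omega>. P s * (\<integral>\<omega>. h (?x t s \<omega>) \<partial>N))" for t
  define \<Psi>' where "\<Psi>' t = (\<Sum>s\<in>\<Omega>. P s * (\<integral>\<omega>. (\<Sum>k\<in>UNIV. (cos t * W s $ k - sin t * ?Y \<omega> $ k) * g k (?x t s \<omega>)) \<partial>N))" for t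
  have der: "(\<Psi> has_real_derivative \<Psi>' t) (at t)" for t
    unfolding \<Psi>_def \<Psi>'_def
    by (intro DERIV_sum DERIV_cmult path_expectation_derivative[OF N Ym Y2])
  have bound: "\<bar>\<Psi>' t\<bar> \<le> B" for t
  proof -
    have ig: "integrable N (\<lambda>\<omega>. g k (?x t s \<omega>))" "integrable N (\<lambda>\<omega>. ?Y \<omega> $ k * g k (?x t s \<omega>))" for k s
      by (rule integrable_g_path[OF N Ym Y2])+
    have iH: "integrable N (\<lambda>\<omega>. H j k (?x t s \<omega>))" for j k s
      by (rule integrable_H_path[OF N Ym Y2])
    let ?G = "\<lambda>\<omega>. (\<Sum>s\<in>\<Omega>. P s * (\<Sum>k\<in>UNIV. W s $ k * g k (?x t s \<omega>)))
      - sin t * (\<Sum>k\<in>UNIV. \<Sum>j\<in>UNIV. ?S k j * (\<Sum>s\<in>\<Omega>. P s * H j k (?x t s \<omega>)))"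
    have iG: "integrable N ?G" using ig iH by simp
    have one: "(\<integral>\<omega>. (\<Sum>k\<in>UNIV. (cos t * W s $ k - sin t * ?Y \<omega> $ k) * g k (?x t s \<omega>)) \<partial>N)
        = cos t * ((\<Sum>k\<in>UNIV. W s $ k * (\<integral>\<omega>. g k (?x t s \<omega>) \<partial>N))
          - sin t * (\<Sum>k\<in>UNIV. \<Sum>j\<in>UNIV. ?S k j * (\<integral>\<omega>. H j k (?x t s \<omega>) \<partial>N)))" for s
    proof -
      have "(\<integral>\<omega>. (\<Sum>k\<in>UNIV. (cos t * W s $ k - sin t * ?Y \<omega> $ k) * g k (?x t s \<omega>)) \<partial>N)
        = (\<integral>\<omega>. (\<Sum>k\<in>UNIV. cos t * W s $ k * g k (?x t s \<omega>) - sin t * (?Y \<omega> $ k * g k (?x t s \<omega>))) \<partial>N)"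
        by (simp add: left_diff_distrib mult.assoc)
      also have "\<dots> = (\<Sum>k\<in>UNIV. cos t * W s $ k * (\<integral>\<omega>. g k (?x t s \<omega>) \<partial>N)
          - sin t * (\<integral>\<omega>. ?Y \<omega> $ k * g k (?x t s \<omega>) \<partial>N))"
        using ig by simp
      also have "\<dots> = cos t * ((\<Sum>k\<in>UNIV. W s $ k * (\<integral>\<omega>. g k (?x t s \<omega>) \<partial>N))
          - sin t * (\<Sum>k\<in>UNIV. \<Sum>j\<in>UNIV. ?S k j * (\<integral>\<omega>. H j k (?x t s \<omega>) \<partial>N)))"
        unfolding gaussian_path_integration_by_parts(1)[OF N Z]
        by (simp add: sum_subtractf right_diff_distrib sum_distrib_left mult_ac)
      finally show ?thesis .
    qed
    have "\<Psi>' t = cos t * ((\<Sum>s\<in>\<Omega>. P s * (\<Sum>k\<in>UNIV. W s $ k * (\<integral>\<omega>. g k (?x t s \<omega>) \<partial>N)))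
        - sin t * (\<Sum>s\<in>\<Omega>. \<Sum>k\<in>UNIV. \<Sum>j\<in>UNIV. ?S k j * (P s * (\<integral>\<omega>. H j k (?x t s \<omega>) \<partial>N))))"
      unfolding \<Psi>'_def one by (simp add: sum_subtractf right_diff_distrib sum_distrib_left mult_ac)
    also have "(\<Sum>s\<in>\<Omega>. \<Sum>k\<in>UNIV. \<Sum>j\<in>UNIV. ?S k j * (P s * (\<integral>\<omega>. H j k (?x t s \<omega>) \<partial>N)))
        = (\<Sum>k\<in>UNIV. \<Sum>s\<in>\<Omega>. \<Sum>j\<in>UNIV. ?S k j * (P s * (\<integral>\<omega>. H j k (?x t s \<omega>) \<partial>N)))"
      by (rule sum.swap)
    also have "\<dots> = (\<Sum>k\<in>UNIV. \<Sum>j\<in>UNIV. ?S k j * (\<Sum>s\<in>\<Omega>. P s * (\<integral>\<omega>. H j k (?x t s \<omega>) \<partial>N)))"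
      unfolding sum_distrib_left by (intro sum.cong refl sum.swap)
    also have "cos t * ((\<Sum>s\<in>\<Omega>. P s * (\<Sum>k\<in>UNIV. W s $ k * (\<integral>\<omega>. g k (?x t s \<omega>) \<partial>N))) - sin t * \<dots>)
        = cos t * (\<integral>\<omega>. ?G \<omega> \<partial>N)"
      using ig iH by simp
    finally have "\<bar>\<Psi>' t\<bar> = \<bar>cos t\<bar> * \<bar>\<integral>\<omega>. ?G \<omega> \<partial>N\<bar>" by (simp add: abs_mult)
    also have "\<dots> \<le> 1 * (\<integral>\<omega>. B \<partial>N)"
      using iG stein
      by (intro mult_mono order_trans[OF integral_abs_bound] integral_mono) auto
    also have "\<dots> = B" by (simp add: prob_space)
    finally show ?thesis .
  qed
  have "norm (\<Psi> (pi / 2) - \<Psi> 0) \<le> B * norm (pi / 2 - 0)"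
    by (rule field_differentiable_bound[of UNIV \<Psi> \<Psi>']) (use der bound in auto)
  moreover have "\<Psi> (pi / 2) = (\<Sum>s\<in>\<Omega>. P s * h (W s))" unfolding \<Psi>_def by (simp add: prob_space)
  moreover have "\<Psi> 0 = (\<integral>\<omega>. h (R *v Z \<omega>) \<partial>N)"
    unfolding \<Psi>_def using P by (simp flip: sum_distrib_right)
  ultimately show ?thesis by simp
qed

end

section \<open>Bernoulli trials and cyclic windows\<close>

context expectation_functional
begin

text \<open>Both follow pointwise from AM-GM, x y z \<le> (x^3 + y^3 + z^3) / 3, which rests on the
  factorisation of x^3 + y^3 + z^3 - 3 x y z. For the product of expectations, nesting E in E plays
  the role of an independent copy, so that the same pointwise inequality applies.\<close>

lemma third_moment_bounds:
  assumes a: "E (\<lambda>s. \<bar>a s\<bar> ^ 3) \<le> T" and b: "E (\<lambda>s. \<bar>b s\<bar> ^ 3) \<le> T" and c: "E (\<lambda>s. \<bar>c s\<bar> ^ 3) \<le> T"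
  shows "E (\<lambda>s. \<bar>a s\<bar> * \<bar>b s\<bar> * \<bar>c s\<bar>) \<le> T"
    and "E (\<lambda>s. \<bar>a s\<bar> * \<bar>b s\<bar>) * E (\<lambda>s. \<bar>c s\<bar>) \<le> T"
proof -
  have amgm: "x * y * z \<le> 1 / 3 * (x ^ 3 + y ^ 3 + z ^ 3)" if "0 \<le> x" "0 \<le> y" "0 \<le> z" for x y z :: real
  proof -
    have "0 \<le> (x + y + z) * ((x - y)\<^sup>2 + (y - z)\<^sup>2 + (z - x)\<^sup>2)" using that by simp
    then show ?thesis by (simp add: power2_eq_square power3_eq_cube algebra_simps)
  qed
  have "E (\<lambda>s. \<bar>a s\<bar> * \<bar>b s\<bar> * \<bar>c s\<bar>) \<le> E (\<lambda>s. 1 / 3 * (\<bar>a s\<bar> ^ 3 + \<bar>b s\<bar> ^ 3 + \<bar>c s\<bar> ^ 3))"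
    by (intro E_mono amgm) auto
  also have "\<dots> \<le> T" using a b c unfolding E_cmult E_add by simp
  finally show "E (\<lambda>s. \<bar>a s\<bar> * \<bar>b s\<bar> * \<bar>c s\<bar>) \<le> T" .
  have "E (\<lambda>s. \<bar>a s\<bar> * \<bar>b s\<bar>) * E (\<lambda>s. \<bar>c s\<bar>) = E (\<lambda>s'. E (\<lambda>s. \<bar>c s\<bar>) * (\<bar>a s'\<bar> * \<bar>b s'\<bar>))"
    unfolding E_cmult by (rule mult.commute)
  also have "\<dots> = E (\<lambda>s'. E (\<lambda>s. \<bar>a s'\<bar> * \<bar>b s'\<bar> * \<bar>c s\<bar>))"
  proof -
    have "E (\<lambda>s. \<bar>c s\<bar>) * (\<bar>a s'\<bar> * \<bar>b s'\<bar>) = E (\<lambda>s. \<bar>a s'\<bar> * \<bar>b s'\<bar> * \<bar>c s\<bar>)" for s'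
      unfolding E_cmult by (rule mult.commute)
    then show ?thesis by simp
  qed
  also have "\<dots> \<le> E (\<lambda>s'. E (\<lambda>s. 1 / 3 * (\<bar>a s'\<bar> ^ 3 + \<bar>b s'\<bar> ^ 3 + \<bar>c s\<bar> ^ 3)))"
    by (intro E_mono amgm) auto
  also have "\<dots> \<le> T" using a b c unfolding E_cmult E_add E_const by simp
  finally show "E (\<lambda>s. \<bar>a s\<bar> * \<bar>b s\<bar>) * E (\<lambda>s. \<bar>c s\<bar>) \<le> T" .
qed

end

text \<open>An outcome of the trials is encoded as the set S of positions showing a success; this is
  its probability.\<close>

definition bern_weight :: "'i set \<Rightarrow> real \<Rightarrow> 'i set \<Rightarrow> real" where
  "bern_weight I p S = p ^ card S * (1 - p) ^ card (I - S)"

definition bern_ex :: "'i set \<Rightarrow> real \<Rightarrow> ('i set \<Rightarrow> real) \<Rightarrow> real" where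
  "bern_ex I p F = (\<Sum>S\<in>Pow I. bern_weight I p S * F S)"

lemma bern_weight_prod:
  assumes "finite I" "S \<subseteq> I"
  shows "bern_weight I p S = (\<Prod>i\<in>I. if i \<in> S then p else 1 - p)"
proof -
  have "(\<Prod>i\<in>I. if i \<in> S then p else 1 - p) = (\<Prod>i\<in>I \<inter> S. p) * (\<Prod>i\<in>I - S. 1 - p)"
    using prod.If_cases[OF assms(1), of "\<lambda>i. i \<in> S" "\<lambda>_. p" "\<lambda>_. 1 - p"]
    by (simp add: Diff_eq Collect_neg_eq)
  also have "I \<inter> S = S" using assms by blast
  finally show ?thesis by (simp add: bern_weight_def)
qed

text \<open>Multiply out the product over I of p + c_i, with c_i = 0 on A and c_i = 1 - p elsewhere.
  Subsets that miss a point of A contribute 0, the others their weight.\<close>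

lemma bern_ex_superset:
  assumes "finite I" "A \<subseteq> I"
  shows "bern_ex I p (\<lambda>S. of_bool (A \<subseteq> S)) = p ^ card A"
proof -
  have "(\<Prod>i\<in>I. p + (if i \<in> A then 0 else 1 - p))
      = (\<Sum>S\<in>Pow I. (\<Prod>i\<in>S. p) * (\<Prod>i\<in>I - S. if i \<in> A then 0 else 1 - p))"
    by (rule prod_add) fact
  also have "\<dots> = bern_ex I p (\<lambda>S. of_bool (A \<subseteq> S))"
    unfolding bern_ex_def bern_weight_def
  proof (intro sum.cong refl)
    fix S assume S: "S \<in> Pow I"
    show "(\<Prod>i\<in>S. p) * (\<Prod>i\<in>I - S. if i \<in> A then 0 else 1 - p) = p ^ card S * (1 - p) ^ card (I - S) * of_bool (A \<subseteq> S)"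
    proof (cases "A \<subseteq> S")
      case True
      then have "(\<Prod>i\<in>I - S. if i \<in> A then 0 else 1 - p) = (\<Prod>i\<in>I - S. 1 - p)"
        by (intro prod.cong) auto
      then show ?thesis using True by simp
    next
      case False
      then obtain i where "i \<in> A" "i \<notin> S" by blast
      then have "(\<Prod>i\<in>I - S. if i \<in> A then 0 else 1 - p) = 0"
        using assms by (intro prod_zero) auto
      then show ?thesis using False by simp
    qed
  qed
  also have "(\<Prod>i\<in>I. p + (if i \<in> A then 0 else 1 - p)) = (\<Prod>i\<in>I. if i \<in> A then p else 1)"
    by (intro prod.cong) auto
  also have "\<dots> = (\<Prod>i\<in>A. p)"
    using assms by (simp add: prod.inter_restrict[symmetric] Int_absorb1)
  finally show ?thesis by simp
qed

lemma bern_weight_sum: "finite I \<Longrightarrow> sum (bern_weight I p) (Pow I) = 1"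
  using bern_ex_superset[of I "{}" p] by (simp add: bern_ex_def)

lemma expectation_functional_bern_ex:
  assumes "finite I" "0 \<le> p" "p \<le> 1"
  shows "expectation_functional (bern_ex I p)"
proof
  show "bern_ex I p F \<le> bern_ex I p G" if "\<And>s. F s \<le> G s" for F G
    unfolding bern_ex_def using assms that by (intro sum_mono mult_left_mono) (auto simp: bern_weight_def)
  show "bern_ex I p (\<lambda>s. c) = c" for c
    unfolding bern_ex_def sum_distrib_right[symmetric] bern_weight_sum[OF assms(1)] by simp
qed (simp_all add: bern_ex_def sum.distrib distrib_left sum_distrib_left mult_ac)

text \<open>Fubini for the product weight: a subset of I is a subset of A joined with one of I -
  A.\<close>

lemma bern_ex_split:
  assumes "finite I" "A \<subseteq> I"
  shows "bern_ex I p F = bern_ex A p (\<lambda>S. bern_ex (I - A) p (\<lambda>T. F (S \<union> T)))"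
proof -
  have fin: "finite A" "finite (I - A)" using assms finite_subset by auto
  have "bern_ex I p F = (\<Sum>(S, T)\<in>Pow A \<times> Pow (I - A). bern_weight I p (S \<union> T) * F (S \<union> T))"
    unfolding bern_ex_def
    by (rule sum.reindex_bij_witness[where i = "\<lambda>(S, T). S \<union> T" and j = "\<lambda>U. (U \<inter> A, U - A)"])
       (use assms(2) in \<open>auto simp: Int_Un_distrib2 Un_Diff_Int Un_commute Int_Diff_Un\<close>)
  also have "\<dots> = (\<Sum>(S, T)\<in>Pow A \<times> Pow (I - A). bern_weight A p S * (bern_weight (I - A) p T * F (S \<union> T)))"
  proof (intro sum.cong refl, clarify)
    fix S T assume "S \<subseteq> A" "T \<subseteq> I - A"
    moreover have "S \<union> T \<subseteq> I" using calculation assms(2) by blast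
    moreover have "(\<Prod>i\<in>I. if i \<in> S \<union> T then p else 1 - p)
        = (\<Prod>i\<in>A. if i \<in> S \<union> T then p else 1 - p) * (\<Prod>i\<in>I - A. if i \<in> S \<union> T then p else 1 - p)"
      using prod.subset_diff[OF assms(2,1)] by (simp add: mult.commute)
    moreover have "(\<Prod>i\<in>A. if i \<in> S \<union> T then p else 1 - p) = (\<Prod>i\<in>A. if i \<in> S then p else 1 - p)"
      using calculation by (intro prod.cong) auto
    moreover have "(\<Prod>i\<in>I - A. if i \<in> S \<union> T then p else 1 - p) = (\<Prod>i\<in>I - A. if i \<in> T then p else 1 - p)"
      using calculation by (intro prod.cong) auto
    ultimately show "bern_weight I p (S \<union> T) * F (S \<union> T) = bern_weight A p S * (bern_weight (I - A) p T * F (S \<union> T))"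
      using assms(1) fin by (simp add: bern_weight_prod)
  qed
  also have "\<dots> = bern_ex A p (\<lambda>S. bern_ex (I - A) p (\<lambda>T. F (S \<union> T)))"
    unfolding bern_ex_def by (simp add: sum.cartesian_product sum_distrib_left)
  finally show ?thesis .
qed

text \<open>That F depends only on the trials in A is expressed by F S = F (S \<inter> A). After
  splitting I along A, F is constant in the inner variable and, B being disjoint from A, G is
  constant in the outer one.\<close>

lemma bern_ex_independent:
  assumes I: "finite I" and p: "0 \<le> p" "p \<le> 1" and A: "A \<subseteq> I" and AB: "A \<inter> B = {}"
    and F: "\<And>S. F S = F (S \<inter> A)" and G: "\<And>S. G S = G (S \<inter> B)"
  shows "bern_ex I p (\<lambda>S. F S * G S) = bern_ex I p F * bern_ex I p G"
proof -
  have fin: "finite A" "finite (I - A)" using I A finite_subset by auto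
  interpret a: expectation_functional "bern_ex A p" using expectation_functional_bern_ex fin p by blast
  interpret b: expectation_functional "bern_ex (I - A) p" using expectation_functional_bern_ex fin p by blast
  have cong: "bern_ex A p (\<lambda>S. bern_ex (I - A) p (\<lambda>T. f S T)) = bern_ex A p (\<lambda>S. bern_ex (I - A) p (\<lambda>T. f' S T))"
    if "\<And>S T. S \<subseteq> A \<Longrightarrow> T \<subseteq> I - A \<Longrightarrow> f S T = f' S T" for f f'
    unfolding bern_ex_def using that by (intro sum.cong arg_cong2[of _ _ _ _ "(*)"] refl) auto
  have FS: "F (S \<union> T) = F S" if "S \<subseteq> A" "T \<subseteq> I - A" for S T
  proof -
    have "(S \<union> T) \<inter> A = S \<inter> A" using that by blast
    then show ?thesis using F by metis
  qed
  have GT: "G (S \<union> T) = G T" if "S \<subseteq> A" "T \<subseteq> I - A" for S T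
  proof -
    have "(S \<union> T) \<inter> B = T \<inter> B" using that AB by blast
    then show ?thesis using G by metis
  qed
  have "bern_ex I p (\<lambda>S. F S * G S) = bern_ex A p (\<lambda>S. bern_ex (I - A) p (\<lambda>T. F S * G T))"
    unfolding bern_ex_split[OF I A, of p "\<lambda>S. F S * G S"] by (rule cong) (simp add: FS GT)
  also have "\<dots> = bern_ex A p F * bern_ex (I - A) p G"
    unfolding b.E_cmult by (subst mult.commute) (simp only: a.E_cmult mult.commute[of "F _"])
  also have "bern_ex A p F = bern_ex I p F"
    unfolding bern_ex_split[OF I A, of p F]
    by (subst cong[of _ "\<lambda>S T. F S"]) (simp_all add: FS b.E_const)
  also have "bern_ex (I - A) p G = bern_ex I p G"
    unfolding bern_ex_split[OF I A, of p G]
    by (subst cong[of _ "\<lambda>S T. G T"]) (simp_all add: GT a.E_const)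
  finally show ?thesis .
qed

section \<open>Cyclic windows: sizes and overlaps\<close>

definition window :: "nat \<Rightarrow> nat \<Rightarrow> nat \<Rightarrow> nat set" where
  "window n m i = (\<lambda>k. cyc n (m + k)) ` {..<i}"

lemma window_subset: "0 < n \<Longrightarrow> window n m i \<subseteq> {1..n}"
  unfolding window_def cyc_def by (auto simp: Suc_le_eq)

lemma window_mono: "i \<le> j \<Longrightarrow> window n m i \<subseteq> window n m j"
  unfolding window_def by auto

text \<open>The condition 1 \<le> m lets k be taken out of the truncated subtraction m + k -
  1.\<close>

lemma cyc_eq: "1 \<le> m \<Longrightarrow> cyc n (m + k) = Suc ((m - 1 + k) mod n)"
  unfolding cyc_def by simp

lemma inj_on_shift_mod:
  fixes a n :: nat
  shows "inj_on (\<lambda>k. (a + k) mod n) {..<n}"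
proof (rule linorder_inj_onI')
  fix x y assume xy: "x \<in> {..<n}" "y \<in> {..<n}" "x < y"
  then have "\<not> n dvd y - x" by (auto dest: dvd_imp_le)
  then show "(a + x) mod n \<noteq> (a + y) mod n"
    using xy mod_eq_dvd_iff_nat[of "a + x" "a + y" n] by auto
qed

lemma inj_on_Suc_shift_mod: "inj_on (\<lambda>k. Suc ((a + k) mod n)) {..<n}"
  using comp_inj_on[OF inj_on_shift_mod[of a n] inj_on_subset[OF inj_Suc subset_UNIV]] by (simp add: comp_def)

lemma card_window:
  assumes "1 \<le> m" "i \<le> n"
  shows "card (window n m i) = i"
proof -
  have "inj_on (\<lambda>k. cyc n (m + k)) {..<i}"
    unfolding cyc_eq[OF assms(1)]
    by (rule inj_on_subset[OF inj_on_Suc_shift_mod]) (use assms(2) in auto)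
  then show ?thesis unfolding window_def by (simp add: card_image)
qed

text \<open>A common point m + a = l + b on the circle, with a, b < d, forces l = m + (a - b). So l
  lies on an arc of 2 d consecutive positions starting d before m; the offset a + d - b, together
  with the added n, keeps the arithmetic inside the natural numbers.\<close>

lemma card_overlapping_windows:
  assumes m: "m \<in> {1..n}" and n: "2 * d \<le> n"
  shows "card {l \<in> {1..n}. window n m d \<inter> window n l d \<noteq> {}} \<le> 2 * d"
proof -
  have "{l \<in> {1..n}. window n m d \<inter> window n l d \<noteq> {}} \<subseteq> (\<lambda>u. Suc ((m - 1 + n - d + u) mod n)) ` {..<2 * d}"
  proof
    fix l assume "l \<in> {l \<in> {1..n}. window n m d \<inter> window n l d \<noteq> {}}"
    then obtain a b where l: "l \<in> {1..n}" and ab: "a < d" "b < d" and eq: "cyc n (m + a) = cyc n (l + b)"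
      unfolding window_def by auto
    have "1 \<le> m" "1 \<le> l" using m l by auto
    with eq have e: "(m - 1 + a) mod n = (l - 1 + b) mod n" by (simp add: cyc_eq)
    have "l - 1 < n" using l by auto
    then have "(l - 1 + n) mod n = l - 1" by (metis mod_add_self2 mod_less)
    have "(m - 1 + n - d + (a + d - b)) mod n = (m - 1 + a + (n - b)) mod n"
      using ab n by (intro arg_cong[of _ _ "\<lambda>x. x mod n"]) auto
    also have "\<dots> = (l - 1 + b + (n - b)) mod n" using e by (metis mod_add_left_eq)
    also have "l - 1 + b + (n - b) = l - 1 + n" using ab n by simp
    also have "(l - 1 + n) mod n = l - 1" by fact
    finally have "l = Suc ((m - 1 + n - d + (a + d - b)) mod n)" using l by simp
    moreover have "a + d - b < 2 * d" using ab by simp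
    ultimately show "l \<in> (\<lambda>u. Suc ((m - 1 + n - d + u) mod n)) ` {..<2 * d}" by blast
  qed
  then have "card {l \<in> {1..n}. window n m d \<inter> window n l d \<noteq> {}} \<le> card ((\<lambda>u. Suc ((m - 1 + n - d + u) mod n)) ` {..<2 * d})"
    by (intro card_mono) auto
  also have "\<dots> \<le> 2 * d" using card_image_le[of "{..<2 * d}" "\<lambda>u. Suc ((m - 1 + n - d + u) mod n)"] by simp
  finally show ?thesis .
qed

text \<open>Rotating the circle moves the first window to {0..<i} and the second to the arc of
  length j starting at e.\<close>

lemma card_window_overlap:
  assumes m: "m \<in> {1..n}" and e: "e < n" and i: "i \<le> n" and j: "j \<le> n"
  shows "card (window n m i \<inter> window n (Suc ((m - 1 + e) mod n)) j) = card {k\<in>{..<j}. (e + k) mod n < i}"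
proof -
  let ?r = "\<lambda>x. Suc ((m - 1 + x) mod n)"
  have inj: "inj_on ?r {..<n}" by (rule inj_on_Suc_shift_mod)
  have n: "0 < n" using e by simp
  have w1: "window n m i = ?r ` {..<i}"
    using m unfolding window_def by (intro image_cong) (auto simp: cyc_eq)
  have w2: "window n (?r e) j = ?r ` ((\<lambda>k. (e + k) mod n) ` {..<j})"
    unfolding window_def image_image
    by (intro image_cong refl) (simp add: cyc_def mod_add_left_eq mod_add_right_eq add.assoc)
  have "window n m i \<inter> window n (?r e) j = ?r ` ({..<i} \<inter> (\<lambda>k. (e + k) mod n) ` {..<j})"
    unfolding w1 w2 using n i by (intro inj_on_image_Int[OF inj, symmetric]) auto
  then have "card (window n m i \<inter> window n (?r e) j) = card ({..<i} \<inter> (\<lambda>k. (e + k) mod n) ` {..<j})"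
    using inj i by (simp add: card_image inj_on_subset subset_eq)
  also have "{..<i} \<inter> (\<lambda>k. (e + k) mod n) ` {..<j} = (\<lambda>k. (e + k) mod n) ` {k\<in>{..<j}. (e + k) mod n < i}"
    by auto
  also have "card \<dots> = card {k\<in>{..<j}. (e + k) mod n < i}"
    by (intro card_image inj_on_subset[OF inj_on_shift_mod[of e n]]) (use j in auto)
  finally show ?thesis .
qed

text \<open>As the second window travels round the circle, its overlap with the first rises through
  1, ..., i - 1, stays at i for j - i + 1 starting positions, and falls back through i - 1, ..., 1.
  The condition i + j \<le> n excludes overlaps at both ends at once.\<close>

lemma sum_over_window_overlaps:
  fixes f :: "nat \<Rightarrow> real"
  assumes m: "m \<in> {1..n}" and ij: "1 \<le> i" "i \<le> j" "i + j \<le> n" and f0: "f 0 = 0"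
  shows "(\<Sum>l=1..n. f (card (window n m i \<inter> window n l j)))
    = real (j - i + 1) * f i + 2 * (\<Sum>u=1..<i. f u)"
proof -
  have n: "0 < n" using m by simp
  let ?c = "\<lambda>e. card {k\<in>{..<j}. (e + k) mod n < i}"
  have "bij_betw (\<lambda>e. Suc ((m - 1 + e) mod n)) {..<n} {1..n}"
  proof (rule bij_betw_imageI)
    show inj: "inj_on (\<lambda>e. Suc ((m - 1 + e) mod n)) {..<n}"
      by (rule inj_on_Suc_shift_mod)
    show "(\<lambda>e. Suc ((m - 1 + e) mod n)) ` {..<n} = {1..n}"
      using inj n by (intro card_subset_eq) (auto simp: card_image Suc_le_eq)
  qed
  then have "(\<Sum>l=1..n. f (card (window n m i \<inter> window n l j)))
     = (\<Sum>e<n. f (card (window n m i \<inter> window n (Suc ((m - 1 + e) mod n)) j)))"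
    by (rule sum.reindex_bij_betw[symmetric])
  also have "\<dots> = (\<Sum>e<n. f (?c e))"
    using card_window_overlap[OF m] ij by (intro sum.cong refl arg_cong[of _ _ f]) auto
  txt \<open>Offsets between \<open>i\<close> and \<open>n - j\<close> give disjoint windows, larger ones wrap around the circle.\<close>
  also have "\<dots> = (\<Sum>e\<in>{..<i} \<union> {n - j + 1..<n}. f (?c e))"
  proof (rule sum.mono_neutral_right)
    show "\<forall>e\<in>{..<n} - ({..<i} \<union> {n - j + 1..<n}). f (?c e) = 0"
    proof
      fix e assume e: "e \<in> {..<n} - ({..<i} \<union> {n - j + 1..<n})"
      have "(e + k) mod n = e + k" if "k < j" for k using that e ij by (intro mod_less) auto
      then have "{k\<in>{..<j}. (e + k) mod n < i} = {}" using e by auto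
      then show "f (?c e) = 0" by (simp only: card.empty f0)
    qed
  qed (use ij in auto)
  also have "\<dots> = (\<Sum>e<i. f (?c e)) + (\<Sum>e=n - j + 1..<n. f (?c e))"
    using ij by (intro sum.union_disjoint) auto
  also have "(\<Sum>e<i. f (?c e)) = (\<Sum>u=1..i. f u)"
  proof -
    have "?c e = i - e" if "e < i" for e
    proof -
      have "(e + k) mod n = e + k" if "k < j" for k using that \<open>e < i\<close> ij by (intro mod_less) auto
      then have "{k\<in>{..<j}. (e + k) mod n < i} = {..<i - e}" using that ij by auto
      then show ?thesis by simp
    qed
    then have "(\<Sum>e<i. f (?c e)) = (\<Sum>e<i. f (i - e))" by simp
    also have "\<dots> = (\<Sum>u=1..i. f u)"
      by (rule sum.reindex_bij_witness[where i = "\<lambda>u. i - u" and j = "\<lambda>e. i - e"]) auto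
    finally show ?thesis .
  qed
  \<comment> \<open>A wrapping window starts n - e positions before m, so j - (n - e) of its
    positions reach m or lie beyond, and at most i of these fall in the first window.\<close>
  also have "(\<Sum>e=n - j + 1..<n. f (?c e)) = (\<Sum>u=1..<j. f (min u i))"
  proof -
    have "?c e = min (j - (n - e)) i" if "e \<in> {n - j + 1..<n}" for e
    proof -
      have md: "(e + k) mod n = (if e + k < n then e + k else e + k - n)" if "k < j" for k
        using that \<open>e \<in> _\<close> ij by (auto simp: le_mod_geq)
      have "{k\<in>{..<j}. (e + k) mod n < i} = {n - e..<n - e + min (j - (n - e)) i}"
      proof (rule set_eqI)
        fix k
        have "k \<in> {k\<in>{..<j}. (e + k) mod n < i} \<longleftrightarrow> k < j \<and> (if e + k < n then e + k else e + k - n) < i"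
          using md by auto
        also have "\<dots> \<longleftrightarrow> n - e \<le> k \<and> k < n - e + min (j - (n - e)) i"
        proof -
          obtain r where r: "n = e + r" using \<open>e \<in> _\<close> by (metis atLeastLessThan_iff le_iff_add less_imp_le)
          have "i \<le> e" "r < j" using \<open>e \<in> _\<close> ij r by auto
          then show ?thesis unfolding r min_def by (cases "k < r") auto
        qed
        finally show "k \<in> {k\<in>{..<j}. (e + k) mod n < i} \<longleftrightarrow> k \<in> {n - e..<n - e + min (j - (n - e)) i}"
          by simp
      qed
      then show ?thesis by simp
    qed
    then have "(\<Sum>e=n - j + 1..<n. f (?c e)) = (\<Sum>e=n - j + 1..<n. f (min (j - (n - e)) i))" by simp
    also have "\<dots> = (\<Sum>u=1..<j. f (min u i))"
      by (rule sum.reindex_bij_witness[where i = "\<lambda>u. u + n - j" and j = "\<lambda>e. j - (n - e)"]) (use ij in auto)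
    finally show ?thesis .
  qed
  also have "(\<Sum>u=1..i. f u) + (\<Sum>u=1..<j. f (min u i)) = real (j - i + 1) * f i + 2 * (\<Sum>u=1..<i. f u)"
  proof -
    have "(\<Sum>u=1..i. f u) = (\<Sum>u=1..<i. f u) + f i"
      using ij by (simp add: atLeastLessThanSuc_atLeastAtMost[symmetric])
    moreover have "(\<Sum>u=1..<j. f (min u i)) = (\<Sum>u=1..<i. f (min u i)) + (\<Sum>u=i..<j. f (min u i))"
      by (rule sum.atLeastLessThan_concat[symmetric]) (use ij in auto)
    moreover have "(\<Sum>u=i..<j. f (min u i)) = real (j - i) * f i" by simp
    moreover have "(\<Sum>u=1..<i. f (min u i)) = (\<Sum>u=1..<i. f u)" by (intro sum.cong) auto
    ultimately have "(\<Sum>u=1..i. f u) + (\<Sum>u=1..<j. f (min u i))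
        = ((\<Sum>u=1..<i. f u) + f i) + ((\<Sum>u=1..<i. f u) + real (j - i) * f i)"
      by (simp only:)
    also have "\<dots> = (real (j - i) + 1) * f i + 2 * (\<Sum>u=1..<i. f u)"
      by (simp only: distrib_right mult_1 mult_2 add_ac)
    finally show ?thesis by simp
  qed
  finally show ?thesis .
qed

text \<open>Summation by parts: the factor 1 - p turns the coefficients c + 2 k into their
  increments 2. For c = j - i + 1 the left side is the weighted overlap count and the right side the
  sum in \<open>sigma\<close>, with the 1 - p that the normalisation cancels.\<close>

lemma sigma_telescope:
  fixes p c :: real
  shows "c * (1 - p ^ i) + 2 * (\<Sum>v=1..<i. p ^ v - p ^ i) = (1 - p) * (\<Sum>k<i. (c + 2 * real k) * p ^ k)"
proof (cases i)
  case (Suc i')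
  have "c * (1 - p ^ Suc i') + 2 * (\<Sum>v=1..<Suc i'. p ^ v - p ^ Suc i') = (1 - p) * (\<Sum>k<Suc i'. (c + 2 * real k) * p ^ k)"
  proof (induction i')
    case (Suc i)
    have *: "(\<Sum>v=1..<Suc a. p ^ v - x) = (\<Sum>v=1..<Suc a. p ^ v) - real a * x" for a x
      by (simp add: sum_subtractf)
    show ?case using Suc unfolding * by (simp add: algebra_simps)
  qed (simp add: algebra_simps)
  then show ?thesis using Suc by simp
qed simp

section \<open>The vector of runs\<close>

text \<open>The term of W belonging to the starting position m, already normalised, as a function of
  the success set; a product of trials becomes the indicator that its window lies in S.\<close>

definition run_summand :: "nat \<Rightarrow> real \<Rightarrow> ('d::finite \<Rightarrow> nat) \<Rightarrow> nat \<Rightarrow> nat set \<Rightarrow> real ^ 'd" where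
  "run_summand n p idx m S =
     (\<chi> a. (of_bool (window n m (idx a) \<subseteq> S) - p ^ idx a) / sqrt (real n * p ^ idx a * (1 - p)))"

text \<open>The condition 2 d \<le> n, equivalent to n > 2 d - 1, gives i + j \<le> n for all window
  lengths up to d, as required for counting overlaps.\<close>

locale runs =
  fixes n d :: nat and p :: real and idx :: "'d::finite \<Rightarrow> nat"
  assumes d: "d = CARD('d)" and p: "0 < p" "p < 1" and idx: "bij_betw idx UNIV {1..d}" and n: "2 * d \<le> n"
begin

abbreviation "X \<equiv> run_summand n p idx"
text \<open>Neighbours are decided by windows of full length d because the vector X m reads windows
  of every length up to d.\<close>

abbreviation "D m \<equiv> {l \<in> {1..n}. window n m d \<inter> window n l d \<noteq> {}}"
abbreviation "E \<equiv> bern_ex {1..n} p"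

lemma n_pos: "0 < n" and d_pos: "0 < d"
  using n d zero_less_card_finite[where 'a='d] by linarith+

lemma idx_bounds: "1 \<le> idx a" "idx a \<le> d"
  using bij_betwE[OF idx] by auto

sublocale E: expectation_functional E
  using p by (intro expectation_functional_bern_ex) auto

lemma window_subset_I: "window n m i \<subseteq> {1..n}"
  by (rule window_subset[OF n_pos])

lemma summand_sum_local:
  "(\<Sum>l\<in>L. X l S) = (\<Sum>l\<in>L. X l (S \<inter> (\<Union>l\<in>L. window n l d)))"
proof (rule sum.cong[OF refl])
  fix l assume "l \<in> L"
  then have "window n l (idx a) \<subseteq> (\<Union>l\<in>L. window n l d)" for a
    using window_mono[OF idx_bounds(2), of n l a] by blast
  then show "X l S = X l (S \<inter> (\<Union>l\<in>L. window n l d))"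
    by (simp add: run_summand_def)
qed

lemma summand_local: "X l S = X l (S \<inter> window n l d)"
  using summand_sum_local[where L = "{l}" and S = S] by simp

section \<open>Means, independence and covariances of the summands\<close>

lemma E_window: "E (\<lambda>S. of_bool (window n m i \<subseteq> S)) = p ^ card (window n m i)"
  using window_subset_I by (intro bern_ex_superset) auto

lemma E_summand:
  assumes "m \<in> {1..n}"
  shows "E (\<lambda>S. X m S $ k) = 0"
proof -
  have "X m S $ k = 1 / sqrt (real n * p ^ idx k * (1 - p)) * (of_bool (window n m (idx k) \<subseteq> S) - p ^ idx k)" for S
    by (simp add: run_summand_def)
  moreover have "card (window n m (idx k)) = idx k"
    using assms idx_bounds[of k] n by (auto intro!: card_window)
  ultimately show ?thesis by (simp only: E.E_cmult E.E_diff E.E_const E_window) simp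
qed

lemma summand_independent:
  assumes AB: "A \<inter> (\<Union>l\<in>L. window n l d) = {}" and A: "A \<subseteq> {1..n}" and F: "\<And>S. F S = F (S \<inter> A)"
  shows "E (\<lambda>S. F S * \<phi> (\<Sum>l\<in>L. X l S)) = E F * E (\<lambda>S. \<phi> (\<Sum>l\<in>L. X l S))"
  using bern_ex_independent[of "{1..n}" p A "\<Union>l\<in>L. window n l d" F "\<lambda>S. \<phi> (\<Sum>l\<in>L. X l S)"]
    p A AB F summand_sum_local[where L = L] by fastforce

lemma summand_indep1:
  assumes "m \<in> {1..n}"
  shows "E (\<lambda>S. X m S $ k * \<phi> (\<Sum>l\<in>{1..n} - D m. X l S)) = 0"
proof -
  have "E (\<lambda>S. X m S $ k * \<phi> (\<Sum>l\<in>{1..n} - D m. X l S))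
      = E (\<lambda>S. X m S $ k) * E (\<lambda>S. \<phi> (\<Sum>l\<in>{1..n} - D m. X l S))"
    by (rule summand_independent[of "window n m d"]) (use window_subset_I summand_local in auto)
  then show ?thesis using E_summand[OF assms] by simp
qed

lemma summand_indep2:
  "E (\<lambda>S. X m S $ k * X l S $ j * \<phi> (\<Sum>l'\<in>{1..n} - (D m \<union> D l). X l' S))
    = E (\<lambda>S. X m S $ k * X l S $ j) * E (\<lambda>S. \<phi> (\<Sum>l'\<in>{1..n} - (D m \<union> D l). X l' S))"
proof (rule summand_independent[of "window n m d \<union> window n l d"])
  have "X m S = X m (S \<inter> (window n m d \<union> window n l d))" "X l S = X l (S \<inter> (window n m d \<union> window n l d))" for S
    using summand_local[of m S] summand_local[of m "S \<inter> (window n m d \<union> window n l d)"]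
      summand_local[of l S] summand_local[of l "S \<inter> (window n m d \<union> window n l d)"]
    by (simp_all add: Int_assoc Int_absorb1 Int_Un_distrib2 inf_sup_absorb sup_inf_absorb)
  then show "X m S $ k * X l S $ j = X m (S \<inter> (window n m d \<union> window n l d)) $ k * X l (S \<inter> (window n m d \<union> window n l d)) $ j" for S
    by metis
qed (use window_subset_I in auto)

text \<open>The product of two window indicators is the indicator of the union, so the covariance
  depends on the positions only through the size of the overlap.\<close>

lemma covariance_summand:
  assumes "m \<in> {1..n}" "l \<in> {1..n}"
  shows "E (\<lambda>S. X m S $ k * X l S $ j)
    = (p ^ (idx k + idx j - card (window n m (idx k) \<inter> window n l (idx j))) - p ^ (idx k + idx j))
      / (sqrt (real n * p ^ idx k * (1 - p)) * sqrt (real n * p ^ idx j * (1 - p)))"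
proof -
  let ?A = "window n m (idx k)" and ?B = "window n l (idx j)"
  let ?s = "sqrt (real n * p ^ idx k * (1 - p)) * sqrt (real n * p ^ idx j * (1 - p))"
  have cA: "card ?A = idx k" and cB: "card ?B = idx j"
    using assms idx_bounds[of k] idx_bounds[of j] n by (auto intro!: card_window)
  have fin: "finite ?A" "finite ?B" by (simp_all add: window_def)
  have alg: "(a - x) / u * ((b - y) / v) = 1 / (u * v) * (a * b - y * a - x * b + x * y)" for a b x y u v :: real
    by (simp add: algebra_simps add_divide_distrib diff_divide_distrib)
  have "X m S $ k * X l S $ j = 1 / ?s * (of_bool (?A \<union> ?B \<subseteq> S) - p ^ idx j * of_bool (?A \<subseteq> S)
      - p ^ idx k * of_bool (?B \<subseteq> S) + p ^ (idx k + idx j))" for S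
    by (simp only: run_summand_def vec_lambda_beta alg Un_subset_iff of_bool_conj power_add)
  then have "E (\<lambda>S. X m S $ k * X l S $ j) = 1 / ?s * (E (\<lambda>S. of_bool (?A \<union> ?B \<subseteq> S))
      - p ^ idx j * p ^ idx k - p ^ idx k * p ^ idx j + p ^ (idx k + idx j))"
    by (simp only: E.E_cmult E.E_add E.E_diff E.E_const E_window cA cB)
  also have "E (\<lambda>S. of_bool (?A \<union> ?B \<subseteq> S)) = p ^ card (?A \<union> ?B)"
    using window_subset_I by (intro bern_ex_superset) auto
  also have "card (?A \<union> ?B) = idx k + idx j - card (?A \<inter> ?B)"
    using card_Un_Int[OF fin] cA cB by simp
  finally show ?thesis by (simp add: power_add mult.commute diff_divide_distrib)
qed

text \<open>The row sum over l is the same for every m, and the n rows cancel the n of the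
  normalisation. Disjoint windows contribute 0, as \<open>sum_over_window_overlaps\<close> demands
  of its f.\<close>

lemma covariance_le:
  assumes ij: "idx k \<le> idx j"
  shows "(\<Sum>m=1..n. \<Sum>l=1..n. E (\<lambda>S. X m S $ k * X l S $ j)) = sigma p (idx k) (idx j)"
proof -
  let ?i = "idx k" and ?j = "idx j"
  let ?s = "sqrt (real n * p ^ ?i * (1 - p)) * sqrt (real n * p ^ ?j * (1 - p))"
  let ?f = "\<lambda>u. p ^ (?i + ?j - u) - p ^ (?i + ?j)"
  let ?c = "real (?j - ?i + 1)"
  \<comment> \<open>Since i + j - u = j + (i - u), a factor p^j comes out, and the reflection v = i
    - u leads to the sum of \<open>sigma_telescope\<close>.\<close>
  have "(\<Sum>u=1..<?i. ?f u) = (\<Sum>u=1..<?i. p ^ ?j * (p ^ (?i - u) - p ^ ?i))"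
    by (intro sum.cong refl) (simp add: right_diff_distrib add.commute flip: power_add)
  also have "\<dots> = p ^ ?j * (\<Sum>v=1..<?i. p ^ v - p ^ ?i)"
    unfolding sum_distrib_left
    by (rule sum.reindex_bij_witness[where i = "\<lambda>u. ?i - u" and j = "\<lambda>u. ?i - u"]) auto
  finally have s1: "(\<Sum>u=1..<?i. ?f u) = p ^ ?j * (\<Sum>v=1..<?i. p ^ v - p ^ ?i)" .
  have s2: "?f ?i = p ^ ?j * (1 - p ^ ?i)" by (simp add: power_add algebra_simps)
  have row: "(\<Sum>l=1..n. E (\<lambda>S. X m S $ k * X l S $ j)) = p ^ ?j * (1 - p) * (\<Sum>v<?i. (?c + 2 * real v) * p ^ v) / ?s"
    if m: "m \<in> {1..n}" for m
  proof -
    have "(\<Sum>l=1..n. E (\<lambda>S. X m S $ k * X l S $ j)) = (\<Sum>l=1..n. ?f (card (window n m ?i \<inter> window n l ?j))) / ?s"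
      unfolding sum_divide_distrib using covariance_summand[OF m] by (intro sum.cong) auto
    also have "(\<Sum>l=1..n. ?f (card (window n m ?i \<inter> window n l ?j))) = ?c * ?f ?i + 2 * (\<Sum>u=1..<?i. ?f u)"
      using sum_over_window_overlaps[OF m idx_bounds(1) ij, of ?f] idx_bounds(2)[of k] idx_bounds(2)[of j] n by simp
    also have "\<dots> = p ^ ?j * (?c * (1 - p ^ ?i) + 2 * (\<Sum>v=1..<?i. p ^ v - p ^ ?i))"
      unfolding s1 s2 by (simp add: algebra_simps)
    also have "\<dots> = p ^ ?j * ((1 - p) * (\<Sum>v<?i. (?c + 2 * real v) * p ^ v))"
      unfolding sigma_telescope ..
    finally show ?thesis by (simp only: mult.assoc)
  qed
  have s: "?s = real n * (1 - p) * (sqrt (p ^ ?i) * sqrt (p ^ ?j))"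
  proof -
    have "?s = (sqrt (real n) * sqrt (real n)) * (sqrt (1 - p) * sqrt (1 - p)) * (sqrt (p ^ ?i) * sqrt (p ^ ?j))"
      by (simp only: real_sqrt_mult mult_ac)
    then show ?thesis using p by simp
  qed
  have q: "sqrt (p ^ i) = p powr (real i / 2)" for i
    using p by (simp add: powr_half_sqrt[symmetric] powr_realpow[symmetric] powr_powr)
  have "p ^ ?j / (sqrt (p ^ ?i) * sqrt (p ^ ?j)) = p powr (real ?j - (real ?i / 2 + real ?j / 2))"
  proof -
    have pj: "p ^ ?j = p powr real ?j" using p by (simp add: powr_realpow)
    show ?thesis unfolding q by (simp only: pj powr_diff powr_add)
  qed
  also have "real ?j - (real ?i / 2 + real ?j / 2) = \<bar>real ?i - real ?j\<bar> / 2"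
    using ij by (simp add: field_simps)
  finally have pw: "p ^ ?j / (sqrt (p ^ ?i) * sqrt (p ^ ?j)) = p powr (\<bar>real ?i - real ?j\<bar> / 2)" .
  have "(\<Sum>m=1..n. \<Sum>l=1..n. E (\<lambda>S. X m S $ k * X l S $ j))
      = real n * (p ^ ?j * (1 - p) * (\<Sum>v<?i. (?c + 2 * real v) * p ^ v) / ?s)"
    using row by simp
  also have "\<dots> = p ^ ?j / (sqrt (p ^ ?i) * sqrt (p ^ ?j)) * (\<Sum>v<?i. (?c + 2 * real v) * p ^ v)"
    unfolding s using p n_pos by simp
  also have "\<dots> = sigma p ?i ?j"
  proof -
    have "?c = \<bar>real ?i - real ?j\<bar> + 1" using ij by simp
    then show ?thesis unfolding pw sigma_def min_absorb1[OF ij] by (simp only:)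
  qed
  finally show ?thesis .
qed

lemma sigma_sym: "sigma p i j = sigma p j i"
  unfolding sigma_def by (simp add: abs_minus_commute min.commute)

lemma covariance:
  "(\<Sum>m=1..n. \<Sum>l=1..n. E (\<lambda>S. X m S $ k * X l S $ j)) = sigma p (idx k) (idx j)"
proof (cases "idx k \<le> idx j")
  case False
  have "(\<Sum>m=1..n. \<Sum>l=1..n. E (\<lambda>S. X m S $ k * X l S $ j)) = (\<Sum>l=1..n. \<Sum>m=1..n. E (\<lambda>S. X l S $ j * X m S $ k))"
    by (subst sum.swap) (simp add: mult.commute)
  then show ?thesis using covariance_le[of j k] False sigma_sym by simp
qed (rule covariance_le)

text \<open>Summands that are not neighbours are uncorrelated, so the restricted double sum in
  \<open>local_dependence_bound\<close> is already the full covariance. This makes the second-order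
  terms cancel exactly against those of the Gaussian.\<close>

lemma covariance_local:
  "(\<Sum>m=1..n. \<Sum>l\<in>D m. E (\<lambda>S. X m S $ k * X l S $ j)) = sigma p (idx k) (idx j)"
  unfolding covariance[symmetric]
proof (rule sum.cong[OF refl])
  fix m assume m: "m \<in> {1..n}"
  show "(\<Sum>l\<in>D m. E (\<lambda>S. X m S $ k * X l S $ j)) = (\<Sum>l=1..n. E (\<lambda>S. X m S $ k * X l S $ j))"
  proof (rule sum.mono_neutral_left)
    show "\<forall>l\<in>{1..n} - D m. E (\<lambda>S. X m S $ k * X l S $ j) = 0"
    proof
      fix l assume "l \<in> {1..n} - D m"
      then have "E (\<lambda>S. X m S $ k * X l S $ j) = E (\<lambda>S. X m S $ k) * E (\<lambda>S. X l S $ j)"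
        using summand_independent[of "window n m d" "{l}" "\<lambda>S. X m S $ k" "\<lambda>x. x $ j"] window_subset_I summand_local[of m]
        by auto
      then show "E (\<lambda>S. X m S $ k * X l S $ j) = 0" using E_summand[OF m] by simp
    qed
  qed auto
qed

lemma Sigma_mat_symmetric: "transpose (Sigma_mat p idx) = Sigma_mat p idx"
  by (simp add: transpose_def Sigma_mat_def vec_eq_iff sigma_sym)

text \<open>The quadratic form at x is the second moment of the scalar product of x with W, so no
  direct analysis of the entries \<open>sigma\<close> is called for.\<close>

lemma Sigma_mat_nonneg_definite: "nonneg_definite (Sigma_mat p idx)"
  unfolding nonneg_definite_def
proof
  fix x :: "real ^ 'd"
  have "x \<bullet> (Sigma_mat p idx *v x) = (\<Sum>k\<in>UNIV. \<Sum>j\<in>UNIV. x $ k * x $ j * (\<Sum>m=1..n. \<Sum>l=1..n. E (\<lambda>S. X m S $ k * X l S $ j)))"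
    unfolding covariance by (simp add: inner_vec_def matrix_vector_mult_def Sigma_mat_def sum_distrib_left mult_ac)
  also have "\<dots> = E (\<lambda>S. \<Sum>k\<in>UNIV. \<Sum>j\<in>UNIV. x $ k * x $ j * (\<Sum>m=1..n. \<Sum>l=1..n. X m S $ k * X l S $ j))"
    by (simp only: E.E_sum E.E_cmult)
  also have "\<dots> = E (\<lambda>S. (\<Sum>k\<in>UNIV. x $ k * (\<Sum>m=1..n. X m S $ k))\<^sup>2)"
  proof -
    have "(\<Sum>k\<in>UNIV. \<Sum>j\<in>UNIV. x $ k * x $ j * (\<Sum>m=1..n. \<Sum>l=1..n. X m S $ k * X l S $ j))
      = (\<Sum>k\<in>UNIV. \<Sum>j\<in>UNIV. (x $ k * (\<Sum>m=1..n. X m S $ k)) * (x $ j * (\<Sum>l=1..n. X l S $ j)))" for S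
      by (intro sum.cong refl) (simp only: sum_product[symmetric] mult_ac)
    also have "\<dots> S = (\<Sum>k\<in>UNIV. x $ k * (\<Sum>m=1..n. X m S $ k))\<^sup>2" for S
      by (simp only: power2_eq_square sum_product)
    finally show ?thesis by simp
  qed
  also have "0 \<le> \<dots>" by (rule E.E_nonneg) simp
  finally show "0 \<le> x \<bullet> (Sigma_mat p idx *v x)" .
qed

text \<open>The value for the longest run, which is the worst case since sqrt (p^i) decreases in i.
  Multiplied by n it is the reciprocal of p^(d/2) (1 - p)^(3/2) sqrt n.\<close>

definition third_moment_bound :: real where
  "third_moment_bound = 1 / (sqrt (real n) ^ 3 * sqrt (p ^ d) * sqrt (1 - p) ^ 3)"

text \<open>A centred indicator y has |y| \<le> 1, so |y|^3 \<le> y^2, and its variance q (1 - q) is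
  at most q = p^i. One factor sqrt q of the normalisation survives the cancellation. The square is
  linear in the indicator because an indicator equals its own square.\<close>

lemma third_moment:
  assumes m: "m \<in> {1..n}"
  shows "E (\<lambda>S. \<bar>X m S $ k\<bar> ^ 3) \<le> third_moment_bound"
proof -
  let ?q = "p ^ idx k" and ?A = "window n m (idx k)"
  let ?s = "sqrt (real n * ?q * (1 - p))"
  have q: "0 < ?q" "?q \<le> 1" using p by (auto intro: power_le_one)
  have s0: "?s > 0" using p n_pos q by simp
  have "\<bar>X m S $ k\<bar> ^ 3 \<le> 1 / ?s ^ 3 * ((1 - 2 * ?q) * of_bool (?A \<subseteq> S) + ?q\<^sup>2)" for S
  proof -
    let ?y = "of_bool (?A \<subseteq> S) - ?q"
    have y1: "\<bar>?y\<bar> \<le> 1" using q by auto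
    have "\<bar>?y\<bar> ^ 3 = \<bar>?y\<bar> * \<bar>?y\<bar>\<^sup>2" by (simp add: power2_eq_square power3_eq_cube)
    also have "\<dots> \<le> 1 * \<bar>?y\<bar>\<^sup>2" by (intro mult_right_mono y1) auto
    also have "\<dots> = (1 - 2 * ?q) * of_bool (?A \<subseteq> S) + ?q\<^sup>2" by (simp add: power2_eq_square algebra_simps)
    finally have "\<bar>?y\<bar> ^ 3 / ?s ^ 3 \<le> ((1 - 2 * ?q) * of_bool (?A \<subseteq> S) + ?q\<^sup>2) / ?s ^ 3"
      using s0 by (intro divide_right_mono) auto
    moreover have "\<bar>X m S $ k\<bar> ^ 3 = \<bar>?y\<bar> ^ 3 / ?s ^ 3"
      using s0 by (simp add: run_summand_def power_divide)
    ultimately show ?thesis by simp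
  qed
  then have "E (\<lambda>S. \<bar>X m S $ k\<bar> ^ 3) \<le> E (\<lambda>S. 1 / ?s ^ 3 * ((1 - 2 * ?q) * of_bool (?A \<subseteq> S) + ?q\<^sup>2))"
    by (rule E.E_mono)
  also have "\<dots> = 1 / ?s ^ 3 * ((1 - 2 * ?q) * ?q + ?q\<^sup>2)"
    using m idx_bounds[of k] n by (simp only: E.E_cmult E.E_add E.E_const E_window) (simp add: card_window)
  also have "\<dots> \<le> 1 / ?s ^ 3 * ?q"
    using s0 by (intro mult_left_mono) (auto simp: power2_eq_square algebra_simps)
  also have "\<dots> = 1 / (sqrt (real n) ^ 3 * sqrt ?q * sqrt (1 - p) ^ 3)"
  proof -
    have "?s ^ 3 = sqrt (real n) ^ 3 * (sqrt ?q) ^ 3 * sqrt (1 - p) ^ 3"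
      by (simp add: real_sqrt_mult power_mult_distrib)
    moreover have "?q = sqrt ?q * sqrt ?q" using q by simp
    ultimately show ?thesis using q p n_pos
      by (simp add: power3_eq_cube field_simps)
  qed
  also have "\<dots> \<le> third_moment_bound"
    unfolding third_moment_bound_def
  proof (intro divide_left_mono mult_right_mono mult_left_mono)
    show "sqrt (p ^ d) \<le> sqrt ?q" using p idx_bounds(2)[of k] by (simp add: power_decreasing)
  qed (use p n_pos in auto)
  finally show ?thesis .
qed

text \<open>Applies the local dependence estimate to x \<mapsto> g k (sin t x + y), whose
  derivatives gain a factor sin t by the chain rule; this is the sin t in front of the covariance
  term. The Lipschitz constant is entered as 2 C3 because \<open>g_taylor\<close> has no factor 1 /
  2.\<close>

lemma stein_bound:
  assumes B: "bounded_third_derivative h g H T C2 C3"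
  defines "W \<equiv> \<lambda>S. \<Sum>m=1..n. X m S"
  shows "\<bar>E (\<lambda>S. \<Sum>k\<in>UNIV. W S $ k * g k (sin t *\<^sub>R W S + y))
      - sin t * (\<Sum>k\<in>UNIV. \<Sum>j\<in>UNIV. Sigma_mat p idx $ k $ j * E (\<lambda>S. H j k (sin t *\<^sub>R W S + y)))\<bar>
    \<le> 32 * real d ^ 5 * C3 * (real n * third_moment_bound)"
proof -
  interpret B: bounded_third_derivative h g H T C2 C3 by (rule B)
  let ?g = "\<lambda>k x. g k (sin t *\<^sub>R x + y)" and ?H = "\<lambda>j k x. sin t * H j k (sin t *\<^sub>R x + y)"
  have l1: "(\<Sum>i\<in>UNIV. \<bar>(sin t *\<^sub>R v) $ i\<bar>) \<le> (\<Sum>i\<in>UNIV. \<bar>v $ i\<bar>)" for v :: "real ^ 'd"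
    by (intro sum_mono) (simp add: abs_mult mult_left_le_one_le)
  have T0: "0 \<le> third_moment_bound" using p by (simp add: third_moment_bound_def)
  have "\<bar>E (\<lambda>S. \<Sum>k\<in>UNIV. W S $ k * ?g k (W S))
      - (\<Sum>k\<in>UNIV. \<Sum>j\<in>UNIV. (\<Sum>m=1..n. \<Sum>l\<in>D m. E (\<lambda>S. X m S $ k * X l S $ j)) * E (\<lambda>S. ?H j k (W S)))\<bar>
    \<le> 4 * real (card {1..n}) * real CARD('d) ^ 3 * real (2 * d) ^ 2 * (2 * C3) * third_moment_bound"
    unfolding W_def
  proof (rule E.local_dependence_bound)
    show "card (D m) \<le> 2 * d" if "m \<in> {1..n}" for m
      by (rule card_overlapping_windows[OF that n])
    show "E (\<lambda>s. \<bar>X m s $ k\<bar> * \<bar>X l s $ j\<bar> * \<bar>X l' s $ i\<bar>) \<le> third_moment_bound"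
      "E (\<lambda>s. \<bar>X m s $ k\<bar> * \<bar>X l s $ j\<bar>) * E (\<lambda>s. \<bar>X l' s $ i\<bar>) \<le> third_moment_bound"
      if "m \<in> {1..n}" "l \<in> {1..n}" "l' \<in> {1..n}" for m l l' k j i
      using that by (rule E.third_moment_bounds[OF third_moment third_moment third_moment])+
    show "\<bar>?g k (x + v) - ?g k x - (\<Sum>j\<in>UNIV. v $ j * ?H j k x)\<bar> \<le> 2 * C3 / 2 * (\<Sum>j\<in>UNIV. \<bar>v $ j\<bar>)\<^sup>2" for k x v
    proof -
      have "\<bar>g k (sin t *\<^sub>R x + y + sin t *\<^sub>R v) - g k (sin t *\<^sub>R x + y)
          - (\<Sum>j\<in>UNIV. (sin t *\<^sub>R v) $ j * H j k (sin t *\<^sub>R x + y))\<bar> \<le> C3 * (\<Sum>i\<in>UNIV. \<bar>(sin t *\<^sub>R v) $ i\<bar>)\<^sup>2"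
        by (rule B.g_taylor)
      also have "\<dots> \<le> C3 * (\<Sum>i\<in>UNIV. \<bar>v $ i\<bar>)\<^sup>2"
        by (intro mult_left_mono power_mono l1 B.C_nonneg sum_nonneg) auto
      finally show ?thesis by (simp add: scaleR_add_right add_ac mult_ac)
    qed
    show "\<bar>?H j k (x + v) - ?H j k x\<bar> \<le> 2 * C3 * (\<Sum>i\<in>UNIV. \<bar>v $ i\<bar>)" for j k x v
    proof -
      have "\<bar>?H j k (x + v) - ?H j k x\<bar> = \<bar>sin t\<bar> * \<bar>H j k (sin t *\<^sub>R x + y + sin t *\<^sub>R v) - H j k (sin t *\<^sub>R x + y)\<bar>"
        by (simp add: scaleR_add_right add_ac flip: abs_mult right_diff_distrib)
      also have "\<dots> \<le> 1 * (C3 * (\<Sum>i\<in>UNIV. \<bar>(sin t *\<^sub>R v) $ i\<bar>))"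
        by (intro mult_mono B.H_lipschitz) auto
      also have "\<dots> \<le> 1 * (C3 * (\<Sum>i\<in>UNIV. \<bar>v $ i\<bar>))"
        by (intro mult_left_mono l1 B.C_nonneg) auto
      also have "\<dots> \<le> 2 * C3 * (\<Sum>i\<in>UNIV. \<bar>v $ i\<bar>)"
        using B.C_nonneg by (simp add: sum_nonneg mult_right_mono)
      finally show ?thesis .
    qed
  qed (use summand_indep1 summand_indep2 T0 B.C_nonneg in auto)
  moreover have "(\<Sum>k\<in>UNIV. \<Sum>j\<in>UNIV. (\<Sum>m=1..n. \<Sum>l\<in>D m. E (\<lambda>S. X m S $ k * X l S $ j)) * E (\<lambda>S. ?H j k (W S)))
     = sin t * (\<Sum>k\<in>UNIV. \<Sum>j\<in>UNIV. Sigma_mat p idx $ k $ j * E (\<lambda>S. H j k (sin t *\<^sub>R W S + y)))"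
    unfolding covariance_local E.E_cmult by (simp add: Sigma_mat_def sum_distrib_left mult_ac)
  moreover have "4 * real (card {1..n}) * real CARD('d) ^ 3 * real (2 * d) ^ 2 * (2 * C3) * third_moment_bound
      = 32 * real d ^ 5 * C3 * (real n * third_moment_bound)"
    by (simp add: d power2_eq_square eval_nat_numeral)
  ultimately show ?thesis by (simp only:)
qed

end

section \<open>Transfer to the given probability spaces\<close>

text \<open>As the probabilities of 0 and 1 add up to 1, almost surely every trial takes one of
  these values. Up to a null set the space is then partitioned into the events A S on which exactly
  the trials in S succeed, and independence gives A S the product weight. Accordingly f has to be
  described by F only where all trials are 0 or 1.\<close>

lemma bernoulli_expectation:
  fixes M :: "'a measure" and \<xi> :: "'i \<Rightarrow> 'a \<Rightarrow> real"
  assumes M: "prob_space M" and I: "finite I" "I \<noteq> {}"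
    and indep: "prob_space.indep_vars M (\<lambda>_. borel) \<xi> I"
    and one: "\<And>m. m \<in> I \<Longrightarrow> measure M {\<omega> \<in> space M. \<xi> m \<omega> = 1} = p"
    and zero: "\<And>m. m \<in> I \<Longrightarrow> measure M {\<omega> \<in> space M. \<xi> m \<omega> = 0} = 1 - p"
    and f: "f \<in> borel_measurable M"
    and F: "\<And>\<omega>. (\<And>m. m \<in> I \<Longrightarrow> \<xi> m \<omega> = 0 \<or> \<xi> m \<omega> = 1) \<Longrightarrow> f \<omega> = F {m \<in> I. \<xi> m \<omega> = 1}"
  shows "(\<integral>\<omega>. f \<omega> \<partial>M) = bern_ex I p F"
proof -
  interpret prob_space M by (rule M)
  have meas[measurable]: "\<xi> m \<in> borel_measurable M" if "m \<in> I" for m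
    using indep that by (auto simp: indep_vars_def)
  have "AE \<omega> in M. \<xi> m \<omega> = 0 \<or> \<xi> m \<omega> = 1" if m: "m \<in> I" for m
  proof -
    let ?A0 = "{\<omega> \<in> space M. \<xi> m \<omega> = 0}" and ?A1 = "{\<omega> \<in> space M. \<xi> m \<omega> = 1}"
    have sets: "?A0 \<in> sets M" "?A1 \<in> sets M" using meas[OF m] by measurable
    have "prob (?A0 \<union> ?A1) = prob ?A0 + prob ?A1"
      using sets by (intro finite_measure_Union) auto
    then have "prob (?A0 \<union> ?A1) = 1" using one[OF m] zero[OF m] by simp
    then have "AE \<omega> in M. \<omega> \<in> ?A0 \<union> ?A1" using sets by (subst (asm) prob_eq_1) auto
    then show ?thesis by (rule AE_mp) auto
  qed
  then have ae: "AE \<omega> in M. \<forall>m\<in>I. \<xi> m \<omega> = 0 \<or> \<xi> m \<omega> = 1"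
    using I by (intro AE_finite_allI) auto
  let ?v = "\<lambda>S m. if m \<in> S then 1 else 0 :: real"
  define A where "A S = (\<Inter>m\<in>I. \<xi> m -` {?v S m} \<inter> space M)" for S
  have A_sets: "A S \<in> sets M" for S
    unfolding A_def using I by (intro sets.finite_INT measurable_sets[OF meas]) auto
  have A_prob: "prob (A S) = bern_weight I p S" if "S \<subseteq> I" for S
  proof -
    have "prob (A S) = (\<Prod>m\<in>I. prob (\<xi> m -` {?v S m} \<inter> space M))"
      unfolding A_def using I by (intro indep_varsD[OF indep]) auto
    also have "\<dots> = (\<Prod>m\<in>I. if m \<in> S then p else 1 - p)"
    proof (rule prod.cong[OF refl])
      fix m assume m: "m \<in> I"
      have "\<xi> m -` {c} \<inter> space M = {\<omega> \<in> space M. \<xi> m \<omega> = c}" for c by auto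
      then show "prob (\<xi> m -` {?v S m} \<inter> space M) = (if m \<in> S then p else 1 - p)"
        using one[OF m] zero[OF m] by simp
    qed
    finally show ?thesis using bern_weight_prod[OF I(1) that] by simp
  qed
  have "AE \<omega> in M. f \<omega> = (\<Sum>S\<in>Pow I. indicator (A S) \<omega> * F S)"
    using ae AE_space
  proof eventually_elim
    fix \<omega> assume v: "\<forall>m\<in>I. \<xi> m \<omega> = 0 \<or> \<xi> m \<omega> = 1" and sp: "\<omega> \<in> space M"
    let ?S = "{m \<in> I. \<xi> m \<omega> = 1}"
    have "\<omega> \<in> A S \<longleftrightarrow> S = ?S" if "S \<in> Pow I" for S
      using v sp that I(2) unfolding A_def by (auto split: if_splits)
    then have "(\<Sum>S\<in>Pow I. indicator (A S) \<omega> * F S) = (\<Sum>S\<in>Pow I. if S = ?S then F S else 0)"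
      by (intro sum.cong refl) (simp add: indicator_def)
    also have "\<dots> = F ?S" using I by (simp add: sum.delta)
    finally show "f \<omega> = (\<Sum>S\<in>Pow I. indicator (A S) \<omega> * F S)" using F v by simp
  qed
  then have "(\<integral>\<omega>. f \<omega> \<partial>M) = (\<integral>\<omega>. (\<Sum>S\<in>Pow I. indicator (A S) \<omega> * F S) \<partial>M)"
    using f A_sets by (intro integral_cong_AE) auto
  also have "\<dots> = (\<Sum>S\<in>Pow I. prob (A S) * F S)"
  proof -
    have "integrable M (indicat_real (A S))" for S
      by (rule integrable_real_indicator[OF A_sets]) (simp add: less_top[symmetric])
    then show ?thesis using A_sets by simp
  qed
  also have "\<dots> = bern_ex I p F" using A_prob by (auto simp: bern_ex_def intro!: sum.cong)
  finally show ?thesis .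
qed

context runs
begin

lemma runs_W_eq_sum:
  assumes "\<And>m. m \<in> {1..n} \<Longrightarrow> \<xi> m \<omega> = 0 \<or> \<xi> m \<omega> = 1"
  shows "runs_W \<xi> n p idx \<omega> = (\<Sum>m=1..n. X m {m \<in> {1..n}. \<xi> m \<omega> = 1})"
proof -
  let ?S = "{m \<in> {1..n}. \<xi> m \<omega> = 1}"
  have "(\<Prod>k<i. \<xi> (cyc n (m + k)) \<omega>) = of_bool (window n m i \<subseteq> ?S)" for m i
  proof (induction i)
    case (Suc i)
    have "cyc n (m + i) \<in> {1..n}" using window_subset_I[of m "Suc i"] by (auto simp: window_def)
    moreover have "window n m (Suc i) = insert (cyc n (m + i)) (window n m i)"
      by (auto simp: window_def lessThan_Suc)
    ultimately show ?case using Suc assms[of "cyc n (m + i)"] by auto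
  qed (simp add: window_def)
  then show ?thesis
    by (simp add: vec_eq_iff runs_W_def runs_V_def run_summand_def sum_divide_distrib)
qed

lemma runs_W_measurable:
  assumes "\<And>m. m \<in> {1..n} \<Longrightarrow> \<xi> m \<in> borel_measurable M"
  shows "runs_W \<xi> n p idx \<in> borel_measurable M"
proof (subst borel_measurable_euclidean_space, intro ballI)
  fix b :: "real ^ 'd" assume "b \<in> Basis"
  then obtain i where b: "b = axis i 1" by (auto simp: Basis_vec_def)
  have "cyc n m \<in> {1..n}" for m using n_pos by (simp add: cyc_def Suc_le_eq)
  then show "(\<lambda>\<omega>. runs_W \<xi> n p idx \<omega> \<bullet> b) \<in> borel_measurable M"
    unfolding b runs_W_def runs_V_def inner_axis
    using assms by (auto intro!: borel_measurable_divide borel_measurable_sum borel_measurable_diff borel_measurable_prod)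
qed

lemma runs_normal_approximation:
  assumes M: "prob_space M" and N: "prob_space N"
    and indep: "prob_space.indep_vars M (\<lambda>_. borel) \<xi> {1..n}"
    and one: "\<And>m. m \<in> {1..n} \<Longrightarrow> measure M {\<omega> \<in> space M. \<xi> m \<omega> = 1} = p"
    and zero: "\<And>m. m \<in> {1..n} \<Longrightarrow> measure M {\<omega> \<in> space M. \<xi> m \<omega> = 0} = 1 - p"
    and Z: "std_normal_vector N Z" and B: "bounded_third_derivative h g H T C2 C3"
  shows "\<bar>(\<integral>\<omega>. h (runs_W \<xi> n p idx \<omega>) \<partial>M) - (\<integral>\<omega>. h (mat_sqrt (Sigma_mat p idx) *v Z \<omega>) \<partial>N)\<bar>
    \<le> 64 * real d ^ 5 * C3 * (real n * third_moment_bound)"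
proof -
  interpret B: bounded_third_derivative h g H T C2 C3 by (rule B)
  interpret prob_space M by (rule M)
  let ?R = "mat_sqrt (Sigma_mat p idx)" and ?W = "\<lambda>S. \<Sum>m=1..n. X m S"
  let ?B = "32 * real d ^ 5 * C3 * (real n * third_moment_bound)"
  have R: "?R ** transpose ?R = Sigma_mat p idx"
    using mat_sqrt_properties[OF Sigma_mat_symmetric Sigma_mat_nonneg_definite] by simp
  have "\<xi> m \<in> borel_measurable M" if "m \<in> {1..n}" for m
    using indep that by (auto simp: indep_vars_def)
  then have hm: "(\<lambda>\<omega>. h (runs_W \<xi> n p idx \<omega>)) \<in> borel_measurable M"
    by (intro measurable_compose[OF runs_W_measurable borel_measurable_continuous_onI[OF B.continuous_derivatives(1)]])
  have "(\<integral>\<omega>. h (runs_W \<xi> n p idx \<omega>) \<partial>M) = E (\<lambda>S. h (?W S))"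
  proof (rule bernoulli_expectation[OF M _ _ indep one zero])
    show "h (runs_W \<xi> n p idx \<omega>) = h (?W {m \<in> {1..n}. \<xi> m \<omega> = 1})"
      if "\<And>m. m \<in> {1..n} \<Longrightarrow> \<xi> m \<omega> = 0 \<or> \<xi> m \<omega> = 1" for \<omega>
      using runs_W_eq_sum[of \<xi> \<omega>, OF that] by (rule arg_cong)
  qed (use n_pos hm in auto)
  moreover have "\<bar>E (\<lambda>S. h (?W S)) - (\<integral>\<omega>. h (?R *v Z \<omega>) \<partial>N)\<bar> \<le> ?B * (pi / 2)"
    unfolding bern_ex_def
  proof (rule B.interpolation_bound[OF N Z])
    show "sum (bern_weight {1..n} p) (Pow {1..n}) = 1" by (rule bern_weight_sum) simp
  qed (use stein_bound[OF B] in \<open>simp only: R bern_ex_def\<close>)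
  \<comment> \<open>The crude bound pi < 4 suffices and turns 32 into 64.\<close>
  moreover have "?B * (pi / 2) \<le> ?B * 2"
    using B.C_nonneg p pi_less_4 by (intro mult_left_mono) (auto simp: third_moment_bound_def)
  ultimately have "\<bar>(\<integral>\<omega>. h (runs_W \<xi> n p idx \<omega>) \<partial>M) - (\<integral>\<omega>. h (?R *v Z \<omega>) \<partial>N)\<bar> \<le> ?B * 2"
    by linarith
  then show ?thesis by (simp add: mult_ac)
qed

end

section \<open>Partial derivatives of Frechet differentiable functions, and the conclusion\<close>

lemma partial_eq_derivative:
  assumes "(h has_derivative D) (at x)"
  shows "partial i h x = D (axis i 1)"
proof -
  have "((\<lambda>t. x + t *\<^sub>R axis i 1) has_derivative (\<lambda>t. t *\<^sub>R axis i 1)) (at (0::real))"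
    by (auto intro!: derivative_eq_intros)
  from has_derivative_compose[OF this, of h D] assms
  have "((\<lambda>t. h (x + t *\<^sub>R axis i 1)) has_derivative (\<lambda>t. D (t *\<^sub>R axis i 1))) (at 0)" by simp
  moreover have "(\<lambda>t. D (t *\<^sub>R axis i 1)) = (*) (D (axis i 1))"
    using linear_scale[OF has_derivative_linear[OF assms]] by (simp add: fun_eq_iff mult.commute)
  ultimately show ?thesis
    unfolding partial_def by (intro DERIV_imp_deriv) (simp add: has_field_derivative_def)
qed

lemma linear_coordinates:
  fixes f :: "real ^ 'd::finite \<Rightarrow> real"
  assumes "linear f"
  shows "f v = (\<Sum>k\<in>UNIV. v $ k * f (axis k 1))"
proof -
  have "f v = f (\<Sum>k\<in>UNIV. v $ k *\<^sub>R axis k 1)"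
    using basis_expansion[of v] by (simp add: scalar_mult_eq_scaleR)
  then show ?thesis using assms by (simp add: linear_sum linear_scale)
qed

text \<open>Iterated \<open>partial\<close> is built from \<open>deriv\<close>, which says nothing
  until differentiability is known. Evaluating a map-valued derivative at axis vectors is bounded
  linear and so commutes with differentiation; each order thus identifies the next partial
  derivative with a Frechet derivative.\<close>

lemma three_times_differentiable_partials:
  fixes h :: "real ^ 'd::finite \<Rightarrow> real"
  assumes "three_times_differentiable h"
  shows "(h has_derivative (\<lambda>v. \<Sum>k\<in>UNIV. v $ k * partial k h x)) (at x)"
    and "(partial k h has_derivative (\<lambda>v. \<Sum>j\<in>UNIV. v $ j * partial j (partial k h) x)) (at x)"
    and "(partial j (partial k h) has_derivative (\<lambda>v. \<Sum>i\<in>UNIV. v $ i * partial i (partial j (partial k h)) x)) (at x)"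
proof -
  obtain h1 :: "(real ^ 'd) \<Rightarrow> ((real ^ 'd) \<Rightarrow>\<^sub>L real)"
    and h2 :: "(real ^ 'd) \<Rightarrow> ((real ^ 'd) \<Rightarrow>\<^sub>L ((real ^ 'd) \<Rightarrow>\<^sub>L real))"
    and h3 :: "(real ^ 'd) \<Rightarrow> ((real ^ 'd) \<Rightarrow>\<^sub>L ((real ^ 'd) \<Rightarrow>\<^sub>L ((real ^ 'd) \<Rightarrow>\<^sub>L real)))"
    where *: "\<forall>x. (h has_derivative blinfun_apply (h1 x)) (at x) \<and>
        (h1 has_derivative blinfun_apply (h2 x)) (at x) \<and> (h2 has_derivative blinfun_apply (h3 x)) (at x)"
    using assms unfolding three_times_differentiable_def by (elim exE) (rule that)
  note h1 = *[THEN spec, THEN conjunct1] and h2 = *[THEN spec, THEN conjunct2, THEN conjunct1]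
    and h3 = *[THEN spec, THEN conjunct2, THEN conjunct2]
  have expand: "(f has_derivative (\<lambda>v. \<Sum>k\<in>UNIV. v $ k * partial k f x)) (at x)"
    if "(f has_derivative D) (at x)" for f :: "real ^ 'd \<Rightarrow> real" and D x
  proof -
    have "D = (\<lambda>v. \<Sum>k\<in>UNIV. v $ k * partial k f x)"
      unfolding partial_eq_derivative[OF that]
      by (rule ext) (rule linear_coordinates[OF has_derivative_linear[OF that]])
    with that show ?thesis by simp
  qed
  show "(h has_derivative (\<lambda>v. \<Sum>k\<in>UNIV. v $ k * partial k h x)) (at x)"
    by (rule expand[OF h1])
  have p1: "partial k h = (\<lambda>x. h1 x (axis k 1))" for k
    using partial_eq_derivative[OF h1] by (simp add: fun_eq_iff)
  have d1: "(partial k h has_derivative (\<lambda>v. h2 x v (axis k 1))) (at x)" for k x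
    unfolding p1 by (rule bounded_linear.has_derivative[OF blinfun.bounded_linear_left h2])
  show "(partial k h has_derivative (\<lambda>v. \<Sum>j\<in>UNIV. v $ j * partial j (partial k h) x)) (at x)"
    by (rule expand[OF d1])
  have p2: "partial j (partial k h) = (\<lambda>x. h2 x (axis j 1) (axis k 1))" for j k
    using partial_eq_derivative[OF d1] by (simp add: fun_eq_iff)
  have d2: "(partial j (partial k h) has_derivative (\<lambda>v. h3 x v (axis j 1) (axis k 1))) (at x)" for j k x
    unfolding p2
    by (rule bounded_linear.has_derivative[OF blinfun.bounded_linear_left
          bounded_linear.has_derivative[OF blinfun.bounded_linear_left h3]])
  show "(partial j (partial k h) has_derivative (\<lambda>v. \<Sum>i\<in>UNIV. v $ i * partial i (partial j (partial k h)) x)) (at x)"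
    by (rule expand[OF d2])
qed

lemma seminorm2_upper: "ereal \<bar>partial i (partial j h) x\<bar> \<le> seminorm2 h"
  unfolding seminorm2_def
  by (rule order_trans[OF _ SUP_upper[of i]], rule order_trans[OF _ SUP_upper[of j]], rule SUP_upper[of x]) auto

lemma seminorm3_upper: "ereal \<bar>partial i (partial j (partial k h)) x\<bar> \<le> seminorm3 h"
  unfolding seminorm3_def
  by (rule order_trans[OF _ SUP_upper[of i]], rule order_trans[OF _ SUP_upper[of j]],
      rule order_trans[OF _ SUP_upper[of k]], rule SUP_upper[of x]) auto

theorem theorem4p1:
  fixes M :: "'a measure" and N :: "'b measure"
    and \<xi> :: "nat \<Rightarrow> 'a \<Rightarrow> real" and Z :: "'b \<Rightarrow> real ^ 'd::finite"
    and idx :: "'d \<Rightarrow> nat" and n :: nat and p :: real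
    and h :: "real ^ 'd \<Rightarrow> real"
  assumes "prob_space M" and "prob_space N"
    and "CARD('d) > 1"
    and "bij_betw idx UNIV {1..CARD('d)}"
    and "0 < p" and "p < 1"
    and "n > 2 * CARD('d) - 1"
    and "prob_space.indep_vars M (\<lambda>_. borel) \<xi> {1..n}"
    and "\<And>m. m \<in> {1..n} \<Longrightarrow> measure M {\<omega> \<in> space M. \<xi> m \<omega> = 1} = p"
    and "\<And>m. m \<in> {1..n} \<Longrightarrow> measure M {\<omega> \<in> space M. \<xi> m \<omega> = 0} = 1 - p"
    and "std_normal_vector N Z"
    and "three_times_differentiable h"
  shows "ereal \<bar>(\<integral>\<omega>. h (runs_W \<xi> n p idx \<omega>) \<partial>M)
               - (\<integral>\<omega>. h (mat_sqrt (Sigma_mat p idx) *v Z \<omega>) \<partial>N)\<bar>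
    \<le> (ereal (416 * real CARD('d) powr (7/2)) * seminorm2 h
        + ereal (960 * real CARD('d) ^ 5) * seminorm3 h)
      / ereal (p powr (real CARD('d) / 2) * (1 - p) powr (3/2) * sqrt (real n))"
    (is "ereal ?L \<le> (ereal ?a * _ + ereal ?b * _) / ereal ?c")
proof -
  interpret runs n "CARD('d)" p idx
    by unfold_locales (use assms in auto)
  have c: "?c > 0" using p n_pos by simp
  have a: "?a > 0" and b: "?b > 0" using d_pos by auto
  \<comment> \<open>A supremum of absolute values over nonempty index sets; \<open>undefined\<close>
    serves as an arbitrary index and point.\<close>
  have nn: "0 \<le> seminorm2 h" "0 \<le> seminorm3 h"
    by (rule order_trans[OF _ seminorm2_upper[of undefined undefined h undefined]], simp,
        rule order_trans[OF _ seminorm3_upper[of undefined undefined undefined h undefined]], simp)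
  show ?thesis
  proof (cases "seminorm2 h = \<infinity> \<or> seminorm3 h = \<infinity>")
    case True
    \<comment> \<open>Positive coefficients and nonnegative seminorms rule out both 0 times infinity
      and infinity minus infinity.\<close>
    have "ereal ?a * seminorm2 h + ereal ?b * seminorm3 h = \<infinity>"
      using True nn a b by (cases "seminorm2 h"; cases "seminorm3 h") auto
    moreover have "\<infinity> / ereal ?c = \<infinity>" using c by (simp add: divide_ereal_def)
    ultimately show ?thesis by (simp only: ereal_less_eq)
  next
    case False
    obtain C2 where C2: "seminorm2 h = ereal C2" using False nn by (cases "seminorm2 h") auto
    obtain C3 where C3: "seminorm3 h = ereal C3" using False nn by (cases "seminorm3 h") auto
    have "bounded_third_derivative h (\<lambda>k. partial k h) (\<lambda>j k. partial j (partial k h))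
        (\<lambda>i j k. partial i (partial j (partial k h))) C2 C3"
      using three_times_differentiable_partials[OF assms(12)] seminorm2_upper[of _ _ h] seminorm3_upper[of _ _ _ h]
      unfolding C2 C3 by unfold_locales auto
    from runs_normal_approximation[OF assms(1,2,8,9,10,11) this]
    have "?L \<le> 64 * real CARD('d) ^ 5 * C3 * (real n * third_moment_bound)" by simp
    also have "real n * third_moment_bound = 1 / ?c"
    proof -
      have "sqrt (p ^ CARD('d)) = p powr (real CARD('d) / 2)"
        using p by (simp add: powr_half_sqrt[symmetric] powr_realpow[symmetric] powr_powr)
      moreover have "sqrt (1 - p) ^ 3 = (1 - p) powr (3 / 2)"
        using p by (simp add: powr_half_sqrt[symmetric] powr_realpow[symmetric] powr_powr)
      moreover have "real n = sqrt (real n) * sqrt (real n)" by simp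
      ultimately show ?thesis
        using p n_pos unfolding third_moment_bound_def
        by (simp add: power3_eq_cube)
    qed
    also have "64 * real CARD('d) ^ 5 * C3 * (1 / ?c) \<le> (?a * C2 + ?b * C3) / ?c"
    proof -
      \<comment> \<open>The estimate obtained has only a third-order term; the slack from 64 to 960
        and the nonnegative second-order term give the stated form.\<close>
      have "0 \<le> ?a * C2" "0 \<le> real CARD('d) ^ 5 * C3" using nn C2 C3 a by auto
      then have "64 * (real CARD('d) ^ 5 * C3) \<le> ?a * C2 + 960 * (real CARD('d) ^ 5 * C3)" by linarith
      then have "64 * real CARD('d) ^ 5 * C3 \<le> ?a * C2 + ?b * C3" by (simp only: mult.assoc)
      then show ?thesis using c by (simp add: divide_right_mono)
    qed
    finally have "?L \<le> (?a * C2 + ?b * C3) / ?c" .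
    moreover have "(ereal ?a * ereal C2 + ereal ?b * ereal C3) / ereal ?c = ereal ((?a * C2 + ?b * C3) / ?c)"
      using c by (simp only: times_ereal.simps plus_ereal.simps ereal_divide less_irrefl if_False less_imp_neq[THEN not_sym])
    ultimately show ?thesis unfolding C2 C3 by (simp only: ereal_less_eq)
  qed
qed

end
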